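(* Suppose that the random vector $a$ in $\mathbf{R}^n$ has distribution density $\rho_0(x)\in L_2(\mathbf{R}^n)$, the function $f:\mathbf{R}^n\times\mathbf{R}^m\times[0,T]\to\mathbf{R}^n$ satisfies condition (I) stated in the context, $\varphi(x,u,t)\equiv\varphi(x,t)\in L^1([0,T]\to L_2(\mathbf{R}^n))$ is independent of $u$ (and Lebesgue measurable), and the set $\Delta$ is compact in $\mathbf{R}^m$. Then the problem $$\frac{dy}{dt}(t)=f[y(t),u(t),t],\qquad y(0)=a,\qquad \Phi[u(\cdot)]=M\int_0^T\varphi[y(t),t]\,dt\to\min_{u(\cdot)}$$ has an optimal control $\hat u(\cdot)$ in $\mathscr{U}_R$, i.e. there is $\hat u(\cdot)\in\mathscr{U}_R$ with $\Phi[\hat u(\cdot)]\le\Phi[u(\cdot)]$ for all $u(\cdot)\in\mathscr{U}_R$.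
   Context: Fix $T>0$; $M$ denotes expectation; $\Delta\subset\mathbf{R}^m$ is a given (nonempty) set. Condition (I): $f$ is measurable, satisfies a Lipschitz condition in $x\in\mathbf{R}^n$ and $u\in\Delta$ uniformly in $t$, and, together with its partial $x$-derivatives up to second order inclusive (which exist for each $u,t$), is bounded uniformly in $x,u,t$; moreover $f(x,u,t)$ and $\partial f(x,u,t)/\partial x$ are continuous in $t$ for each $x,u$. Relaxed controls: for compact $\Delta$, $C^*(\Delta)$ is the dual of the Banach space $C(\Delta\to\mathbf{R})$, endowed with the weak norm (a norm inducing the weak-* topology on bounded sets), and $\mathrm{rpm}(\Delta)\subset C^*(\Delta)$ is the set of regular Borel probability measures on $\Delta$. $\mathscr{U}_R$ is the class of $u\in L^\infty([0,T]\to C^*(\Delta))$ with $u(t)\in\mathrm{rpm}(\Delta)$ for almost all $t$ (measurability means that $t\mapsto\int_\Delta\alpha(v)\,u(t,dv)$ is measurable for every $\alpha\in C(\Delta\to\mathbf{R})$). For $u\in\mathrm{rpm}(\Delta)$ one puts $f(x,u,t)=\int_\Delta f(x,v,t)\,u(dv)$; for $u(\cdot)\in\mathscr{U}_R$ the equation is understood in this sense. *)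

theory Defs
  imports "HOL-Probability.Probability"
begin

definition has_partial :: "'n::finite \<Rightarrow> (real^'n \<Rightarrow> 'b::real_normed_vector) \<Rightarrow> real^'n \<Rightarrow> bool" where
  "has_partial j g x \<longleftrightarrow> (\<lambda>s::real. g (x + s *\<^sub>R axis j 1)) differentiable (at 0)"

definition partial :: "'n::finite \<Rightarrow> (real^'n \<Rightarrow> 'b::real_normed_vector) \<Rightarrow> real^'n \<Rightarrow> 'b" where
  "partial j g x = vector_derivative (\<lambda>s::real. g (x + s *\<^sub>R axis j 1)) (at 0)"

(* Condition (I).  Everything except the measurability of f on its whole domain is required only
   for controls u in Delta and times t in [0,T]. *)
definition condition_I ::
    "(real^'m::finite) set \<Rightarrow> real \<Rightarrow> (real^'n::finite \<Rightarrow> real^'m \<Rightarrow> real \<Rightarrow> real^'n) \<Rightarrow> bool" where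
  "condition_I \<Delta> T f \<longleftrightarrow>
     (\<lambda>(x, u, t). f x u t) \<in> borel_measurable (lebesgue_on (UNIV \<times> UNIV \<times> {0..T})) \<and>
     (\<exists>L. \<forall>t\<in>{0..T}. L-lipschitz_on (UNIV \<times> \<Delta>) (\<lambda>(x, u). f x u t)) \<and>
     (\<forall>u\<in>\<Delta>. \<forall>t\<in>{0..T}. \<forall>x j.
        has_partial j (\<lambda>z. f z u t) x \<and>
        (\<forall>k. has_partial k (partial j (\<lambda>z. f z u t)) x)) \<and>
     (\<exists>C. \<forall>u\<in>\<Delta>. \<forall>t\<in>{0..T}. \<forall>x.
        norm (f x u t) \<le> C \<and>
        (\<forall>j. norm (partial j (\<lambda>z. f z u t) x) \<le> C) \<and>
        (\<forall>j k. norm (partial k (partial j (\<lambda>z. f z u t)) x) \<le> C)) \<and>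
     (\<forall>u\<in>\<Delta>. \<forall>x.
        continuous_on {0..T} (\<lambda>t. f x u t) \<and>
        (\<forall>j. continuous_on {0..T} (\<lambda>t. partial j (\<lambda>z. f z u t) x)))"

definition in_L2 :: "('a::euclidean_space \<Rightarrow> real) \<Rightarrow> bool" where
  "in_L2 g \<longleftrightarrow> g \<in> borel_measurable lebesgue \<and> integrable lebesgue (\<lambda>x. (g x)\<^sup>2)"

definition L2_norm :: "('a::euclidean_space \<Rightarrow> real) \<Rightarrow> real" where
  "L2_norm g = sqrt (LINT x|lebesgue. (g x)\<^sup>2)"

(* Elements of the Bochner space of integrable maps from [0,T] to the real L2 space over R^n,
   given by jointly Lebesgue measurable representatives. *)
definition in_L1_L2 :: "real \<Rightarrow> ('a::euclidean_space \<Rightarrow> real \<Rightarrow> real) \<Rightarrow> bool" where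
  "in_L1_L2 T \<phi> \<longleftrightarrow>
     (\<lambda>(x, t). \<phi> x t) \<in> borel_measurable (lebesgue_on (UNIV \<times> {0..T})) \<and>
     (AE t in lebesgue_on {0..T}. in_L2 (\<lambda>x. \<phi> x t)) \<and>
     integrable (lebesgue_on {0..T}) (\<lambda>t. L2_norm (\<lambda>x. \<phi> x t))"

(* Regular Borel probability measures on Delta, as measures whose space is Delta itself. *)
definition rpm :: "'a::topological_space set \<Rightarrow> 'a measure set" where
  "rpm \<Delta> = {\<mu>. sets \<mu> = sets (restrict_space borel \<Delta>) \<and> prob_space \<mu> \<and>
     (\<forall>A\<in>sets \<mu>.
        emeasure \<mu> A = (SUP K\<in>{K. K \<subseteq> A \<and> compact K}. emeasure \<mu> K) \<and>
        emeasure \<mu> A = (INF U\<in>{U. A \<subseteq> U \<and> openin (top_of_set \<Delta>) U}. emeasure \<mu> U))}"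

(* Representatives of the classes of relaxed controls.  A probability measure has norm 1 in the
   dual of C(Delta), so essential boundedness is automatic. *)
definition relaxed_controls ::
    "'a::topological_space set \<Rightarrow> real \<Rightarrow> (real \<Rightarrow> 'a measure) set" where
  "relaxed_controls \<Delta> T = {u.
     (\<forall>\<alpha>::'a \<Rightarrow> real. continuous_on \<Delta> \<alpha> \<longrightarrow>
        (\<lambda>t. LINT v|u t. \<alpha> v) \<in> borel_measurable (lebesgue_on {0..T})) \<and>
     (AE t in lebesgue_on {0..T}. u t \<in> rpm \<Delta>)}"

definition relaxed_rhs ::
    "(real^'n::finite \<Rightarrow> 'a \<Rightarrow> real \<Rightarrow> real^'n) \<Rightarrow> real^'n \<Rightarrow> 'a measure \<Rightarrow> real \<Rightarrow> real^'n" where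
  "relaxed_rhs f x \<mu> t = (LINT v|\<mu>. f x v t)"

(* Solutions in the sense of Caratheodory: u depends only measurably on time, so the
   differential equation is understood in integrated form. *)
definition solves ::
    "(real^'n::finite \<Rightarrow> 'a \<Rightarrow> real \<Rightarrow> real^'n) \<Rightarrow> real \<Rightarrow> (real \<Rightarrow> 'a measure) \<Rightarrow>
     real^'n \<Rightarrow> (real \<Rightarrow> real^'n) \<Rightarrow> bool" where
  "solves f T u x\<^sub>0 z \<longleftrightarrow>
     (\<forall>t\<in>{0..T}.
        integrable (lebesgue_on {0..t}) (\<lambda>s. relaxed_rhs f (z s) (u s) s) \<and>
        z t = x\<^sub>0 + (LINT s|lebesgue_on {0..t}. relaxed_rhs f (z s) (u s) s))"

(* Under condition (I), for compact Delta and a relaxed control u, a solution exists and any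
   two solutions agree on [0,T]; values outside [0,T] are never used. *)
definition trajectory ::
    "(real^'n::finite \<Rightarrow> 'a \<Rightarrow> real \<Rightarrow> real^'n) \<Rightarrow> real \<Rightarrow> (real \<Rightarrow> 'a measure) \<Rightarrow>
     real^'n \<Rightarrow> real \<Rightarrow> real^'n" where
  "trajectory f T u x\<^sub>0 = (SOME z. solves f T u x\<^sub>0 z)"

(* The cost functional.  Since phi is only Lebesgue measurable, the inner integral is in general
   measurable in \<omega> only up to P-null sets, hence the completion of P. *)
definition cost ::
    "'w measure \<Rightarrow> ('w \<Rightarrow> real^'n::finite) \<Rightarrow>
     (real^'n \<Rightarrow> 'a \<Rightarrow> real \<Rightarrow> real^'n) \<Rightarrow> (real^'n \<Rightarrow> real \<Rightarrow> real) \<Rightarrow> real \<Rightarrow>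
     (real \<Rightarrow> 'a measure) \<Rightarrow> real" where
  "cost P a f \<phi> T u =
     (LINT \<omega>|completion P. LINT t|lebesgue_on {0..T}. \<phi> (trajectory f T u (a \<omega>) t) t)"

end

theory Submission
  imports Defs
begin

text \<open>
  The set of relaxed controls is sequentially compact, and the cost is sequentially continuous on
  it, so the cost attains its infimum.

  Compactness. A relaxed control is, up to a null set of times, a measurable kernel from [0,T] to
  probability measures on \<open>\<Delta>\<close>. Schoenberg's space-filling curve has a Borel right inverse
  (\<open>bounded_set_continuous_code\<close>), so that kernels on \<open>\<Delta>\<close> become kernels on the unit interval,
  which are described by distribution functions \<open>F\<^sub>k t q\<close>. A diagonal argument makes the time
  primitives of \<open>F\<^sub>k (-) q\<close> converge for all rational q. The limits are Lipschitz in time, hence have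
  densities (Radon-Nikodym, \<open>monotone_densities\<close>), and their right limits in q are the
  distribution functions of the limit kernel (\<open>real_kernels_weakly_compact\<close>,
  \<open>control_kernels_weakly_compact\<close>). The convergence obtained is that of
  \<open>\<integral>\<^sub>0\<^sup>t \<integral> \<alpha>(v) u\<^sub>k(s,dv) ds\<close> for all t and all continuous \<open>\<alpha>\<close>; by a step function argument \<open>\<alpha>\<close> may
  depend continuously on s too.

  Trajectories. Condition (I) makes \<open>f(y(s),v,s)\<close> jointly continuous in (s,v) along each
  continuous curve y. A Gronwall estimate turns the weak convergence of the controls into pointwise
  convergence of the trajectories, for each initial point. The same estimate, forwards and backwards
  in time, shows that the flow maps are bi-Lipschitz with a constant that is uniform in the
  control (\<open>relaxed_flow\<close>).

  Cost. A map with K-Lipschitz inverse pushes Lebesgue measure to at most a constant multiple of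
  itself (\<open>nn_integral_expanding_map_le\<close>). With the Cauchy-Schwarz inequality this gives
  \<open>M \<integral> \<bar>\<phi>(y(t),t)\<bar> dt \<le> c \<parallel>\<phi>\<parallel>\<close> in the norm of \<open>L1([0,T], L2)\<close>, with c independent of the control
  (\<open>transport_L1_bound\<close>). For bounded continuous integrands the cost converges by dominated
  convergence, and such functions are dense (\<open>L1_L2_approximation\<close>), so the cost is continuous for
  every admissible \<open>\<phi>\<close> (\<open>transport_integral_convergence\<close>). The same bound shows that changing
  \<open>\<phi>\<close> on a Lebesgue null set of space-time does not change the cost, which reduces the argument to
  Borel measurable \<open>\<phi>\<close>.
\<close>

section \<open>A continuous parametrisation of bounded sets by the real line\<close>

text \<open>Schoenberg's 2-periodic profile: it vanishes on [0, 1/3] and equals 1 on [2/3, 1].\<close>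

definition schoenberg_profile :: "real \<Rightarrow> real" where
  "schoenberg_profile x = max 0 (min 1 (3 * (arccos (cos (pi * x)) / pi) - 1))"

lemma continuous_schoenberg_profile: "continuous_on UNIV schoenberg_profile"
  unfolding schoenberg_profile_def
  by (intro continuous_intros) auto

lemma schoenberg_profile_bounds: "0 \<le> schoenberg_profile x" "schoenberg_profile x \<le> 1"
  by (auto simp: schoenberg_profile_def)

lemma schoenberg_profile_reads_digit:
  fixes k a :: int and r :: real
  assumes "a \<in> {0, 1}" "0 \<le> r" "r \<le> 1/3"
  shows "schoenberg_profile (2 * of_int k + 2/3 * of_int a + r) = of_int a"
proof -
  define y :: real where "y = 2/3 * of_int a + r"
  have y: "0 \<le> y" "y \<le> 1" using assms by (auto simp: y_def)
  have "cos (pi * (2 * of_int k + 2/3 * of_int a + r)) = cos (2 * pi * of_int k + pi * y)"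
    by (simp add: y_def algebra_simps)
  also have "\<dots> = cos (pi * y)"
    by (simp add: cos_add cos_int_2pin sin_int_2pin)
  finally have "arccos (cos (pi * (2 * of_int k + 2/3 * of_int a + r))) = pi * y"
    using y by (simp add: arccos_cos)
  then show ?thesis
    using assms by (auto simp: schoenberg_profile_def y_def field_simps)
qed

lemma schoenberg_profile_ternary:
  fixes a :: "nat \<Rightarrow> int"
  assumes a: "\<And>q. a q \<in> {0, 1}"
  shows "schoenberg_profile (3^p * (\<Sum>q. 2 * of_int (a q) / 3^(q+1))) = of_int (a p)"
proof -
  define g :: "nat \<Rightarrow> real" where "g q = 2 * of_int (a q) / 3^(q+1)" for q
  have a01: "0 \<le> real_of_int (a q)" "real_of_int (a q) \<le> 1" for q
    using a[of q] by auto
  have geo: "(\<lambda>q. 2/3 * (1/3::real)^q) sums 1"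
    using sums_mult[OF geometric_sums[of "1/3::real"], of "2/3"] by simp
  have summ: "summable g"
  proof (rule summable_comparison_test[OF _ sums_summable[OF geo]])
    have "norm (g n) \<le> 2/3 * (1/3)^n" for n
      using a01[of n] by (simp add: g_def power_divide field_simps)
    then show "\<exists>N. \<forall>n\<ge>N. norm (g n) \<le> 2/3 * (1/3)^n" by auto
  qed
  define r where "r = 3^p * (\<Sum>q. g (q + Suc p))"
  have "(\<Sum>q. g q) = (\<Sum>q. g (q + Suc p)) + (\<Sum>q<Suc p. g q)"
    by (rule suminf_split_initial_segment[OF summ])
  then have split: "3^p * (\<Sum>q. g q) = 3^p * (\<Sum>q<p. g q) + 3^p * g p + r"
    by (simp add: r_def algebra_simps)
  have int: "3^p * (\<Sum>q<p. g q) = 2 * of_int (\<Sum>q<p. a q * 3^(p - q - 1))"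
  proof -
    have "3^p * g q = 2 * of_int (a q * 3^(p - q - 1))" if "q < p" for q
    proof -
      have "(3::real)^p = 3^(p - q - 1) * 3^(q+1)"
        using power_add[of "3::real" "p - q - 1" "q + 1"] that by simp
      then show ?thesis by (simp add: g_def)
    qed
    then show ?thesis by (simp add: sum_distrib_left)
  qed
  have summ': "summable (\<lambda>q. g (q + Suc p))"
    using summ by (subst summable_iff_shift)
  have "0 \<le> r" unfolding r_def
    by (intro mult_nonneg_nonneg suminf_nonneg summ')
      (use a01 in \<open>auto simp: g_def simp del: of_int_0_le_iff\<close>)
  moreover have "r \<le> 1/3"
  proof -
    have s2: "(\<lambda>q. (1/3)^(p+1) * (2/3 * (1/3::real)^q)) sums (1/3)^(p+1)"
      using sums_mult[OF geo, of "(1/3)^(p+1)"] by simp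
    have "g (q + Suc p) \<le> (1/3)^(p+1) * (2/3 * (1/3)^q)" for q
      using a01[of "q + Suc p"]
      by (simp add: g_def power_divide field_simps power_add)
    then have "(\<Sum>q. g (q + Suc p)) \<le> (1/3)^(p+1)"
      using suminf_le[OF _ summ' sums_summable[OF s2]] sums_unique[OF s2] by auto
    then have "r \<le> 3^p * (1/3)^(p+1)" by (simp add: r_def)
    also have "\<dots> = 1/3" by (simp add: power_divide)
    finally show ?thesis .
  qed
  ultimately have "schoenberg_profile (2 * of_int (\<Sum>q<p. a q * 3^(p - q - 1)) + 2/3 * of_int (a p) + r)
      = of_int (a p)"
    by (intro schoenberg_profile_reads_digit a)
  moreover have "3^p * g p = 2/3 * of_int (a p)" by (simp add: g_def)
  ultimately show ?thesis using split int by (simp add: g_def)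
qed

text \<open>The binary digit of x at the place \<open>2^-(i+1)\<close>; integer parts do not matter.\<close>

definition binary_digit :: "nat \<Rightarrow> real \<Rightarrow> int" where
  "binary_digit i x = \<lfloor>2^(i+1) * x\<rfloor> - 2 * \<lfloor>2^i * x\<rfloor>"

lemma binary_digit_01: "binary_digit i x \<in> {0, 1}"
proof -
  have "2^(i+1) * x = 2 * (2^i * x)" by simp
  then show ?thesis unfolding binary_digit_def by (auto, linarith)
qed

lemma binary_digit_sums: "(\<lambda>i. of_int (binary_digit i x) / 2^(i+1)) sums frac x"
proof -
  have part: "(\<Sum>i<N. of_int (binary_digit i x) / 2^(i+1)) = (of_int \<lfloor>2^N * x\<rfloor> / 2^N - of_int \<lfloor>x\<rfloor> :: real)" for N
  proof (induction N)
    case (Suc N)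
    have "of_int (binary_digit N x) / 2^(N+1) = of_int \<lfloor>2^(Suc N) * x\<rfloor> / 2^(Suc N) - (of_int \<lfloor>2^N * x\<rfloor> / 2^N :: real)"
      by (simp add: binary_digit_def diff_divide_distrib)
    with Suc show ?case by simp
  qed simp
  have "(\<lambda>N. of_int \<lfloor>2^N * x\<rfloor> / 2^N :: real) \<longlonglongrightarrow> x"
  proof (rule tendsto_sandwich)
    show "\<forall>\<^sub>F N in sequentially. x - (1/2)^N \<le> of_int \<lfloor>2^N * x\<rfloor> / 2^N"
    proof (rule always_eventually, rule allI)
      fix N
      have "2^N * x - 1 \<le> of_int \<lfloor>2^N * x\<rfloor>" by linarith
      then have "(2^N * x - 1) / 2^N \<le> of_int \<lfloor>2^N * x\<rfloor> / 2^N"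
        by (rule divide_right_mono) simp
      then show "x - (1/2)^N \<le> of_int \<lfloor>2^N * x\<rfloor> / 2^N"
        by (simp add: diff_divide_distrib power_divide)
    qed
    show "\<forall>\<^sub>F N in sequentially. of_int \<lfloor>2^N * x\<rfloor> / 2^N \<le> x"
      by (auto simp: field_simps intro!: always_eventually)
    show "(\<lambda>N. x - (1/2)^N) \<longlonglongrightarrow> x"
      using tendsto_diff[OF tendsto_const LIMSEQ_realpow_zero[of "1/2"], of x] by simp
  qed simp
  then show ?thesis
    unfolding sums_def part frac_def by (intro tendsto_intros)
qed

lemma measurable_binary_digit [measurable]: "(\<lambda>x. real_of_int (binary_digit i x)) \<in> borel_measurable borel"
  unfolding binary_digit_def by measurable

text \<open>
  Schoenberg's space-filling curve. If all ternary digits of c are 0 or 2, then coordinate j of the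
  point \<open>schoenberg_decode c\<close> has as its binary digits the halves of the ternary digits of c at the
  places \<open>to_nat (i, j)\<close>. \<open>schoenberg_encode\<close> is the resulting Borel right inverse on the half-open
  unit cube.
\<close>

definition schoenberg_decode :: "real \<Rightarrow> real^'m::finite" where
  "schoenberg_decode c = (\<chi> j. \<Sum>i. schoenberg_profile (3^(to_nat (i, j)) * c) / 2^(i+1))"

definition schoenberg_encode :: "real^'m::finite \<Rightarrow> real" where
  "schoenberg_encode v =
     (\<Sum>p. 2 * of_int (case from_nat p of (i, j) \<Rightarrow> binary_digit i (v $ j)) / 3^(p+1))"

lemma decode_encode:
  fixes v :: "real^'m::finite"
  assumes "\<And>j. 0 \<le> v $ j" "\<And>j. v $ j < 1"
  shows "schoenberg_decode (schoenberg_encode v) = v"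
proof -
  have "schoenberg_profile (3^(to_nat (i, j)) * schoenberg_encode v) = of_int (binary_digit i (v $ j))"
    for i and j :: 'm
    unfolding schoenberg_encode_def
    by (subst schoenberg_profile_ternary) (use binary_digit_01 in \<open>auto split: prod.split\<close>)
  moreover have "(\<Sum>i. of_int (binary_digit i (v $ j)) / 2^(i+1)) = v $ j" for j
    using sums_unique[OF binary_digit_sums[of "v $ j"]] assms[of j] by (simp add: frac_eq)
  ultimately show ?thesis by (simp add: schoenberg_decode_def vec_eq_iff)
qed

lemma continuous_schoenberg_decode: "continuous_on UNIV (schoenberg_decode :: real \<Rightarrow> real^'m::finite)"
  unfolding schoenberg_decode_def
proof (rule continuous_on_vec_lambda)
  fix j :: 'm
  have geo: "summable (\<lambda>i. (1/2::real)^(i+1))" by (simp add: summable_mult)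
  have "uniform_limit UNIV (\<lambda>n c. \<Sum>i<n. schoenberg_profile (3^(to_nat (i, j)) * c) / 2^(i+1))
      (\<lambda>c. \<Sum>i. schoenberg_profile (3^(to_nat (i, j)) * c) / 2^(i+1)) sequentially"
    by (rule Weierstrass_m_test[OF _ geo])
      (use schoenberg_profile_bounds in \<open>auto simp: power_divide divide_right_mono\<close>)
  then show "continuous_on UNIV (\<lambda>c. \<Sum>i. schoenberg_profile (3^(to_nat (i, j)) * c) / 2^(i+1))"
    by (rule uniform_limit_theorem[rotated])
      (auto intro!: always_eventually continuous_intros
        continuous_on_compose2[OF continuous_schoenberg_profile])
qed

lemma measurable_schoenberg_encode: "schoenberg_encode \<in> borel_measurable (borel :: (real^'m::finite) measure)"
proof -
  have "(\<lambda>v. real_of_int (case from_nat p of (i, j) \<Rightarrow> binary_digit i (v $ j)))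
      \<in> borel_measurable (borel :: (real^'m) measure)" for p
    by (cases "from_nat p :: nat \<times> 'm") (simp, measurable)
  then show ?thesis unfolding schoenberg_encode_def
    by (intro borel_measurable_suminf borel_measurable_divide borel_measurable_times) auto
qed

lemma schoenberg_encode_bounds: "schoenberg_encode v \<in> {0..1}"
proof -
  define a where "a p = real_of_int (case from_nat p of (i, j) \<Rightarrow> binary_digit i (v $ j))" for p
  have a: "0 \<le> a p \<and> a p \<le> 1" for p
    using binary_digit_01[of "fst (from_nat p :: nat \<times> 'a)" "v $ snd (from_nat p :: nat \<times> 'a)"]
    by (auto simp: a_def split: prod.split)
  have geo: "(\<lambda>p. 2/3 * (1/3::real)^p) sums 1"
    using sums_mult[OF geometric_sums[of "1/3::real"], of "2/3"] by simp
  have le: "0 \<le> 2 * a p / 3^(p+1) \<and> 2 * a p / 3^(p+1) \<le> 2/3 * (1/3)^p" for p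
    using a[of p] by (simp add: power_divide field_simps)
  have summ: "summable (\<lambda>p. 2 * a p / 3^(p+1))"
  proof (rule summable_comparison_test'[OF sums_summable[OF geo], of 0])
    show "norm (2 * a p / 3^(p+1)) \<le> 2/3 * (1/3)^p" for p
      using le[of p] by (simp only: real_norm_def abs_of_nonneg)
  qed
  have "(\<Sum>p. 2 * a p / 3^(p+1)) \<le> (\<Sum>p. 2/3 * (1/3)^p)"
    using le by (intro suminf_le summ sums_summable[OF geo]) auto
  moreover have "0 \<le> (\<Sum>p. 2 * a p / 3^(p+1))"
    using le by (intro suminf_nonneg summ) auto
  ultimately show ?thesis
    using sums_unique[OF geo] by (simp add: schoenberg_encode_def a_def)
qed

text \<open>A bounded subset of a Euclidean space is reached by a continuous curve that admits a
  Borel right inverse, so measures on it can be studied through measures on the real line.\<close>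

lemma bounded_set_continuous_code:
  fixes S :: "(real^'m::finite) set"
  assumes "bounded S"
  obtains \<theta> :: "real \<Rightarrow> real^'m" and s where
    "continuous_on UNIV \<theta>" "s \<in> borel_measurable borel" "\<And>v. s v \<in> {0..1}" "\<And>v. v \<in> S \<Longrightarrow> \<theta> (s v) = v"
proof -
  obtain R where R: "R > 0" "\<And>v. v \<in> S \<Longrightarrow> norm v \<le> R"
    using assms by (auto simp: bounded_pos)
  define aff :: "real^'m \<Rightarrow> real^'m" where "aff v = (1 / (3*R)) *\<^sub>R (v + (\<chi> j. R))" for v
  define \<theta> :: "real \<Rightarrow> real^'m" where "\<theta> c = (3*R) *\<^sub>R schoenberg_decode c - (\<chi> j. R)" for c
  have "\<theta> (schoenberg_encode (aff v)) = v" if "v \<in> S" for v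
  proof -
    have "\<bar>v $ j\<bar> \<le> R" for j using component_le_norm_cart[of v j] R(2)[OF that] by simp
    then have "0 \<le> v $ j + R" "v $ j + R < 3 * R" for j
      using R(1) by (smt (verit))+
    then have "schoenberg_decode (schoenberg_encode (aff v)) = aff v"
      using R(1) by (intro decode_encode) (simp_all add: aff_def field_simps)
    then show ?thesis using R(1) by (simp add: \<theta>_def aff_def)
  qed
  moreover have "continuous_on UNIV \<theta>"
    unfolding \<theta>_def by (intro continuous_intros continuous_schoenberg_decode)
  moreover have "(\<lambda>v. schoenberg_encode (aff v)) \<in> borel_measurable borel"
    by (rule measurable_compose[OF _ measurable_schoenberg_encode]) (simp add: aff_def)
  ultimately show ?thesis
    using that[of \<theta> "\<lambda>v. schoenberg_encode (aff v)"] schoenberg_encode_bounds by blast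
qed

section \<open>Comparison of measures on dyadic cells\<close>

text \<open>The half-open dyadic cube of side \<open>2^-n\<close> that contains x.\<close>

definition dyadic_cell :: "nat \<Rightarrow> 'a::euclidean_space \<Rightarrow> 'a set" where
  "dyadic_cell n x = {y. \<forall>i\<in>Basis. \<lceil>2^n * (y \<bullet> i)\<rceil> = \<lceil>2^n * (x \<bullet> i)\<rceil>}"

lemma dyadic_cell_refl: "x \<in> dyadic_cell n x"
  by (simp add: dyadic_cell_def)

lemma dyadic_cell_eq: "y \<in> dyadic_cell n x \<Longrightarrow> dyadic_cell n y = dyadic_cell n x"
  by (auto simp: dyadic_cell_def)

lemma dyadic_cell_Suc_subset: "dyadic_cell (Suc n) x \<subseteq> dyadic_cell n x"
proof -
  have ceil: "\<lceil>b\<rceil> \<le> k \<longleftrightarrow> \<lceil>2 * b\<rceil> \<le> 2 * k" for b :: real and k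
    by (simp add: ceiling_le_iff)
  have half: "\<lceil>b\<rceil> = \<lceil>c\<rceil>" if "\<lceil>2 * b\<rceil> = \<lceil>2 * c\<rceil>" for b c :: real
    using iffD2[OF ceil, OF ord_eq_le_trans[OF that iffD1[OF ceil order_refl]]]
      iffD2[OF ceil, OF ord_eq_le_trans[OF that[symmetric] iffD1[OF ceil order_refl]]]
    by (rule antisym)
  show ?thesis
  proof
    fix y assume "y \<in> dyadic_cell (Suc n) x"
    then have eq: "\<lceil>2 * (2^n * (y \<bullet> i))\<rceil> = \<lceil>2 * (2^n * (x \<bullet> i))\<rceil>" if "i \<in> Basis" for i
      using that by (auto simp only: dyadic_cell_def power_Suc mult.assoc)
    show "y \<in> dyadic_cell n x"
      unfolding dyadic_cell_def by (rule CollectI, rule ballI, rule half, rule eq)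
  qed
qed

lemma dyadic_cell_borel [measurable]: "dyadic_cell n (x::'a::euclidean_space) \<in> sets borel"
proof -
  have "dyadic_cell n x = {y\<in>space borel. \<forall>i\<in>Basis. \<lceil>2^n * (y \<bullet> i)\<rceil> = \<lceil>2^n * (x \<bullet> i)\<rceil>}"
    by (simp add: dyadic_cell_def)
  also have "\<dots> \<in> sets borel"
    by measurable
  finally show ?thesis .
qed

lemma countable_dyadic_cells: "countable (range (dyadic_cell n :: 'a::euclidean_space \<Rightarrow> _))"
proof -
  define g :: "('a \<Rightarrow> int) \<Rightarrow> 'a set" where "g k = {y. \<forall>i\<in>Basis. \<lceil>2^n * (y \<bullet> i)\<rceil> = k i}" for k
  have "dyadic_cell n x = g (\<lambda>i\<in>Basis. \<lceil>2^n * (x \<bullet> i)\<rceil>)" for x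
    by (simp add: g_def dyadic_cell_def)
  then have "range (dyadic_cell n) \<subseteq> g ` (Basis \<rightarrow>\<^sub>E UNIV)"
    by (auto simp: image_iff intro!: bexI)
  then show ?thesis
    by (rule countable_subset) (auto intro!: countable_image countable_PiE)
qed

lemma dyadic_cell_dist:
  fixes x :: "'a::euclidean_space"
  assumes "y \<in> dyadic_cell n x" "z \<in> dyadic_cell n x"
  shows "norm (y - z) \<le> DIM('a) / 2^n"
proof -
  have "\<bar>(y - z) \<bullet> i\<bar> \<le> 1 / 2^n" if "i \<in> Basis" for i
  proof -
    have "\<lceil>2^n * (y \<bullet> i)\<rceil> = \<lceil>2^n * (z \<bullet> i)\<rceil>"
      using assms that by (auto simp: dyadic_cell_def)
    then have "\<bar>2^n * (y \<bullet> i) - 2^n * (z \<bullet> i)\<bar> \<le> 1" by linarith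
    then have "2^n * \<bar>(y - z) \<bullet> i\<bar> \<le> 1"
      by (simp add: inner_diff_left abs_mult flip: right_diff_distrib)
    then show ?thesis by (simp add: field_simps)
  qed
  then have "(\<Sum>i\<in>Basis. \<bar>(y - z) \<bullet> i\<bar>) \<le> (\<Sum>i\<in>(Basis::'a set). 1 / 2^n)"
    by (rule sum_mono)
  then show ?thesis using norm_le_l1[of "y - z"] by simp
qed

lemma emeasure_lborel_dyadic_cell_ge:
  "ennreal ((1/2^n)^DIM('a)) \<le> emeasure lborel (dyadic_cell n (x::'a::euclidean_space))"
proof -
  define u l :: 'a where "u = (\<Sum>i\<in>Basis. (\<lceil>2^n * (x \<bullet> i)\<rceil> / 2^n) *\<^sub>R i)"
    and "l = (\<Sum>i\<in>Basis. ((\<lceil>2^n * (x \<bullet> i)\<rceil> - 1) / 2^n) *\<^sub>R i)"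
  have "emeasure lborel (box l u) = ennreal (\<Prod>b\<in>(Basis::'a set). 1/2^n)"
    by (subst emeasure_lborel_box)
      (auto simp: u_def l_def inner_diff_left divide_right_mono diff_divide_distrib intro!: arg_cong[of _ _ ennreal] prod.cong)
  moreover have "box l u \<subseteq> dyadic_cell n x"
  proof
    fix y assume y: "y \<in> box l u"
    show "y \<in> dyadic_cell n x" unfolding dyadic_cell_def
    proof (rule CollectI, rule ballI)
      fix i :: 'a assume i: "i \<in> Basis"
      with y have "(\<lceil>2^n * (x \<bullet> i)\<rceil> - 1) / 2^n < y \<bullet> i" "y \<bullet> i < \<lceil>2^n * (x \<bullet> i)\<rceil> / 2^n"
        by (auto simp: box_def u_def l_def)
      then show "\<lceil>2^n * (y \<bullet> i)\<rceil> = \<lceil>2^n * (x \<bullet> i)\<rceil>"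
        by (intro ceiling_unique) (simp_all add: field_simps)
    qed
  qed
  ultimately show ?thesis
    using emeasure_mono[of "box l u" "dyadic_cell n x" lborel] by simp
qed

text \<open>An open set is an increasing union of disjoint families of cells, so that an inequality between
  measures of cells carries over to open sets and, by outer regularity, to Borel sets.\<close>

lemma emeasure_open_le_if_cells_le:
  fixes N M :: "'a::euclidean_space measure"
  assumes N: "sets N = sets borel" and M: "sets M = sets borel"
    and le: "\<And>n x. emeasure N (dyadic_cell n x) \<le> emeasure M (dyadic_cell n x)"
    and U: "open U"
  shows "emeasure N U \<le> emeasure M U"
proof -
  define Q where "Q n = {c \<in> range (dyadic_cell n :: 'a \<Rightarrow> _). c \<subseteq> U}" for n
  have cQ: "countable (Q n)" for n
    unfolding Q_def by (rule countable_subset[OF _ countable_dyadic_cells[of n]]) auto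
  have Qb: "c \<in> sets borel" if "c \<in> Q n" for c n using that by (auto simp: Q_def)
  have disj: "disjoint_family_on (\<lambda>c. c) (Q n)" for n
    unfolding disjoint_family_on_def
  proof (intro ballI impI)
    fix c d assume "c \<in> Q n" "d \<in> Q n" "c \<noteq> d"
    moreover then obtain x y where "c = dyadic_cell n x" "d = dyadic_cell n y" by (auto simp: Q_def)
    ultimately show "c \<inter> d = {}"
      using dyadic_cell_eq[of _ n x] dyadic_cell_eq[of _ n y] by (metis disjoint_iff)
  qed
  have inc: "incseq (\<lambda>n. \<Union> (Q n))"
  proof (rule incseq_SucI, rule subsetI)
    fix n x assume "x \<in> \<Union> (Q n)"
    then obtain y where "x \<in> dyadic_cell n y" "dyadic_cell n y \<subseteq> U" by (auto simp: Q_def)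
    then have "dyadic_cell (Suc n) x \<subseteq> U"
      using dyadic_cell_eq dyadic_cell_Suc_subset by blast
    then show "x \<in> \<Union> (Q (Suc n))" using dyadic_cell_refl by (auto simp: Q_def)
  qed
  have cover: "(\<Union>n. \<Union> (Q n)) = U"
  proof (intro equalityI subsetI)
    fix x assume "x \<in> U"
    then obtain e where e: "e > 0" "ball x e \<subseteq> U" using U openE by blast
    have "(\<lambda>n. real DIM('a) * (1/2)^n) \<longlonglongrightarrow> real DIM('a) * 0"
      by (intro tendsto_intros) auto
    then have "\<forall>\<^sub>F n in sequentially. real DIM('a) * (1/2)^n < e"
      using e by (intro order_tendstoD(2)) auto
    then obtain n where n: "DIM('a) / 2^n < e"
      by (auto simp: eventually_sequentially power_divide)
    have "dyadic_cell n x \<subseteq> ball x e"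
      using dyadic_cell_dist[OF dyadic_cell_refl, of _ n x] n by (force simp: dist_norm)
    then show "x \<in> (\<Union>n. \<Union> (Q n))"
      using e dyadic_cell_refl[of x n] unfolding Q_def by blast
  qed (auto simp: Q_def)
  have level: "emeasure N (\<Union> (Q n)) \<le> emeasure M (\<Union> (Q n))" for n
  proof -
    have "emeasure N (\<Union> (Q n)) = (\<integral>\<^sup>+c. emeasure N c \<partial>count_space (Q n))"
      using emeasure_UN_countable[of "Q n" "\<lambda>c. c" N] cQ disj Qb N by auto
    also have "\<dots> \<le> (\<integral>\<^sup>+c. emeasure M c \<partial>count_space (Q n))"
      by (rule nn_integral_mono) (auto simp: Q_def le)
    also have "\<dots> = emeasure M (\<Union> (Q n))"
      using emeasure_UN_countable[of "Q n" "\<lambda>c. c" M] cQ disj Qb M by auto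
    finally show ?thesis .
  qed
  have bor: "\<Union> (Q n) \<in> sets borel" for n
    using cQ Qb by (intro sets.countable_Union) auto
  have "emeasure N U = (SUP n. emeasure N (\<Union> (Q n)))"
    using SUP_emeasure_incseq[of "\<lambda>n. \<Union> (Q n)" N] inc bor cover N by (simp add: image_subset_iff)
  also have "\<dots> \<le> (SUP n. emeasure M (\<Union> (Q n)))"
    using level by (intro SUP_mono) auto
  also have "\<dots> = emeasure M U"
    using SUP_emeasure_incseq[of "\<lambda>n. \<Union> (Q n)" M] inc bor cover M by (simp add: image_subset_iff)
  finally show ?thesis .
qed

lemma emeasure_le_if_cells_le_finite:
  fixes N M :: "'a::euclidean_space measure"
  assumes N: "sets N = sets borel" and M: "sets M = sets borel" "finite_measure M"
    and le: "\<And>n x. emeasure N (dyadic_cell n x) \<le> emeasure M (dyadic_cell n x)"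
    and A: "A \<in> sets borel"
  shows "emeasure N A \<le> emeasure M A"
proof -
  interpret M: finite_measure M by fact
  have "emeasure N A \<le> (INF U\<in>{U. A \<subseteq> U \<and> open U}. emeasure M U)"
  proof (rule INF_greatest)
    fix U assume U: "U \<in> {U. A \<subseteq> U \<and> open U}"
    then have "emeasure N A \<le> emeasure N U" using N by (intro emeasure_mono) auto
    also have "\<dots> \<le> emeasure M U"
      using U by (intro emeasure_open_le_if_cells_le[OF N M(1) le]) simp
    finally show "emeasure N A \<le> emeasure M U" .
  qed
  also have "\<dots> = emeasure M A"
    using A M by (intro outer_regular[symmetric]) auto
  finally show ?thesis .
qed

lemma emeasure_le_lborel_if_cells_le:
  fixes N :: "'a::euclidean_space measure"
  assumes N: "sets N = sets borel"
    and le: "\<And>n x. emeasure N (dyadic_cell n x) \<le> ennreal K * emeasure lborel (dyadic_cell n x)"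
    and A: "A \<in> sets borel"
  shows "emeasure N A \<le> ennreal K * emeasure lborel A"
proof (rule ennreal_le_epsilon)
  fix e :: real assume "0 < e"
  define d where "d = e / (\<bar>K\<bar> + 1)"
  have "d > 0" using \<open>0 < e\<close> by (simp add: d_def)
  then obtain U where U: "open U" "A \<subseteq> U" "emeasure lborel (U - A) < d"
    using outer_regular_lborel[OF A] by blast
  have "emeasure N A \<le> emeasure N U" using N U by (intro emeasure_mono) auto
  also have "\<dots> \<le> emeasure (scale_measure (ennreal K) lborel) U"
    by (rule emeasure_open_le_if_cells_le) (use U in \<open>simp_all add: N le\<close>)
  also have "\<dots> = ennreal K * emeasure lborel (A \<union> (U - A))"
    using U by (simp add: Un_absorb1)
  also have "\<dots> = ennreal K * (emeasure lborel A + emeasure lborel (U - A))"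
    by (intro arg_cong[of _ _ "\<lambda>x. ennreal K * x"] plus_emeasure[symmetric]) (use U A in auto)
  also have "\<dots> \<le> ennreal K * (emeasure lborel A + ennreal d)"
    using U by (intro mult_left_mono add_left_mono) auto
  also have "\<dots> = ennreal K * emeasure lborel A + ennreal K * ennreal d"
    by (simp add: distrib_left)
  also have "ennreal K * ennreal d \<le> ennreal e"
  proof (cases "K \<ge> 0")
    case True
    then have "K * d \<le> e" using \<open>0 < e\<close> by (simp add: d_def field_simps)
    then show ?thesis using True \<open>d > 0\<close> by (simp add: ennreal_leI flip: ennreal_mult)
  qed (simp add: ennreal_neg)
  finally show "emeasure N A \<le> ennreal K * emeasure lborel A + ennreal e"
    by (simp add: add_left_mono)
qed

text \<open>A map with Lipschitz inverse pushes Lebesgue measure to a measure that is at most a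
  constant multiple of Lebesgue measure.\<close>

lemma nn_integral_expanding_map_le:
  fixes g :: "'a::euclidean_space \<Rightarrow> 'a" and h :: "'a \<Rightarrow> ennreal"
  assumes g [measurable]: "g \<in> borel_measurable borel"
    and exp: "\<And>x y. norm (x - y) \<le> B * norm (g x - g y)" and B: "B \<ge> 0"
    and h [measurable]: "h \<in> borel_measurable borel"
  shows "(\<integral>\<^sup>+x. h (g x) \<partial>lborel) \<le> ennreal ((2 * B * DIM('a))^DIM('a)) * (\<integral>\<^sup>+x. h x \<partial>lborel)"
proof -
  define K where "K = (2 * B * DIM('a))^DIM('a)"
  define N where "N = distr lborel borel g"
  have cell: "emeasure N (dyadic_cell n c) \<le> ennreal K * emeasure lborel (dyadic_cell n c)" for n c
  proof (cases "g -` dyadic_cell n c = {}")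
    case False
    then obtain x0 where x0: "g x0 \<in> dyadic_cell n c" by auto
    \<comment> \<open>The preimage of the cell lies in a cube of side \<open>2 r\<close>, whose volume is a fixed multiple of
        the volume of the cell.\<close>
    define r where "r = B * (DIM('a) / 2^n)"
    have r: "r \<ge> 0" using B by (simp add: r_def)
    have "g -` dyadic_cell n c \<subseteq> cbox (x0 - r *\<^sub>R One) (x0 + r *\<^sub>R One)"
    proof
      fix x assume "x \<in> g -` dyadic_cell n c"
      then have "norm (g x - g x0) \<le> DIM('a) / 2^n"
        using x0 dyadic_cell_dist by blast
      then have "norm (x - x0) \<le> r"
        unfolding r_def by (rule order_trans[OF exp mult_left_mono]) (use B in auto)
      then have "\<bar>(x - x0) \<bullet> i\<bar> \<le> r" if "i \<in> Basis" for i
        using Basis_le_norm[OF that, of "x - x0"] by simp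
      then show "x \<in> cbox (x0 - r *\<^sub>R One) (x0 + r *\<^sub>R One)"
        by (force simp: mem_box inner_diff_left inner_add_left abs_le_iff algebra_simps)
    qed
    then have "emeasure N (dyadic_cell n c) \<le> emeasure lborel (cbox (x0 - r *\<^sub>R One) (x0 + r *\<^sub>R One))"
      unfolding N_def by (subst emeasure_distr) (auto intro!: emeasure_mono)
    also have "\<dots> = ennreal (\<Prod>b\<in>(Basis::'a set). 2 * r)"
      using r by (subst emeasure_lborel_cbox)
        (auto simp: inner_diff_left inner_add_left intro!: arg_cong[of _ _ ennreal] prod.cong)
    also have "(\<Prod>b\<in>(Basis::'a set). 2 * r) = K * (1/2^n)^DIM('a)"
      by (simp add: K_def r_def power_mult_distrib power_divide)
    also have "ennreal (K * (1/2^n)^DIM('a)) = ennreal K * ennreal ((1/2^n)^DIM('a))"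
      using B by (intro ennreal_mult) (auto simp: K_def)
    also have "\<dots> \<le> ennreal K * emeasure lborel (dyadic_cell n c)"
      by (intro mult_left_mono emeasure_lborel_dyadic_cell_ge) auto
    finally show ?thesis .
  qed (simp add: N_def emeasure_distr)
  have "N \<le> scale_measure (ennreal K) lborel"
    using emeasure_le_lborel_if_cells_le[of N K] cell
    by (subst le_measure) (auto simp: N_def)
  then have "(\<integral>\<^sup>+x. h x \<partial>N) \<le> (\<integral>\<^sup>+x. h x \<partial>scale_measure (ennreal K) lborel)"
    by (intro nn_integral_mono_measure) (auto simp: N_def)
  then show ?thesis
    by (simp add: N_def nn_integral_distr nn_integral_scale_measure K_def)
qed

section \<open>Ordinary differential equations with bounded measurable time dependence\<close>

text \<open>A Gronwall inequality around an arbitrary base point \<open>s\<^sub>0\<close>. The factor 2 comes from the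
  proof, which bounds the maximum of \<open>exp (- 2 L \<bar>s - s\<^sub>0\<bar>) w s\<close>.\<close>

lemma gronwall_two_sided:
  fixes w :: "real \<Rightarrow> real"
  assumes L: "L > 0" and w: "continuous_on {0..T} w" and s0: "s\<^sub>0 \<in> {0..T}"
    and c: "c \<ge> 0"
    and le: "\<And>s. s \<in> {0..T} \<Longrightarrow> w s \<le> c + L * integral {min s\<^sub>0 s..max s\<^sub>0 s} w"
    and s: "s \<in> {0..T}"
  shows "w s \<le> 2 * c * exp (2 * L * \<bar>s - s\<^sub>0\<bar>)"
proof -
  define v where "v r = exp (- 2 * L * \<bar>r - s\<^sub>0\<bar>) * w r" for r
  have "continuous_on {0..T} v"
    unfolding v_def by (intro continuous_intros w)
  then obtain m where m: "m \<in> {0..T}" "\<And>r. r \<in> {0..T} \<Longrightarrow> v r \<le> v m"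
    using continuous_attains_sup[of "{0..T}" v] s by auto
  have w_le: "w r \<le> v m * exp (2 * L * \<bar>r - s\<^sub>0\<bar>)" if "r \<in> {0..T}" for r
  proof -
    have "w r = v r * exp (2 * L * \<bar>r - s\<^sub>0\<bar>)"
      by (simp add: v_def mult.assoc mult.left_commute flip: exp_add)
    then show ?thesis using m(2)[OF that] by (simp add: mult_right_mono)
  qed
  define J where "J = {min s\<^sub>0 m..max s\<^sub>0 m}"
  have J: "J \<subseteq> {0..T}" using s0 m(1) by (auto simp: J_def)
  have int: "((\<lambda>r. exp (2 * L * \<bar>r - s\<^sub>0\<bar>)) has_integral (exp (2 * L * \<bar>m - s\<^sub>0\<bar>) - 1) / (2 * L)) J"
  proof (cases "s\<^sub>0 \<le> m")
    case True
    have "((\<lambda>r. exp (2 * L * (r - s\<^sub>0))) has_integral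
        (exp (2 * L * (m - s\<^sub>0)) / (2 * L) - exp (2 * L * (s\<^sub>0 - s\<^sub>0)) / (2 * L))) {s\<^sub>0..m}"
      using L by (intro fundamental_theorem_of_calculus True)
        (auto intro!: derivative_eq_intros simp flip: has_real_derivative_iff_has_vector_derivative)
    then have "((\<lambda>r. exp (2 * L * (r - s\<^sub>0))) has_integral (exp (2 * L * \<bar>m - s\<^sub>0\<bar>) - 1) / (2 * L)) J"
      using True by (simp add: J_def diff_divide_distrib)
    then show ?thesis
      by (rule has_integral_eq[rotated]) (use True in \<open>auto simp: J_def\<close>)
  next
    case False
    have "((\<lambda>r. exp (2 * L * (s\<^sub>0 - r))) has_integral
        (- exp (2 * L * (s\<^sub>0 - s\<^sub>0)) / (2 * L) - (- exp (2 * L * (s\<^sub>0 - m)) / (2 * L)))) {m..s\<^sub>0}"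
      using L False by (intro fundamental_theorem_of_calculus)
        (auto intro!: derivative_eq_intros simp flip: has_real_derivative_iff_has_vector_derivative)
    then have "((\<lambda>r. exp (2 * L * (s\<^sub>0 - r))) has_integral (exp (2 * L * \<bar>m - s\<^sub>0\<bar>) - 1) / (2 * L)) J"
      using False by (simp add: J_def diff_divide_distrib)
    then show ?thesis
      by (rule has_integral_eq[rotated]) (use False in \<open>auto simp: J_def\<close>)
  qed
  have "integral J w \<le> integral J (\<lambda>r. v m * exp (2 * L * \<bar>r - s\<^sub>0\<bar>))"
  proof (rule integral_le)
    show "w integrable_on J"
      using continuous_on_subset[OF w J] unfolding J_def by (rule integrable_continuous_real)
    show "(\<lambda>r. v m * exp (2 * L * \<bar>r - s\<^sub>0\<bar>)) integrable_on J"
      using has_integral_mult_right[OF int, of "v m"] by (auto simp: integrable_on_def)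
  qed (use w_le J in auto)
  also have "\<dots> = v m * ((exp (2 * L * \<bar>m - s\<^sub>0\<bar>) - 1) / (2 * L))"
    using integral_unique[OF int] by simp
  finally have "L * integral J w \<le> v m * (exp (2 * L * \<bar>m - s\<^sub>0\<bar>) - 1) / 2"
    using L by (simp add: field_simps)
  with le[OF m(1)] have wm: "w m \<le> c + v m * (exp (2 * L * \<bar>m - s\<^sub>0\<bar>) - 1) / 2"
    by (simp add: J_def)
  have wm_eq: "w m = v m * exp (2 * L * \<bar>m - s\<^sub>0\<bar>)"
    by (simp add: v_def mult.assoc mult.left_commute flip: exp_add)
  define E where "E = exp (2 * L * \<bar>m - s\<^sub>0\<bar>)"
  have E: "E \<ge> 1" using L by (simp add: E_def)
  from wm wm_eq have "v m * E \<le> c + (v m * E - v m) / 2"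
    by (simp add: right_diff_distrib flip: E_def)
  then have "v m * (E + 1) \<le> 2 * c" by (simp add: field_simps)
  with c E have "v m \<le> 2 * c"
    by (smt (verit) mult_left_le mult_le_cancel_left1 mult_nonneg_nonneg)
  then have "v m * exp (2 * L * \<bar>s - s\<^sub>0\<bar>) \<le> 2 * c * exp (2 * L * \<bar>s - s\<^sub>0\<bar>)"
    by (rule mult_right_mono) simp
  with w_le[OF s] show ?thesis by linarith
qed

text \<open>A vector field on [0,T] that is measurable in time along every continuous curve, bounded
  by C and Lipschitz in space with constant L.\<close>

definition time_measurable_field ::
    "real \<Rightarrow> real \<Rightarrow> real \<Rightarrow> (real \<Rightarrow> 'a \<Rightarrow> 'a::euclidean_space) \<Rightarrow> bool" where
  "time_measurable_field T C L g \<longleftrightarrow>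
     (\<forall>z. continuous_on {0..T} z \<longrightarrow> (\<lambda>s. g s (z s)) \<in> borel_measurable (lebesgue_on {0..T})) \<and>
     (\<forall>s\<in>{0..T}. \<forall>y. norm (g s y) \<le> C) \<and>
     (\<forall>s\<in>{0..T}. \<forall>y y'. norm (g s y - g s y') \<le> L * norm (y - y'))"

text \<open>The initial value problem in integrated form, with continuous solutions.\<close>

definition integral_solution ::
    "real \<Rightarrow> (real \<Rightarrow> 'a \<Rightarrow> 'a::euclidean_space) \<Rightarrow> 'a \<Rightarrow> (real \<Rightarrow> 'a) \<Rightarrow> bool" where
  "integral_solution T g x z \<longleftrightarrow> continuous_on {0..T} z \<and>
     (\<forall>t\<in>{0..T}. z t = x + integral {0..t} (\<lambda>s. g s (z s)))"

lemma time_measurable_field_absolutely_integrable: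
  assumes g: "time_measurable_field T C L g" and z: "continuous_on {0..T} z" and S: "S \<subseteq> {0..T}" "S = {a..b}"
  shows "(\<lambda>s. g s (z s)) absolutely_integrable_on S"
proof (rule measurable_bounded_by_integrable_imp_absolutely_integrable)
  have "(\<lambda>s. g s (z s)) \<in> borel_measurable (lebesgue_on {0..T})"
    using g z by (auto simp: time_measurable_field_def)
  then show "(\<lambda>s. g s (z s)) \<in> borel_measurable (lebesgue_on S)"
    by (rule measurable_restrict_mono) (use S in auto)
  show "(\<lambda>_. C) integrable_on S" unfolding S by (rule integrable_const_ivl)
  show "norm (g s (z s)) \<le> C" if "s \<in> S" for s
    using g S that by (auto simp: time_measurable_field_def)
qed (use S in auto)

lemma time_measurable_field_integrable:
  assumes "time_measurable_field T C L g" "continuous_on {0..T} z" "{a..b} \<subseteq> {0..T}"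
  shows "(\<lambda>s. g s (z s)) integrable_on {a..b}"
  using time_measurable_field_absolutely_integrable[OF assms refl]
  by (rule set_lebesgue_integral_eq_integral(1))

lemma norm_integral_le_const:
  fixes h :: "real \<Rightarrow> 'a::euclidean_space"
  assumes "h integrable_on {a..b}" "a \<le> b" "\<And>s. s \<in> {a..b} \<Longrightarrow> norm (h s) \<le> C"
  shows "norm (integral {a..b} h) \<le> C * (b - a)"
proof -
  have "norm (integral {a..b} h) \<le> integral {a..b} (\<lambda>_. C)"
    using assms by (intro integral_norm_bound_integral) auto
  then show ?thesis using assms(2) by (simp add: mult.commute)
qed

lemma integral_solution_exists:
  fixes g :: "real \<Rightarrow> 'a::euclidean_space \<Rightarrow> 'a"
  assumes T: "T \<ge> 0" and L: "L > 0" and g: "time_measurable_field T C L g"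
  shows "\<exists>z. integral_solution T g x z"
proof -
  \<comment> \<open>Picard iteration contracts the weighted supremum norm with weight \<open>exp (- 2 L t)\<close>;
      times outside [0,T] are clamped by \<open>p\<close>.\<close>
  define p where "p t = max 0 (min t T)" for t :: real
  have p: "p t \<in> {0..T}" for t using T by (auto simp: p_def)
  have p_id: "p t = t" if "t \<in> {0..T}" for t using that by (auto simp: p_def)
  have pc: "continuous_on S p" for S unfolding p_def by (intro continuous_intros)
  define E where "E w s = exp (2 * L * s) *\<^sub>R apply_bcontfun w s" for w :: "real \<Rightarrow>\<^sub>C 'a" and s
  have E: "continuous_on {0..T} (E w)" for w
    unfolding E_def by (intro continuous_intros continuous_on_apply_bcontfun)
  define F where "F w t = exp (- 2 * L * p t) *\<^sub>R (x + integral {0..p t} (\<lambda>s. g s (E w s)))"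
    for w t
  have Int: "(\<lambda>s. g s (E w s)) integrable_on {0..t}" if "t \<in> {0..T}" for w t
    using that by (intro time_measurable_field_integrable[OF g E]) auto
  have C: "C \<ge> 0"
  proof -
    have "norm (g 0 x) \<le> C" using g T by (simp add: time_measurable_field_def)
    then show ?thesis using norm_ge_zero order_trans by blast
  qed
  have F: "F w \<in> bcontfun" for w
  proof (rule bcontfun_normI)
    have "continuous_on {0..T} (\<lambda>t. integral {0..t} (\<lambda>s. g s (E w s)))"
      using Int[of T w] T by (intro indefinite_integral_continuous_1) auto
    then have "continuous_on UNIV (\<lambda>t. integral {0..p t} (\<lambda>s. g s (E w s)))"
      by (rule continuous_on_compose2[OF _ pc]) (use p in auto)
    then show "continuous_on UNIV (F w)"
      unfolding F_def by (intro continuous_intros pc)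
    fix t
    have "norm (integral {0..p t} (\<lambda>s. g s (E w s))) \<le> C * (p t - 0)"
      using p[of t] g by (intro norm_integral_le_const Int) (auto simp: time_measurable_field_def)
    also have "\<dots> \<le> C * T" using p[of t] C by (intro mult_left_mono) auto
    finally have "norm (x + integral {0..p t} (\<lambda>s. g s (E w s))) \<le> norm x + C * T"
      by (intro norm_triangle_le) auto
    moreover have "exp (- 2 * L * p t) \<le> 1" using p[of t] L by auto
    ultimately show "norm (F w t) \<le> norm x + C * T"
      unfolding F_def by (auto intro: order_trans[OF mult_left_le_one_le])
  qed
  have dist_F: "dist (Bcontfun (F w)) (Bcontfun (F w')) \<le> 1/2 * dist w w'" for w w'
  proof (rule dist_bound)
    fix t
    define d where "d = dist w w'"
    have d: "norm (w s - w' s) \<le> d" for s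
      using dist_bounded[of w s w'] by (simp add: d_def dist_norm)
    have pt: "p t \<in> {0..T}" "0 \<le> p t" using p[of t] by auto
    have exp_int: "((\<lambda>s. L * d * exp (2 * L * s)) has_integral
        (d * exp (2 * L * p t) / 2 - d * exp (2 * L * 0) / 2)) {0..p t}"
      using L pt by (intro fundamental_theorem_of_calculus)
        (auto intro!: derivative_eq_intros simp flip: has_real_derivative_iff_has_vector_derivative)
    have "integral {0..p t} (\<lambda>s. g s (E w s)) - integral {0..p t} (\<lambda>s. g s (E w' s))
        = integral {0..p t} (\<lambda>s. g s (E w s) - g s (E w' s))"
      using Int pt by (intro integral_diff[symmetric]) auto
    also have "norm \<dots> \<le> integral {0..p t} (\<lambda>s. L * d * exp (2 * L * s))"
    proof (rule integral_norm_bound_integral)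
      show "(\<lambda>s. g s (E w s) - g s (E w' s)) integrable_on {0..p t}"
        using Int pt by (intro integrable_diff) auto
      show "(\<lambda>s. L * d * exp (2 * L * s)) integrable_on {0..p t}"
        using exp_int by (auto simp: integrable_on_def)
      fix s assume "s \<in> {0..p t}"
      then have "norm (g s (E w s) - g s (E w' s)) \<le> L * norm (E w s - E w' s)"
        using g pt by (auto simp: time_measurable_field_def)
      also have "norm (E w s - E w' s) = exp (2 * L * s) * norm (w s - w' s)"
        by (simp add: E_def flip: scaleR_diff_right)
      also have "L * \<dots> \<le> L * d * exp (2 * L * s)"
        using L d[of s] by (simp add: mult.commute)
      finally show "norm (g s (E w s) - g s (E w' s)) \<le> L * d * exp (2 * L * s)" .
    qed
    also have "\<dots> \<le> d / 2 * exp (2 * L * p t)"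
      using integral_unique[OF exp_int] d[of 0] order_trans[OF norm_ge_zero d[of 0]] by simp
    finally have "exp (- 2 * L * p t) * norm (integral {0..p t} (\<lambda>s. g s (E w s)) - integral {0..p t} (\<lambda>s. g s (E w' s)))
        \<le> exp (- 2 * L * p t) * (d / 2 * exp (2 * L * p t))"
      by (intro mult_left_mono) auto
    also have "\<dots> = d / 2" by (simp flip: exp_add)
    finally have "norm (F w t - F w' t) \<le> d / 2"
      by (simp add: F_def flip: scaleR_diff_right)
    then show "dist (Bcontfun (F w) t) (Bcontfun (F w') t) \<le> 1/2 * dist w w'"
      by (simp add: Bcontfun_inverse[OF F] dist_norm d_def)
  qed
  have "\<exists>!w. Bcontfun (F w) = w"
    using dist_F by (intro banach_fix_type[of "1/2"]) auto
  then obtain w where w: "Bcontfun (F w) = w" by blast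
  then have "F w t = w t" for t by (metis Bcontfun_inverse[OF F])
  then have "E w t = x + integral {0..t} (\<lambda>s. g s (E w s))" if "t \<in> {0..T}" for t
  proof -
    have "w t = exp (- 2 * L * t) *\<^sub>R (x + integral {0..t} (\<lambda>s. g s (E w s)))"
      using \<open>\<And>t. F w t = w t\<close>[of t] p_id[OF that] by (simp add: F_def)
    moreover have "exp (2 * L * t) * exp (- 2 * L * t) = 1" by (simp flip: exp_add)
    ultimately show ?thesis unfolding E_def[of w t] by (simp only: scaleR_scaleR scaleR_one)
  qed
  with E show ?thesis unfolding integral_solution_def by blast
qed

lemma integral_solution_lipschitz_time:
  assumes g: "time_measurable_field T C L g" and z: "integral_solution T g x z"
    and st: "s \<in> {0..T}" "t \<in> {0..T}"
  shows "norm (z t - z s) \<le> C * \<bar>t - s\<bar>"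
proof -
  have *: "norm (z t - z s) \<le> C * (t - s)" if st: "s \<in> {0..T}" "t \<in> {0..T}" "s \<le> t" for s t
  proof -
    have c: "continuous_on {0..T} z" using z by (simp add: integral_solution_def)
    have "integral {0..s} (\<lambda>r. g r (z r)) + integral {s..t} (\<lambda>r. g r (z r)) = integral {0..t} (\<lambda>r. g r (z r))"
      using st by (intro Henstock_Kurzweil_Integration.integral_combine time_measurable_field_integrable[OF g c]) auto
    then have "z t - z s = integral {s..t} (\<lambda>r. g r (z r))"
      using z st by (simp add: integral_solution_def diff_eq_eq add.commute)
    moreover have "norm (integral {s..t} (\<lambda>r. g r (z r))) \<le> C * (t - s)"
      using st g by (intro norm_integral_le_const time_measurable_field_integrable[OF g c])
        (auto simp: time_measurable_field_def)
    ultimately show ?thesis by simp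
  qed
  show ?thesis
    using *[of s t] *[of t s] st by (cases "s \<le> t") (auto simp: norm_minus_commute)
qed

text \<open>Two solutions of the same equation control each other forwards and backwards in time.\<close>

lemma integral_solution_two_point:
  fixes g :: "real \<Rightarrow> 'a::euclidean_space \<Rightarrow> 'a"
  assumes L: "L > 0" and g: "time_measurable_field T C L g"
    and z: "integral_solution T g x z" and z': "integral_solution T g x' z'"
    and s: "s \<in> {0..T}" and t: "t \<in> {0..T}"
  shows "norm (z t - z' t) \<le> 2 * norm (z s - z' s) * exp (2 * L * \<bar>t - s\<bar>)"
proof (rule gronwall_two_sided[OF L _ s _ _ t])
  have c: "continuous_on {0..T} z" "continuous_on {0..T} z'"
    using z z' by (auto simp: integral_solution_def)
  then show "continuous_on {0..T} (\<lambda>r. norm (z r - z' r))" by (intro continuous_intros)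
  fix r assume r: "r \<in> {0..T}"
  define a b where "a = min s r" and "b = max s r"
  have ab: "a \<le> b" "0 \<le> a" "b \<le> T" using r s by (auto simp: a_def b_def)
  have Int: "(\<lambda>q. g q (z q)) integrable_on {i..j}" "(\<lambda>q. g q (z' q)) integrable_on {i..j}"
    if "0 \<le> i" "j \<le> T" for i j
    using that by (auto intro!: time_measurable_field_integrable[OF g] c)
  have "z b - z a = integral {a..b} (\<lambda>q. g q (z q))" "z' b - z' a = integral {a..b} (\<lambda>q. g q (z' q))"
    using Henstock_Kurzweil_Integration.integral_combine[OF ab(2,1) Int(1)]
      Henstock_Kurzweil_Integration.integral_combine[OF ab(2,1) Int(2)] z z' ab
    by (simp_all add: integral_solution_def diff_eq_eq add.commute)
  then have "(z b - z' b) - (z a - z' a) = integral {a..b} (\<lambda>q. g q (z q) - g q (z' q))"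
    using integral_diff[OF Int, of a b] ab by (simp add: algebra_simps)
  moreover have "norm \<dots> \<le> integral {a..b} (\<lambda>q. L * norm (z q - z' q))"
  proof (rule integral_norm_bound_integral)
    show "(\<lambda>q. g q (z q) - g q (z' q)) integrable_on {a..b}"
      using Int ab by (intro integrable_diff) auto
    show "(\<lambda>q. L * norm (z q - z' q)) integrable_on {a..b}"
      using ab by (intro integrable_continuous_real continuous_intros continuous_on_subset[OF c(1)]
        continuous_on_subset[OF c(2)]) auto
    show "norm (g q (z q) - g q (z' q)) \<le> L * norm (z q - z' q)" if "q \<in> {a..b}" for q
      using that ab g by (auto simp: time_measurable_field_def)
  qed
  ultimately have "norm ((z b - z' b) - (z a - z' a)) \<le> L * integral {a..b} (\<lambda>q. norm (z q - z' q))"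
    by simp
  moreover have "norm ((z r - z' r) - (z s - z' s)) = norm ((z b - z' b) - (z a - z' a))"
    by (cases "s \<le> r") (auto simp: a_def b_def norm_minus_commute)
  ultimately show "norm (z r - z' r) \<le> norm (z s - z' s) + L * integral {min s r..max s r} (\<lambda>q. norm (z q - z' q))"
    using norm_triangle_ineq2[of "z r - z' r" "z s - z' s"] by (simp add: a_def b_def)
qed simp

lemma pointwise_imp_uniform_if_equi_lipschitz:
  fixes e :: "nat \<Rightarrow> real \<Rightarrow> 'a::real_normed_vector"
  assumes lim: "\<And>t. t \<in> {0..T} \<Longrightarrow> (\<lambda>k. e k t) \<longlonglongrightarrow> 0"
    and lip: "\<And>k s t. s \<in> {0..T} \<Longrightarrow> t \<in> {0..T} \<Longrightarrow> norm (e k t - e k s) \<le> C * \<bar>t - s\<bar>"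
    and \<epsilon>: "\<epsilon> > 0"
  shows "\<forall>\<^sub>F k in sequentially. \<forall>t\<in>{0..T}. norm (e k t) \<le> \<epsilon>"
proof -
  define \<delta> where "\<delta> = \<epsilon> / (2 * (\<bar>C\<bar> + 1))"
  have \<delta>: "\<delta> > 0" using \<epsilon> by (simp add: \<delta>_def)
  obtain K where K: "finite K" "K \<subseteq> {0..T}" "{0..T} \<subseteq> (\<Union>x\<in>K. ball x \<delta>)"
    using compact_eq_totally_bounded[of "{0..T}"] compact_Icc \<delta> seq_compact_imp_totally_bounded
    by (metis compact_imp_seq_compact)
  have "\<forall>\<^sub>F k in sequentially. \<forall>s\<in>K. norm (e k s) < \<epsilon> / 2"
  proof (intro eventually_ball_finite ballI K(1))
    fix s assume "s \<in> K"
    then have "(\<lambda>k. norm (e k s)) \<longlonglongrightarrow> 0" using lim K(2) by (intro tendsto_norm_zero) auto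
    then show "\<forall>\<^sub>F k in sequentially. norm (e k s) < \<epsilon> / 2"
      by (rule order_tendstoD(2)) (use \<epsilon> in simp)
  qed
  then show ?thesis
  proof (rule eventually_mono, intro ballI)
    fix k t assume k: "\<forall>s\<in>K. norm (e k s) < \<epsilon> / 2" and t: "t \<in> {0..T}"
    then obtain s where s: "s \<in> K" "\<bar>t - s\<bar> < \<delta>" using K(3) by (force simp: dist_real_def abs_minus_commute)
    have "norm (e k t - e k s) \<le> C * \<bar>t - s\<bar>" using s K(2) t by (intro lip) auto
    also have "\<dots> \<le> (\<bar>C\<bar> + 1) * \<delta>" using s by (intro mult_mono) auto
    also have "\<dots> = \<epsilon> / 2" using \<epsilon> by (simp add: \<delta>_def field_simps)
    finally show "norm (e k t) \<le> \<epsilon>"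
      using k s norm_triangle_ineq2[of "e k t" "e k s"] by fastforce
  qed
qed

text \<open>Solutions depend continuously on the field in a weak sense: it suffices that the
  time integrals of the fields converge along the limit solution.\<close>

lemma integral_solution_convergence:
  fixes g :: "nat \<Rightarrow> real \<Rightarrow> 'a::euclidean_space \<Rightarrow> 'a"
  assumes L: "L > 0" and gk: "\<And>k. time_measurable_field T C L (g k)"
    and h: "time_measurable_field T C L h"
    and zk: "\<And>k. integral_solution T (g k) x (z k)" and y: "integral_solution T h x y"
    and lim: "\<And>t. t \<in> {0..T} \<Longrightarrow>
      (\<lambda>k. integral {0..t} (\<lambda>s. g k s (y s))) \<longlonglongrightarrow> integral {0..t} (\<lambda>s. h s (y s))"
    and t: "t \<in> {0..T}"
  shows "(\<lambda>k. z k t) \<longlonglongrightarrow> y t"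
proof -
  have T: "0 \<in> {0..T}" using t by auto
  have cy: "continuous_on {0..T} y" and cz: "continuous_on {0..T} (z k)" for k
    using y zk[of k] by (auto simp: integral_solution_def)
  have Int: "(\<lambda>s. g k s (y s)) integrable_on {a..b}" "(\<lambda>s. h s (y s)) integrable_on {a..b}"
    "(\<lambda>s. g k s (z k s)) integrable_on {a..b}"
    if "0 \<le> a" "b \<le> T" for a b k
    using that by (auto intro!: time_measurable_field_integrable[OF gk] time_measurable_field_integrable[OF h] cy cz)
  define e where "e k t = integral {0..t} (\<lambda>s. g k s (y s) - h s (y s))" for k t
  have e_lim: "(\<lambda>k. e k t) \<longlonglongrightarrow> 0" if "t \<in> {0..T}" for t
  proof -
    have "e k t = integral {0..t} (\<lambda>s. g k s (y s)) - integral {0..t} (\<lambda>s. h s (y s))" for k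
      unfolding e_def using that Int by (intro integral_diff) auto
    then show ?thesis using lim[OF that] by (simp add: LIM_zero)
  qed
  have e_lip: "norm (e k t - e k s) \<le> 2 * C * \<bar>t - s\<bar>" if "s \<in> {0..T}" "t \<in> {0..T}" for k s t
  proof -
    have *: "norm (e k t - e k s) \<le> 2 * C * (t - s)" if "0 \<le> s" "s \<le> t" "t \<le> T" for s t
    proof -
      have I: "(\<lambda>s. g k s (y s) - h s (y s)) integrable_on {a..b}" if "0 \<le> a" "b \<le> T" for a b
        using Int that by (intro integrable_diff) auto
      have "norm (g k r (y r) - h r (y r)) \<le> 2 * C" if "r \<in> {s..t}" for r
      proof -
        have "norm (g k r (y r)) \<le> C" "norm (h r (y r)) \<le> C"
          using gk[of k] h that \<open>0 \<le> s\<close> \<open>t \<le> T\<close> by (auto simp: time_measurable_field_def)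
        then show ?thesis using norm_triangle_ineq4[of "g k r (y r)" "h r (y r)"] by linarith
      qed
      moreover have "e k t - e k s = integral {s..t} (\<lambda>s. g k s (y s) - h s (y s))"
        unfolding e_def using Henstock_Kurzweil_Integration.integral_combine[of 0 s t, OF _ _ I] that
        by (simp add: algebra_simps)
      ultimately show ?thesis
        using norm_integral_le_const[OF I \<open>s \<le> t\<close>] that by auto
    qed
    show ?thesis using *[of s t] *[of t s] that by (cases "s \<le> t") (auto simp: norm_minus_commute)
  qed
  have est: "norm (z k t - y t) \<le> 2 * \<epsilon> * exp (2 * L * \<bar>t - 0\<bar>)"
    if e: "\<forall>t\<in>{0..T}. norm (e k t) \<le> \<epsilon>" for k \<epsilon>
  proof (rule gronwall_two_sided[OF L _ T _ _ t])
    show "continuous_on {0..T} (\<lambda>r. norm (z k r - y r))" by (intro continuous_intros cz cy)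
    show "0 \<le> \<epsilon>" using e t order_trans[OF norm_ge_zero] by blast
    fix r assume r: "r \<in> {0..T}"
    have I: "(\<lambda>s. g k s (z k s) - g k s (y s)) integrable_on {0..r}"
      using Int r by (intro integrable_diff) auto
    have "z k r - y r = integral {0..r} (\<lambda>s. g k s (z k s)) - integral {0..r} (\<lambda>s. h s (y s))"
      using zk[of k] y r by (simp add: integral_solution_def)
    also have "\<dots> = integral {0..r} (\<lambda>s. g k s (z k s) - g k s (y s)) + e k r"
      using Int r by (simp add: e_def integral_diff)
    finally have "norm (z k r - y r) \<le> norm (integral {0..r} (\<lambda>s. g k s (z k s) - g k s (y s))) + norm (e k r)"
      by (simp add: norm_triangle_ineq)
    also have "norm (integral {0..r} (\<lambda>s. g k s (z k s) - g k s (y s))) \<le> integral {0..r} (\<lambda>s. L * norm (z k s - y s))"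
    proof (rule integral_norm_bound_integral[OF I])
      show "(\<lambda>s. L * norm (z k s - y s)) integrable_on {0..r}"
        using r by (intro integrable_continuous_real continuous_intros continuous_on_subset[OF cz]
          continuous_on_subset[OF cy]) auto
      show "norm (g k s (z k s) - g k s (y s)) \<le> L * norm (z k s - y s)" if "s \<in> {0..r}" for s
        using that r gk[of k] by (auto simp: time_measurable_field_def)
    qed
    also have "norm (e k r) \<le> \<epsilon>" using e r by auto
    finally show "norm (z k r - y r) \<le> \<epsilon> + L * integral {min 0 r..max 0 r} (\<lambda>r. norm (z k r - y r))"
      using r by (simp add: min_absorb1 max_absorb2)
  qed
  show ?thesis
  proof (rule LIMSEQ_I)
    fix r :: real assume "r > 0"
    define \<epsilon> where "\<epsilon> = r / (4 * exp (2 * L * \<bar>t - 0\<bar>))"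
    have "\<epsilon> > 0" using \<open>r > 0\<close> by (simp add: \<epsilon>_def)
    from pointwise_imp_uniform_if_equi_lipschitz[OF e_lim e_lip this]
    obtain N where "\<And>k. k \<ge> N \<Longrightarrow> \<forall>t\<in>{0..T}. norm (e k t) \<le> \<epsilon>"
      by (auto simp: eventually_sequentially)
    moreover have "2 * \<epsilon> * exp (2 * L * \<bar>t - 0\<bar>) < r" using \<open>r > 0\<close> by (simp add: \<epsilon>_def)
    ultimately show "\<exists>N. \<forall>k\<ge>N. norm (z k t - y t) < r" using est by (meson le_less_trans)
  qed
qed

section \<open>Weak compactness of probability kernels on the real line\<close>

lemma bounded_diagonal_subsequence:
  fixes X :: "nat \<Rightarrow> nat \<Rightarrow> real"
  assumes bdd: "\<And>k n. \<bar>X k n\<bar> \<le> B"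
  obtains r :: "nat \<Rightarrow> nat" where "strict_mono r" "\<And>n. convergent (\<lambda>k. X (r k) n)"
proof -
  let ?P = "\<lambda>n s. convergent (\<lambda>k. X (s k) n)"
  interpret nat: subseqs ?P
  proof
    fix n :: nat and s :: "nat \<Rightarrow> nat" assume s: "strict_mono s"
    have "\<forall>k. X (s k) n \<in> {-B..B}" using bdd by (simp add: abs_le_iff minus_le_iff)
    then obtain l s' where "strict_mono s'" "((\<lambda>k. X (s k) n) \<circ> s') \<longlonglongrightarrow> l"
      using compact_Icc[of "-B" B] unfolding compact_eq_seq_compact_metric seq_compact_def by metis
    then show "\<exists>s'. strict_mono s' \<and> ?P n (s \<circ> s')" by (auto simp: comp_def convergent_def)
  qed
  have "?P n nat.diagseq" for n
  proof -
    have "?P n (nat.seqseq (Suc n))" by (rule nat.seqseq_holds)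
    then have "convergent ((\<lambda>k. X (nat.seqseq (Suc n) k) n) \<circ> (\<lambda>k. nat.fold_reduce (Suc n) k (Suc n + k)))"
      by (rule convergent_subseq_convergent[OF _ nat.subseq_diagonal_rest])
    then have "?P n (nat.diagseq \<circ> ((+) (Suc n)))"
      unfolding nat.diagseq_seqseq by (simp only: comp_def)
    then obtain L where "(\<lambda>k. X (nat.diagseq (k + Suc n)) n) \<longlonglongrightarrow> L"
      unfolding convergent_def comp_def by (auto simp: add.commute)
    then have "(\<lambda>k. X (nat.diagseq k) n) \<longlonglongrightarrow> L"
      by (rule LIMSEQ_offset[where f="\<lambda>k. X (nat.diagseq k) n"])
    then show ?thesis by (auto simp: convergent_def)
  qed
  then show ?thesis using that nat.subseq_diagseq by blast
qed

lemma convergent_if_uniformly_approximable: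
  fixes X :: "nat \<Rightarrow> real"
  assumes "\<And>e. e > 0 \<Longrightarrow> \<exists>Y. convergent Y \<and> (\<forall>k. \<bar>X k - Y k\<bar> \<le> e)"
  shows "convergent X"
proof (rule Cauchy_convergent, rule metric_CauchyI)
  fix e :: real assume "e > 0"
  then obtain Y where Y: "convergent Y" "\<And>k. \<bar>X k - Y k\<bar> \<le> e / 4"
    using assms[of "e/4"] by auto
  then obtain N where N: "\<And>m n. m \<ge> N \<Longrightarrow> n \<ge> N \<Longrightarrow> dist (Y m) (Y n) < e / 4"
    using convergent_Cauchy[OF Y(1)] \<open>e > 0\<close> unfolding Cauchy_def by (metis divide_pos_pos zero_less_numeral)
  have "dist (X m) (X n) < e" if "m \<ge> N" "n \<ge> N" for m n
    using N[OF that] Y(2)[of m] Y(2)[of n] \<open>e > 0\<close>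
    unfolding dist_real_def by linarith
  then show "\<exists>M. \<forall>m\<ge>M. \<forall>n\<ge>M. dist (X m) (X n) < e" by blast
qed

lemma lebesgue_on_bounded_integrable:
  fixes h :: "real \<Rightarrow> 'a::euclidean_space"
  assumes h: "h \<in> borel_measurable (lebesgue_on {0..T})" and B: "\<And>s. s \<in> {0..T} \<Longrightarrow> norm (h s) \<le> B"
    and ab: "{a..b} \<subseteq> {0..T}"
  shows "h absolutely_integrable_on {a..b}" "h integrable_on {a..b}"
proof -
  show "h absolutely_integrable_on {a..b}"
  proof (rule measurable_bounded_by_integrable_imp_absolutely_integrable)
    show "h \<in> borel_measurable (lebesgue_on {a..b})"
      by (rule measurable_restrict_mono[OF h ab])
    show "(\<lambda>_. B) integrable_on {a..b}" by (rule integrable_const_ivl)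
  qed (use B ab in auto)
  then show "h integrable_on {a..b}" by (rule set_lebesgue_integral_eq_integral(1))
qed

lemma subsequence_of_convergent_primitives:
  fixes F :: "nat \<Rightarrow> real \<Rightarrow> real \<Rightarrow> real"
  assumes T: "T \<ge> 0" and meas: "\<And>k q. F k q \<in> borel_measurable (lebesgue_on {0..T})"
    and F: "\<And>k q t. t \<in> {0..T} \<Longrightarrow> 0 \<le> F k q t \<and> F k q t \<le> 1"
  obtains r H where "strict_mono r"
    "\<And>q t. q \<in> \<rat> \<Longrightarrow> t \<in> {0..T} \<Longrightarrow> (\<lambda>k. integral {0..t} (F (r k) q)) \<longlonglongrightarrow> H q t"
proof -
  define p where "p t = max 0 (min t T)" for t :: real
  have p: "p t \<in> {0..T}" for t using T by (auto simp: p_def)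
  have p_near: "\<bar>t - p s\<bar> \<le> \<bar>t - s\<bar>" if "t \<in> {0..T}" for s t
    using that by (auto simp: p_def)
  have int: "F k q integrable_on {a..b}" if "{a..b} \<subseteq> {0..T}" for k q a b
    using F by (intro lebesgue_on_bounded_integrable(2)[OF meas _ that, of k q 1]) auto
  have lip: "\<bar>integral {0..t} (F k q) - integral {0..s} (F k q)\<bar> \<le> \<bar>t - s\<bar>"
    if "s \<in> {0..T}" "t \<in> {0..T}" for k q s t
  proof -
    have *: "\<bar>integral {0..t} (F k q) - integral {0..s} (F k q)\<bar> \<le> t - s"
      if "0 \<le> s" "s \<le> t" "t \<le> T" for s t
    proof -
      have "integral {0..t} (F k q) - integral {0..s} (F k q) = integral {s..t} (F k q)"
        using Henstock_Kurzweil_Integration.integral_combine[of 0 s t "F k q"] int[of 0 t] that by auto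
      moreover have "norm (integral {s..t} (F k q)) \<le> 1 * (t - s)"
        using that F[of _ k q] by (intro norm_integral_le_const int) auto
      ultimately show ?thesis by simp
    qed
    show ?thesis using *[of s t] *[of t s] that by (cases "s \<le> t") auto
  qed
  define X where "X k n = (case from_nat n of (a, b) \<Rightarrow> integral {0..p (of_rat a)} (F k (of_rat b)))"
    for k n
  have "\<bar>X k n\<bar> \<le> T" for k n
  proof -
    obtain a b where ab: "(from_nat n :: rat \<times> rat) = (a, b)" by fastforce
    show ?thesis
      using lip[of 0 "p (of_rat a)" k "of_rat b"] p[of "of_rat a"] T by (simp add: X_def ab)
  qed
  then obtain r where r: "strict_mono r" "\<And>n. convergent (\<lambda>k. X (r k) n)"
    using bounded_diagonal_subsequence[of X T] by metis
  have conv: "convergent (\<lambda>k. integral {0..t} (F (r k) q))" if q: "q \<in> \<rat>" and t: "t \<in> {0..T}" for q t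
  proof (rule convergent_if_uniformly_approximable)
    fix e :: real assume "e > 0"
    then obtain a :: rat where a: "t - e < of_rat a" "of_rat a < t + e"
      using of_rat_dense[of "t - e" "t + e"] by auto
    obtain b where b: "q = of_rat b" using q by (auto simp: Rats_def)
    define Y where "Y k = X (r k) (to_nat (a, b))" for k
    have "Y k = integral {0..p (of_rat a)} (F (r k) q)" for k
      by (simp add: Y_def X_def b)
    then have "\<bar>integral {0..t} (F (r k) q) - Y k\<bar> \<le> e" for k
      using lip[OF p[of "of_rat a"] t, of "r k" q] p_near[OF t, of "of_rat a"] a by simp
    then show "\<exists>Y. convergent Y \<and> (\<forall>k. \<bar>integral {0..t} (F (r k) q) - Y k\<bar> \<le> e)"
      using r(2) unfolding Y_def by blast
  qed
  show ?thesis
    by (rule that[OF r(1), of "\<lambda>q t. lim (\<lambda>k. integral {0..t} (F (r k) q))"])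
      (rule convergent_LIMSEQ_iff[THEN iffD1, OF conv])
qed

lemma AE_le_if_density_le:
  assumes [measurable]: "f \<in> borel_measurable M" "g \<in> borel_measurable M"
    and fin: "(\<integral>\<^sup>+x. f x \<partial>M) \<noteq> \<infinity>"
    and le: "\<And>A. A \<in> sets M \<Longrightarrow> emeasure (density M f) A \<le> emeasure (density M g) A"
  shows "AE x in M. f x \<le> (g x :: ennreal)"
proof -
  define A where "A = {x\<in>space M. g x < f x}"
  have [measurable]: "A \<in> sets M" by (simp add: A_def)
  have fA: "(\<integral>\<^sup>+x. f x * indicator A x \<partial>M) \<noteq> \<infinity>"
  proof -
    have "(\<integral>\<^sup>+x. f x * indicator A x \<partial>M) \<le> (\<integral>\<^sup>+x. f x \<partial>M)"
      by (intro nn_integral_mono) (auto simp: indicator_def)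
    then show ?thesis using fin by (auto simp: top_unique)
  qed
  have gf: "(\<integral>\<^sup>+x. g x * indicator A x \<partial>M) \<le> (\<integral>\<^sup>+x. f x * indicator A x \<partial>M)"
    by (intro nn_integral_mono) (auto simp: A_def indicator_def)
  have "(\<integral>\<^sup>+x. f x * indicator A x - g x * indicator A x \<partial>M)
      = (\<integral>\<^sup>+x. f x * indicator A x \<partial>M) - (\<integral>\<^sup>+x. g x * indicator A x \<partial>M)"
    using gf fA by (intro nn_integral_diff) (auto simp: A_def indicator_def top_unique)
  also have "\<dots> = 0"
    using le[of A] fA by (simp add: emeasure_density diff_eq_0_iff_ennreal less_top)
  finally have "AE x in M. f x * indicator A x - g x * indicator A x = 0"
    by (subst (asm) nn_integral_0_iff_AE) auto
  then show ?thesis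
  proof (rule AE_mp, intro AE_I2 impI)
    fix x assume x: "x \<in> space M" and 0: "f x * indicator A x - g x * indicator A x = 0"
    show "f x \<le> g x"
    proof (rule ccontr)
      assume "\<not> f x \<le> g x"
      then have "x \<in> A" using x by (simp add: A_def)
      then have "f x - g x = 0" using 0 by simp
      with \<open>\<not> f x \<le> g x\<close> show False by (simp add: diff_eq_0_iff_ennreal)
    qed
  qed
qed

lemma dyadic_cell_real: "\<exists>a b. a \<le> b \<and> dyadic_cell n (x::real) = {a<..b}"
proof -
  define c where "c = real_of_int \<lceil>2^n * x\<rceil>"
  have "dyadic_cell n x = {(c - 1) / 2^n<..c / 2^n}"
  proof (rule set_eqI)
    fix y
    have "y \<in> dyadic_cell n x \<longleftrightarrow> \<lceil>2^n * y\<rceil> = \<lceil>2^n * x\<rceil>"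
      unfolding dyadic_cell_def Basis_real_def inner_real_def mem_Collect_eq
      by (metis insertI1 mult.right_neutral singletonD)
    also have "\<dots> \<longleftrightarrow> c - 1 < 2^n * y \<and> 2^n * y \<le> c"
      using ceiling_eq_iff[of "2^n * y" "\<lceil>2^n * x\<rceil>"] by (simp only: c_def of_int_diff of_int_1)
    also have "\<dots> \<longleftrightarrow> y \<in> {(c - 1) / 2^n<..c / 2^n}"
      by (simp add: divide_less_eq le_divide_eq mult.commute)
    finally show "y \<in> dyadic_cell n x \<longleftrightarrow> y \<in> {(c - 1) / 2^n<..c / 2^n}" .
  qed
  moreover have "(c - 1) / 2^n \<le> c / 2^n" by (simp add: divide_right_mono)
  ultimately show ?thesis by blast
qed

lemma sets_Collect_rat_Ball:
  assumes "\<And>q::real. q \<in> \<rat> \<Longrightarrow> {x\<in>space M. P q x} \<in> sets M"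
  shows "{x\<in>space M. \<forall>q\<in>\<rat>. P q x} \<in> sets M"
proof -
  have "{x\<in>space M. \<forall>r::rat. P (of_rat r) x} \<in> sets M"
    by (rule sets.sets_Collect_countable_All) (use assms in auto)
  then show ?thesis by (simp add: Rats_def)
qed

text \<open>A monotone family of nondecreasing 1-Lipschitz functions on [0,T] has a monotone family of
  densities with values in [0,1]. The exceptional null sets are removed by using the density 1
  there, so that monotonicity holds at every time.\<close>

lemma monotone_densities:
  fixes G :: "real \<Rightarrow> real \<Rightarrow> real"
  assumes T: "T \<ge> 0" and G0: "\<And>q. q \<in> \<rat> \<Longrightarrow> G q 0 = 0"
    and G: "\<And>q s t. q \<in> \<rat> \<Longrightarrow> 0 \<le> s \<Longrightarrow> s \<le> t \<Longrightarrow> t \<le> T \<Longrightarrow> 0 \<le> G q t - G q s \<and> G q t - G q s \<le> t - s"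
    and mono: "\<And>q q' s t. q \<in> \<rat> \<Longrightarrow> q' \<in> \<rat> \<Longrightarrow> q \<le> q' \<Longrightarrow> 0 \<le> s \<Longrightarrow> s \<le> t \<Longrightarrow> t \<le> T \<Longrightarrow>
      G q t - G q s \<le> G q' t - G q' s"
  shows "\<exists>f :: real \<Rightarrow> real \<Rightarrow> real.
    (\<forall>q\<in>\<rat>. f q \<in> borel_measurable borel) \<and> (\<forall>q t. 0 \<le> f q t) \<and> (\<forall>q t. f q t \<le> 1) \<and>
    (\<forall>q\<in>\<rat>. \<forall>q'\<in>\<rat>. \<forall>t. q \<le> q' \<longrightarrow> f q t \<le> f q' t) \<and>
    (\<forall>q\<in>\<rat>. \<forall>t\<in>{0..T}. (f q has_integral G q t) {0..t})"
proof -
  define p where "p t = max 0 (min t T)" for t :: real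
  have p: "0 \<le> p t" "p t \<le> T" for t using T by (auto simp: p_def)
  have p_mono: "p s \<le> p t" "p t - p s \<le> t - s" if "s \<le> t" for s t using that by (auto simp: p_def)
  define N where "N q = interval_measure (\<lambda>t. G q (p t))" for q
  have Gm: "G q (p s) \<le> G q (p t)" if "q \<in> \<rat>" "s \<le> t" for q s t
    using G[OF that(1) p(1) p_mono(1)[OF that(2)] p(2)] by simp
  have Gc: "continuous_on UNIV (\<lambda>t. G q (p t))" if q: "q \<in> \<rat>" for q
  proof -
    have "dist (G q (p s)) (G q (p t)) \<le> 1 * dist s t" for s t
    proof -
      have *: "dist (G q (p s)) (G q (p t)) \<le> dist s t" if "s \<le> t" for s t
        using G[OF q p(1) p_mono(1)[OF that] p(2)] p_mono(2)[OF that] that by (auto simp: dist_real_def)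
      show ?thesis using *[of s t] *[of t s] by (cases "s \<le> t") (auto simp: dist_commute)
    qed
    then have "1-lipschitz_on UNIV (\<lambda>t. G q (p t))" by (intro lipschitz_onI) auto
    then show ?thesis by (rule lipschitz_on_continuous_on)
  qed
  have Gr: "continuous (at_right a) (\<lambda>t. G q (p t))" if "q \<in> \<rat>" for q a
    using Gc[OF that] by (auto simp: continuous_on_eq_continuous_at intro: continuous_at_imp_continuous_at_within)
  have N_Ioc: "emeasure (N q) {a<..b} = ennreal (G q (p b) - G q (p a))" if "q \<in> \<rat>" "a \<le> b" for q a b
    unfolding N_def using that by (intro emeasure_interval_measure_Ioc Gm Gr)
  have N_Icc: "emeasure (N q) {a..b} = ennreal (G q (p b) - G q (p a))" if "q \<in> \<rat>" "a \<le> b" for q a b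
    unfolding N_def using that by (intro emeasure_interval_measure_Icc Gm Gc)
  have sN: "sets (N q) = sets borel" for q by (simp add: N_def)
  have N_le: "emeasure (N q) A \<le> emeasure lborel A" if q: "q \<in> \<rat>" and A: "A \<in> sets borel" for q A
  proof -
    have "emeasure (N q) A \<le> ennreal 1 * emeasure lborel A"
    proof (rule emeasure_le_lborel_if_cells_le[OF sN _ A])
      fix n and x :: real
      obtain a b where ab: "a \<le> b" "dyadic_cell n x = {a<..b}" using dyadic_cell_real by blast
      show "emeasure (N q) (dyadic_cell n x) \<le> ennreal 1 * emeasure lborel (dyadic_cell n x)"
        using ab G[OF q p(1) p_mono(1)[OF ab(1)] p(2)] p_mono(2)[OF ab(1)]
        by (simp add: N_Ioc[OF q] ennreal_leI)
    qed
    then show ?thesis by simp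
  qed
  have "emeasure (N q) UNIV \<le> ennreal T" if q: "q \<in> \<rat>" for q
  proof -
    have "(SUP n::nat. emeasure (N q) {- real n<..real n}) = emeasure (N q) UNIV"
      unfolding UN_Ioc_eq_UNIV[symmetric] by (rule SUP_emeasure_incseq) (auto simp: sN incseq_def)
    moreover have "emeasure (N q) {- real n<..real n} \<le> ennreal T" for n
    proof -
      have "G q (p (real n)) - G q (p (- real n)) \<le> p (real n) - p (- real n)"
        using G[OF q p(1) p_mono(1) p(2), of "- real n" "real n"] by simp
      also have "\<dots> \<le> T" using p[of "real n"] p[of "- real n"] by linarith
      finally show ?thesis by (simp add: N_Ioc[OF q] ennreal_leI)
    qed
    then have "(SUP n::nat. emeasure (N q) {- real n<..real n}) \<le> ennreal T" by (rule SUP_least)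
    ultimately show ?thesis by simp
  qed
  note N_UNIV = this
  have N_fin: "finite_measure (N q)" if "q \<in> \<rat>" for q
  proof (rule finite_measureI)
    have "emeasure (N q) UNIV < \<infinity>"
      using N_UNIV[OF that] by (rule le_less_trans) simp
    then show "emeasure (N q) (space (N q)) \<noteq> \<infinity>" by (simp add: N_def)
  qed
  have "\<exists>f\<in>borel_measurable lborel. density lborel f = N q" if q: "q \<in> \<rat>" for q
  proof (rule sigma_finite_measure.Radon_Nikodym[OF sigma_finite_lborel])
    show "absolutely_continuous lborel (N q)"
      unfolding absolutely_continuous_def
    proof
      fix A :: "real set" assume A: "A \<in> null_sets lborel"
      then have "A \<in> sets borel" "emeasure lborel A = 0" by (auto simp: null_sets_def)
      with N_le[OF q, of A] show "A \<in> null_sets (N q)" by (auto simp: null_sets_def sN)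
    qed
  qed (simp add: sN)
  then obtain f where f[measurable]: "\<And>q. q \<in> \<rat> \<Longrightarrow> f q \<in> borel_measurable borel"
    and fN: "\<And>q. q \<in> \<rat> \<Longrightarrow> density lborel (f q) = N q"
    by (auto simp: Bex_def) metis
  have ffin: "(\<integral>\<^sup>+x. f q x \<partial>lborel) \<noteq> \<infinity>" if "q \<in> \<rat>" for q
  proof -
    interpret finite_measure "N q" by (rule N_fin[OF that])
    have "emeasure (density lborel (f q)) UNIV \<noteq> \<infinity>"
      using emeasure_finite by (simp add: fN[OF that])
    then show ?thesis using f[OF that] by (simp add: emeasure_density)
  qed
  have f1: "AE t in lborel. f q t \<le> 1" if q: "q \<in> \<rat>" for q
    using f[OF q] ffin[OF q] N_le[OF q]
    by (intro AE_le_if_density_le) (auto simp: fN[OF q] density_1)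
  have f_mono: "AE t in lborel. f q t \<le> f q' t" if q: "q \<in> \<rat>" "q' \<in> \<rat>" "q \<le> q'" for q q'
  proof (rule AE_le_if_density_le)
    fix A :: "real set" assume A: "A \<in> sets lborel"
    have "emeasure (N q) A \<le> emeasure (N q') A"
    proof (rule emeasure_le_if_cells_le_finite[OF sN sN N_fin[OF q(2)]])
      fix n and x :: real
      obtain a b where ab: "a \<le> b" "dyadic_cell n x = {a<..b}" using dyadic_cell_real by blast
      show "emeasure (N q) (dyadic_cell n x) \<le> emeasure (N q') (dyadic_cell n x)"
        using ab mono[OF q p(1) p_mono(1)[OF ab(1)] p(2)]
        by (simp add: N_Ioc[OF q(1)] N_Ioc[OF q(2)] ennreal_leI)
    qed (use A in simp)
    then show "emeasure (density lborel (f q)) A \<le> emeasure (density lborel (f q')) A"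
      by (simp add: fN q)
  qed (use f ffin q in auto)
  define good where "good t \<longleftrightarrow> (\<forall>q\<in>\<rat>. \<forall>q'\<in>\<rat>. q \<le> q' \<longrightarrow> f q t \<le> f q' t)" for t
  have good_AE: "AE t in lborel. good t"
    unfolding good_def using f_mono
    by (intro AE_ball_countable[THEN iffD2] ballI countable_rat) auto
  have [measurable]: "Measurable.pred borel good"
  proof -
    have "{t\<in>space borel. good t} \<in> sets borel"
      unfolding good_def
    proof (intro sets_Collect_rat_Ball)
      fix q q' :: real assume "q \<in> \<rat>" "q' \<in> \<rat>"
      then have [measurable]: "f q \<in> borel_measurable borel" "f q' \<in> borel_measurable borel" by (auto intro: f)
      show "{t\<in>space borel. q \<le> q' \<longrightarrow> f q t \<le> f q' t} \<in> sets borel" by measurable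
    qed
    then show ?thesis by (simp add: pred_def)
  qed
  define h where "h q t = (if good t then enn2real (min 1 (f q t)) else 1)" for q t
  have h1: "h q t \<le> 1" for q t
    using enn2real_mono[of "min 1 (f q t)" 1] by (simp add: h_def)
  show ?thesis
  proof (intro exI[of _ h] conjI ballI allI impI)
    show hm: "h q \<in> borel_measurable borel" if "q \<in> \<rat>" for q
    proof -
      have [measurable]: "f q \<in> borel_measurable borel" by (rule f[OF that])
      show ?thesis unfolding h_def by measurable
    qed
    show h0: "0 \<le> h q t" for q t by (simp add: h_def)
    show "h q t \<le> 1" for q t by (rule h1)
    show "h q t \<le> h q' t" if "q \<in> \<rat>" "q' \<in> \<rat>" "q \<le> q'" for q q' t
    proof (cases "good t")
      case True
      then have "f q t \<le> f q' t" using that by (auto simp: good_def)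
      then have "min 1 (f q t) \<le> min 1 (f q' t)" by (rule min.mono[OF order_refl])
      then show ?thesis by (simp add: h_def enn2real_mono min.strict_coboundedI1)
    qed (simp add: h_def)
    show "(h q has_integral G q t) {0..t}" if q: "q \<in> \<rat>" and t: "t \<in> {0..T}" for q t
    proof -
      have "(\<integral>\<^sup>+s. ennreal (if s \<in> {0..t} then h q s else 0) \<partial>lborel) = (\<integral>\<^sup>+s. f q s * indicator {0..t} s \<partial>lborel)"
      proof (rule nn_integral_cong_AE)
        show "AE s in lborel. ennreal (if s \<in> {0..t} then h q s else 0) = f q s * indicator {0..t} s"
          using good_AE f1[OF q]
        proof eventually_elim
          case (elim s)
          then have "ennreal (enn2real (f q s)) = f q s"
            by (intro ennreal_enn2real) (auto simp: le_less_trans)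
          with elim show ?case by (auto simp: h_def min_absorb2)
        qed
      qed
      also have "\<dots> = emeasure (N q) {0..t}"
        using f[OF q] by (simp add: emeasure_density flip: fN[OF q])
      also have "\<dots> = ennreal (G q t)"
        using t G0[OF q] by (simp add: N_Icc[OF q] p_def)
      finally have "((\<lambda>s. if s \<in> {0..t} then h q s else 0) has_integral G q t) UNIV"
        using hm[OF q] G[OF q, of 0 t] G0[OF q] t h0
        by (intro nn_integral_has_integral) auto
      then show ?thesis by (simp only: has_integral_restrict_UNIV)
    qed
  qed
qed


text \<open>A function with values in [0,1] on the rationals is turned into a distribution function by
  taking infima over the rationals to the right; the result is carried by [0,1], because it is set
  to 0 on the negative numbers and to 1 from 1 on.\<close>

definition right_limit_cdf :: "(real \<Rightarrow> real) \<Rightarrow> real \<Rightarrow> real" where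
  "right_limit_cdf f x = (if x < 0 then 0 else if 1 \<le> x then 1 else (INF q\<in>{q\<in>\<rat>. x < q}. f q))"

context
  fixes f :: "real \<Rightarrow> real"
  assumes f: "\<And>q. 0 \<le> f q" "\<And>q. f q \<le> 1"
begin

lemma rationals_above: "{q\<in>\<rat>. x < q} \<noteq> {}" for x :: real
  using Rats_dense_in_real[of x "x + 1"] by auto

lemma bdd_below_right_limit: "bdd_below (f ` A)"
  using f by (auto intro: bdd_belowI[of _ 0])

lemma right_limit_cdf_bounds: "0 \<le> right_limit_cdf f x" "right_limit_cdf f x \<le> 1"
proof -
  obtain q where "q \<in> {q\<in>\<rat>. x < q}" using rationals_above by blast
  then have "(INF q\<in>{q\<in>\<rat>. x < q}. f q) \<le> 1"
    using f(2) by (intro cINF_lower2 bdd_below_right_limit)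
  then show "right_limit_cdf f x \<le> 1" by (simp add: right_limit_cdf_def)
  show "0 \<le> right_limit_cdf f x"
    unfolding right_limit_cdf_def by (auto intro!: cINF_greatest[OF rationals_above] f)
qed

lemma right_limit_cdf_le: "q \<in> \<rat> \<Longrightarrow> x < q \<Longrightarrow> 0 \<le> x \<Longrightarrow> x < 1 \<Longrightarrow> right_limit_cdf f x \<le> f q"
  unfolding right_limit_cdf_def by (auto intro!: cINF_lower bdd_below_right_limit)

lemma right_limit_cdf_mono: "x \<le> y \<Longrightarrow> right_limit_cdf f x \<le> right_limit_cdf f y"
proof (cases "0 \<le> x \<and> y < 1")
  case True
  assume "x \<le> y"
  have "(INF q\<in>{q\<in>\<rat>. x < q}. f q) \<le> (INF q\<in>{q\<in>\<rat>. y < q}. f q)"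
    by (rule cINF_superset_mono[OF rationals_above bdd_below_right_limit]) (use \<open>x \<le> y\<close> in auto)
  with True \<open>x \<le> y\<close> show ?thesis by (simp add: right_limit_cdf_def)
next
  case False
  assume "x \<le> y"
  with False show ?thesis
    using right_limit_cdf_bounds[of x] right_limit_cdf_bounds[of y]
    by (cases "x < 0") (auto simp: right_limit_cdf_def)
qed

lemma right_limit_cdf_right_cont: "continuous (at_right x) (right_limit_cdf f)"
proof (subst continuous_at_right_real_increasing)
  show "\<And>x y. x \<le> y \<Longrightarrow> right_limit_cdf f x \<le> right_limit_cdf f y" by (rule right_limit_cdf_mono)
  show "\<forall>e>0. \<exists>d>0. right_limit_cdf f (x + d) - right_limit_cdf f x < e"
  proof (intro allI impI)
    fix e :: real assume "e > 0"
    consider "x < 0" | "0 \<le> x" "x < 1" | "1 \<le> x" by linarith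
    then show "\<exists>d>0. right_limit_cdf f (x + d) - right_limit_cdf f x < e"
    proof cases
      case 1
      with \<open>e > 0\<close> show ?thesis by (intro exI[of _ "- x / 2"]) (auto simp: right_limit_cdf_def)
    next
      case 2
      have "(INF q\<in>{q\<in>\<rat>. x < q}. f q) < right_limit_cdf f x + e"
        using 2 \<open>e > 0\<close> by (simp add: right_limit_cdf_def)
      then obtain q where q: "q \<in> \<rat>" "x < q" "f q < right_limit_cdf f x + e"
        by (subst (asm) cINF_less_iff[OF rationals_above bdd_below_right_limit]) auto
      define d where "d = (min q 1 - x) / 2"
      have d: "d > 0" "x + d < q" "x + d < 1" using q 2 by (auto simp: d_def min_def field_simps)
      then have "right_limit_cdf f (x + d) \<le> f q" using 2 q by (intro right_limit_cdf_le) auto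
      then show ?thesis using d q by (intro exI[of _ d]) auto
    next
      case 3
      with \<open>e > 0\<close> show ?thesis by (intro exI[of _ 1]) (auto simp: right_limit_cdf_def)
    qed
  qed
qed

lemma right_limit_cdf_lims:
  "(right_limit_cdf f \<longlongrightarrow> 0) at_bot" "(right_limit_cdf f \<longlongrightarrow> 1) at_top"
proof -
  have "\<forall>\<^sub>F x in at_bot. right_limit_cdf f x = 0"
    unfolding eventually_at_bot_linorder by (intro exI[of _ "-1"]) (auto simp: right_limit_cdf_def)
  then show "(right_limit_cdf f \<longlongrightarrow> 0) at_bot" by (rule tendsto_eventually)
  have "\<forall>\<^sub>F x in at_top. right_limit_cdf f x = 1"
    unfolding eventually_at_top_linorder by (intro exI[of _ 1]) (auto simp: right_limit_cdf_def)
  then show "(right_limit_cdf f \<longlongrightarrow> 1) at_top" by (rule tendsto_eventually)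
qed

lemma real_distribution_right_limit: "real_distribution (interval_measure (right_limit_cdf f))"
  by (intro real_distribution_interval_measure right_limit_cdf_mono right_limit_cdf_right_cont right_limit_cdf_lims)

lemma cdf_right_limit: "cdf (interval_measure (right_limit_cdf f)) = right_limit_cdf f"
  by (intro cdf_interval_measure right_limit_cdf_mono right_limit_cdf_right_cont right_limit_cdf_lims)

end

lemma measurable_right_limit_kernel:
  fixes f :: "real \<Rightarrow> 'a \<Rightarrow> real"
  assumes m: "\<And>q. q \<in> \<rat> \<Longrightarrow> f q \<in> borel_measurable M"
    and f: "\<And>q t. 0 \<le> f q t" "\<And>q t. f q t \<le> 1"
  shows "(\<lambda>t. interval_measure (right_limit_cdf (\<lambda>q. f q t))) \<in> M \<rightarrow>\<^sub>M prob_algebra borel"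
proof (rule measurable_prob_algebra_generated)
  show "sets borel = sigma_sets UNIV (range (\<lambda>a::real. {..a}))"
    by (subst borel_eq_atMost) simp
  show "Int_stable (range (\<lambda>a::real. {..a}))"
    by (auto simp: Int_stable_def)
  fix A assume "A \<in> range (\<lambda>a::real. {..a})"
  then obtain x where A: "A = {..x}" by auto
  have "emeasure (interval_measure (right_limit_cdf (\<lambda>q. f q t))) A = ennreal (right_limit_cdf (\<lambda>q. f q t) x)" for t
  proof -
    interpret real_distribution "interval_measure (right_limit_cdf (\<lambda>q. f q t))"
      by (rule real_distribution_right_limit[OF f])
    show ?thesis
      using fun_cong[OF cdf_right_limit[of "\<lambda>q. f q t", OF f], of x]
      by (simp add: A emeasure_eq_measure cdf_def2)
  qed
  moreover have "(\<lambda>t. right_limit_cdf (\<lambda>q. f q t) x) \<in> borel_measurable M"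
  proof -
    have "countable {q\<in>\<rat>. x < q}" using countable_rat by (rule countable_subset[rotated]) auto
    then have "(\<lambda>t. INF q\<in>{q\<in>\<rat>. x < q}. f q t) \<in> borel_measurable M"
      by (intro borel_measurable_cINF bdd_below_right_limit f m) auto
    then show ?thesis unfolding right_limit_cdf_def by auto
  qed
  ultimately show "(\<lambda>t. emeasure (interval_measure (right_limit_cdf (\<lambda>q. f q t))) A) \<in> borel_measurable M"
    by simp
qed (use real_distribution_right_limit[OF f] in \<open>auto simp: real_distribution_def\<close>)

lemma prob_space_integral_bounded:
  fixes f :: "'a \<Rightarrow> 'b::{banach, second_countable_topology}"
  assumes "prob_space P" "f \<in> borel_measurable P" "\<And>y. y \<in> space P \<Longrightarrow> norm (f y) \<le> B"
  shows "integrable P f" "norm (LINT y|P. f y) \<le> B"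
proof -
  interpret prob_space P by fact
  show i: "integrable P f" by (rule integrable_const_bound[of _ B]) (use assms in auto)
  have "(LINT y|P. norm (f y)) \<le> (LINT y|P. B)"
    using assms i by (intro integral_mono) auto
  then show "norm (LINT y|P. f y) \<le> B"
    by (intro order_trans[OF integral_norm_bound]) (simp add: prob_space)
qed

lemma integral_bind_bounded:
  fixes f :: "'b \<Rightarrow> real"
  assumes M: "prob_space M" and K: "K \<in> M \<rightarrow>\<^sub>M prob_algebra N"
    and f [measurable]: "f \<in> borel_measurable N" and B: "\<And>y. \<bar>f y\<bar> \<le> B"
  shows "(LINT y|bind M K. f y) = (LINT x|M. LINT y|K x. f y)"
proof -
  interpret M: prob_space M by fact
  have MM: "M \<in> space (prob_algebra M)" by (simp add: space_prob_algebra M)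
  have Kp: "prob_space (K x)" and Ks [measurable_cong]: "sets (K x) = sets N" if "x \<in> space M" for x
    using measurable_space[OF K that] by (auto simp: space_prob_algebra)
  interpret bind: prob_space "bind M K" by (rule prob_space_bind'[OF MM K])
  have bs [measurable_cong]: "sets (bind M K) = sets N" by (rule sets_bind'[OF MM K])
  have Ksub [measurable]: "K \<in> M \<rightarrow>\<^sub>M subprob_algebra N" by (rule measurable_prob_algebraD[OF K])
  have int: "integrable P f" "integrable P (\<lambda>y. f y + B)" if "prob_space P" "sets P = sets N" for P
  proof -
    interpret prob_space P by fact
    have [measurable]: "f \<in> borel_measurable P" using f that(2) by (simp cong: measurable_cong_sets)
    show i: "integrable P f" by (rule integrable_const_bound[of _ B]) (use B in auto)
    show "integrable P (\<lambda>y. f y + B)" using i by simp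
  qed
  have pos: "0 \<le> f y + B" for y using B[of y] by linarith
  have inner: "(\<integral>\<^sup>+y. ennreal (f y + B) \<partial>P) = ennreal ((LINT y|P. f y) + B)" "0 \<le> (LINT y|P. f y) + B"
    "\<bar>LINT y|P. f y\<bar> \<le> B"
    if P: "prob_space P" "sets P = sets N" for P
  proof -
    interpret prob_space P by fact
    have e: "(LINT y|P. f y + B) = (LINT y|P. f y) + B"
      using int[OF P] by (simp add: prob_space)
    show "(\<integral>\<^sup>+y. ennreal (f y + B) \<partial>P) = ennreal ((LINT y|P. f y) + B)"
      using int[OF P] pos e by (subst nn_integral_eq_integral) auto
    show "0 \<le> (LINT y|P. f y) + B" unfolding e[symmetric] using pos by (intro integral_nonneg_AE) auto
    have "norm (LINT y|P. f y) \<le> (LINT y|P. B)"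
      using B int[OF P] by (intro order_trans[OF integral_norm_bound] integral_mono) auto
    then show "\<bar>LINT y|P. f y\<bar> \<le> B" by (simp add: prob_space)
  qed
  have g [measurable]: "(\<lambda>x. LINT y|K x. f y) \<in> borel_measurable M"
    using measurable_compose[OF Ksub integral_measurable_subprob_algebra[OF f]] .
  have gi: "integrable M (\<lambda>x. LINT y|K x. f y)"
    by (rule M.integrable_const_bound[of _ B]) (use inner(3)[OF Kp Ks] in auto)
  have "ennreal ((LINT y|bind M K. f y) + B) = (\<integral>\<^sup>+y. ennreal (f y + B) \<partial>bind M K)"
    using inner(1)[OF bind.prob_space_axioms bs] by simp
  also have "\<dots> = (\<integral>\<^sup>+x. (\<integral>\<^sup>+y. ennreal (f y + B) \<partial>K x) \<partial>M)"
    by (rule nn_integral_bind[OF _ Ksub]) measurable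
  also have "\<dots> = (\<integral>\<^sup>+x. ennreal ((LINT y|K x. f y) + B) \<partial>M)"
    by (intro nn_integral_cong inner(1) Kp Ks)
  also have "\<dots> = ennreal (LINT x|M. (LINT y|K x. f y) + B)"
    using gi inner(2)[OF Kp Ks] by (intro nn_integral_eq_integral) auto
  also have "(LINT x|M. (LINT y|K x. f y) + B) = (LINT x|M. LINT y|K x. f y) + B"
    using gi by (simp add: M.prob_space)
  finally have eq: "ennreal ((LINT y|bind M K. f y) + B) = ennreal ((LINT x|M. LINT y|K x. f y) + B)" .
  have "0 \<le> (LINT x|M. (LINT y|K x. f y) + B)"
    by (intro integral_nonneg_AE AE_I2 inner(2) Kp Ks)
  also have "\<dots> = (LINT x|M. LINT y|K x. f y) + B"
    using gi by (simp add: M.prob_space)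
  finally show ?thesis
    using inner(2)[OF bind.prob_space_axioms bs] eq by (simp only: ennreal_inj add_right_cancel)
qed


text \<open>The uniform distribution on [0,t], on the Lebesgue measurable sets.\<close>

definition uniform_time :: "real \<Rightarrow> real measure" where
  "uniform_time t = density (lebesgue_on {0..t}) (\<lambda>_. ennreal (1 / t))"

lemma prob_space_uniform_time: "t > 0 \<Longrightarrow> prob_space (uniform_time t)"
proof (rule prob_spaceI)
  assume t: "t > 0"
  have "emeasure (uniform_time t) (space (uniform_time t)) = ennreal (1 / t) * emeasure (lebesgue_on {0..t}) {0..t}"
    by (simp add: uniform_time_def emeasure_density_const)
  also have "emeasure (lebesgue_on {0..t}) {0..t} = ennreal t"
    using t by (subst emeasure_restrict_space) auto
  finally show "emeasure (uniform_time t) (space (uniform_time t)) = 1"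
    using t by (simp flip: ennreal_mult)
qed

lemma measurable_uniform_time:
  "f \<in> lebesgue_on {0..T} \<rightarrow>\<^sub>M N \<Longrightarrow> t \<le> T \<Longrightarrow> f \<in> uniform_time t \<rightarrow>\<^sub>M N"
proof -
  assume f: "f \<in> lebesgue_on {0..T} \<rightarrow>\<^sub>M N" "t \<le> T"
  have "f \<in> lebesgue_on {0..t} \<rightarrow>\<^sub>M N"
    by (rule measurable_restrict_mono[OF f(1)]) (use f(2) in auto)
  then show ?thesis
    by (simp add: uniform_time_def)
qed

lemma integral_uniform_time:
  fixes h :: "real \<Rightarrow> real"
  assumes h: "h \<in> borel_measurable (lebesgue_on {0..T})" and B: "\<And>s. s \<in> {0..T} \<Longrightarrow> \<bar>h s\<bar> \<le> B"
    and t: "0 < t" "t \<le> T"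
  shows "(LINT s|uniform_time t. h s) = integral {0..t} h / t"
proof -
  have hm: "h \<in> borel_measurable (lebesgue_on {0..t})"
    by (rule measurable_restrict_mono[OF h]) (use t in auto)
  have "integrable (lebesgue_on {0..t}) h"
    using lebesgue_on_bounded_integrable(1)[OF h, of B 0 t] B t
    by (simp add: absolutely_integrable_on_def set_integrable_def integrable_restrict_space)
  then have "(LINT s|lebesgue_on {0..t}. h s) = integral {0..t} h"
    by (rule lebesgue_integral_eq_integral) simp
  then show ?thesis
    unfolding uniform_time_def using hm t by (subst integral_density) auto
qed

lemma sets_eq_real_distribution:
  "prob_space M \<Longrightarrow> sets M = sets borel \<Longrightarrow> real_distribution M"
  by (simp add: real_distribution_def real_distribution_axioms_def)

text \<open>Kernels from [0,T] to probability measures on the unit interval are weakly sequentially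
  compact: Helly's selection argument is applied to the time primitives of the distribution
  functions, and the limit kernel is obtained by differentiating in time.\<close>

theorem real_kernels_weakly_compact:
  fixes \<kappa> :: "nat \<Rightarrow> real \<Rightarrow> real measure"
  assumes T: "T \<ge> 0" and \<kappa>: "\<And>k. \<kappa> k \<in> lebesgue_on {0..T} \<rightarrow>\<^sub>M prob_algebra borel"
    and supp: "\<And>k t. t \<in> {0..T} \<Longrightarrow> AE c in \<kappa> k t. c \<in> {0..1}"
  obtains r \<kappa>' where "strict_mono (r :: nat \<Rightarrow> nat)" "\<kappa>' \<in> lebesgue_on {0..T} \<rightarrow>\<^sub>M prob_algebra borel"
    "\<forall>t\<in>{0..T}. \<forall>(\<beta> :: real \<Rightarrow> real) B. continuous_on UNIV \<beta> \<longrightarrow> (\<forall>c. \<bar>\<beta> c\<bar> \<le> B) \<longrightarrow>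
      (\<lambda>k. integral {0..t} (\<lambda>s. LINT c|\<kappa> (r k) s. \<beta> c)) \<longlonglongrightarrow> integral {0..t} (\<lambda>s. LINT c|\<kappa>' s. \<beta> c)"
proof -
  have \<kappa>P: "prob_space (\<kappa> k t)" "sets (\<kappa> k t) = sets borel" if "t \<in> {0..T}" for k t
    using measurable_space[OF \<kappa>, of t k] that by (auto simp: space_prob_algebra)
  define F where "F k q t = measure (\<kappa> k t) {..q}" for k q t
  have F_meas: "F k q \<in> borel_measurable (lebesgue_on {0..T})" for k q
    unfolding F_def by (rule measurable_compose[OF \<kappa> measurable_measure_prob_algebra]) auto
  have F01: "0 \<le> F k q t \<and> F k q t \<le> 1" if "t \<in> {0..T}" for k q t
    unfolding F_def using prob_space.prob_le_1[OF \<kappa>P(1)[OF that]] by auto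
  have F_mono: "F k q t \<le> F k q' t" if "t \<in> {0..T}" "q \<le> q'" for k q q' t
    unfolding F_def using \<kappa>P[OF that(1), of k] that(2)
    by (intro finite_measure.finite_measure_mono prob_space.finite_measure) auto
  have F_neg: "F k q t = 0" if "t \<in> {0..T}" "q < 0" for k q t
  proof -
    have "AE c in \<kappa> k t. c \<notin> {..q}" using supp[OF that(1), of k] by eventually_elim (use that(2) in auto)
    then show ?thesis unfolding F_def
      using \<kappa>P[OF that(1), of k] by (simp add: measure_eq_0_null_sets AE_iff_null_sets)
  qed
  have F_one: "F k q t = 1" if "t \<in> {0..T}" "q \<ge> 1" for k q t
  proof -
    have "AE c in \<kappa> k t. c \<in> {..q}" using supp[OF that(1), of k] by eventually_elim (use that(2) in auto)
    then show ?thesis unfolding F_def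
      using \<kappa>P[OF that(1), of k] by (subst prob_space.prob_eq_1) auto
  qed
  have F_int: "F k q integrable_on {a..b}" if "{a..b} \<subseteq> {0..T}" for k q a b
    using F01 by (intro lebesgue_on_bounded_integrable(2)[OF F_meas _ that, of k q 1]) auto
  obtain r H where r: "strict_mono r"
    and H: "\<And>q t. q \<in> \<rat> \<Longrightarrow> t \<in> {0..T} \<Longrightarrow> (\<lambda>k. integral {0..t} (F (r k) q)) \<longlonglongrightarrow> H q t"
    by (rule subsequence_of_convergent_primitives[of T F, OF T F_meas F01]) (assumption, erule that, simp)
  have incr: "(\<lambda>k. integral {s..t} (F (r k) q)) \<longlonglongrightarrow> H q t - H q s" if "q \<in> \<rat>" "0 \<le> s" "s \<le> t" "t \<le> T" for q s t
  proof -
    have "integral {s..t} (F (r k) q) = integral {0..t} (F (r k) q) - integral {0..s} (F (r k) q)" for k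
      using Henstock_Kurzweil_Integration.integral_combine[of 0 s t "F (r k) q"] F_int[of 0 t] that by auto
    then show ?thesis using tendsto_diff[OF H H, of q t q s] that by auto
  qed
  have H0: "H q 0 = 0" if "q \<in> \<rat>" for q
    using LIMSEQ_unique[OF H[OF that, of 0]] T by auto
  have H_lip: "0 \<le> H q t - H q s \<and> H q t - H q s \<le> t - s" if "q \<in> \<rat>" "0 \<le> s" "s \<le> t" "t \<le> T" for q s t
  proof
    show "0 \<le> H q t - H q s"
      using that F01 by (intro LIMSEQ_le_const[OF incr[OF that]] exI[of _ 0] allI impI
        Henstock_Kurzweil_Integration.integral_nonneg F_int) auto
    have "norm (integral {s..t} (F (r k) q)) \<le> 1 * (t - s)" for k
      using that F01[of _ "r k" q] by (intro norm_integral_le_const F_int) auto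
    then have "integral {s..t} (F (r k) q) \<le> t - s" for k using abs_le_D1[of _ "t - s"] by auto
    then show "H q t - H q s \<le> t - s" by (intro LIMSEQ_le_const2[OF incr[OF that]]) auto
  qed
  have H_mono: "H q t - H q s \<le> H q' t - H q' s"
    if "q \<in> \<rat>" "q' \<in> \<rat>" "q \<le> q'" "0 \<le> s" "s \<le> t" "t \<le> T" for q q' s t
    using that F_mono
    by (intro LIMSEQ_le[OF incr incr] exI[of _ 0] allI impI integral_le F_int) auto
  have "\<exists>f :: real \<Rightarrow> real \<Rightarrow> real.
    (\<forall>q\<in>\<rat>. f q \<in> borel_measurable borel) \<and> (\<forall>q t. 0 \<le> f q t) \<and> (\<forall>q t. f q t \<le> 1) \<and>
    (\<forall>q\<in>\<rat>. \<forall>q'\<in>\<rat>. \<forall>t. q \<le> q' \<longrightarrow> f q t \<le> f q' t) \<and>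
    (\<forall>q\<in>\<rat>. \<forall>t\<in>{0..T}. (f q has_integral H q t) {0..t})"
    by (rule monotone_densities[OF T H0 H_lip H_mono])
  then obtain f :: "real \<Rightarrow> real \<Rightarrow> real" where
      f_all: "\<forall>q\<in>\<rat>. f q \<in> borel_measurable borel" "\<forall>q t. 0 \<le> f q t" "\<forall>q t. f q t \<le> 1"
        "\<forall>q\<in>\<rat>. \<forall>q'\<in>\<rat>. \<forall>t. q \<le> q' \<longrightarrow> f q t \<le> f q' t"
        "\<forall>q\<in>\<rat>. \<forall>t\<in>{0..T}. (f q has_integral H q t) {0..t}"
    by (elim exE conjE)
  have f_meas: "f q \<in> borel_measurable borel" if "q \<in> \<rat>" for q using f_all(1) that by blast
  have f: "0 \<le> f q t" "f q t \<le> 1" for q t using f_all(2,3) by blast+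
  have f_mono: "f q t \<le> f q' t" if "q \<in> \<rat>" "q' \<in> \<rat>" "q \<le> q'" for q q' t using f_all(4) that by blast
  have f_int: "(f q has_integral H q t) {0..t}" if "q \<in> \<rat>" "t \<in> {0..T}" for q t using f_all(5) that by blast
  define \<kappa>' where "\<kappa>' t = interval_measure (right_limit_cdf (\<lambda>q. f q t))" for t
  have \<kappa>'_borel: "\<kappa>' \<in> borel \<rightarrow>\<^sub>M prob_algebra borel"
    unfolding \<kappa>'_def by (rule measurable_right_limit_kernel[OF f_meas f])
  have \<kappa>': "\<kappa>' \<in> lebesgue_on {0..T} \<rightarrow>\<^sub>M prob_algebra borel"
    using \<kappa>'_borel by (intro measurable_restrict_space1 measurable_completion) simp
  interpret \<kappa>': real_distribution "\<kappa>' t" for t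
    unfolding \<kappa>'_def by (rule real_distribution_right_limit[OF f])
  define F' where "F' x t = measure (\<kappa>' t) {..x}" for x t
  have F'_eq: "F' x t = right_limit_cdf (\<lambda>q. f q t) x" for x t
    using fun_cong[OF cdf_right_limit[of "\<lambda>q. f q t", OF f], of x]
    by (simp add: F'_def \<kappa>'_def cdf_def)
  have F'_meas: "F' x \<in> borel_measurable (lebesgue_on {0..T})" for x
    unfolding F'_def by (rule measurable_compose[OF \<kappa>' measurable_measure_prob_algebra]) auto
  have F'01: "0 \<le> F' x t \<and> F' x t \<le> 1" for x t unfolding F'_def by (simp add: \<kappa>'.prob_le_1)
  have F'_int: "F' x integrable_on {0..t}" if "t \<in> {0..T}" for x t
    using F'01 that by (intro lebesgue_on_bounded_integrable(2)[OF F'_meas, of x 1]) auto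
  \<comment> \<open>The primitives of the limit distribution functions are squeezed between the limits of
      the primitives at neighbouring rationals; at a rational itself they may differ.\<close>
  have upper: "integral {0..t} (F' x) \<le> H q t" if q: "q \<in> \<rat>" "x < q" and t: "t \<in> {0..T}" for q x t
  proof -
    consider "x < 0" | "0 \<le> x" "x < 1" | "1 \<le> x" by linarith
    then show ?thesis
    proof cases
      case 1
      then have "F' x = (\<lambda>_. 0)" by (auto simp: F'_eq right_limit_cdf_def)
      then show ?thesis using H_lip[OF q(1), of 0 t] H0[OF q(1)] t by simp
    next
      case 2
      then have "F' x s \<le> f q s" for s
        unfolding F'_eq by (intro right_limit_cdf_le[of "\<lambda>q. f q s" q x] f q)
      then show ?thesis
        using f_int[OF q(1) t] F'_int[OF t, of x] has_integral_le[OF integrable_integral] by blast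
    next
      case 3
      then have "F' x = (\<lambda>_. 1)" by (auto simp: F'_eq right_limit_cdf_def)
      moreover have "integral {0..t} (F (r k) q) = integral {0..t} (\<lambda>_. 1)" for k
        using 3 q t by (intro integral_cong F_one) auto
      then have "H q t = integral {0..t} (\<lambda>_. 1)"
        using H[OF q(1) t] by (simp add: LIMSEQ_const_iff)
      ultimately show ?thesis by simp
    qed
  qed
  have lower: "H q t \<le> integral {0..t} (F' x)" if q: "q \<in> \<rat>" "q \<le> x" and t: "t \<in> {0..T}" for q x t
  proof -
    consider "x < 0" | "0 \<le> x" "x < 1" | "1 \<le> x" by linarith
    then show ?thesis
    proof cases
      case 1
      have "integral {0..t} (F (r k) q) = integral {0..t} (\<lambda>_. 0)" for k
        using 1 q t by (intro integral_cong F_neg) auto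
      then have "H q t = 0"
        using H[OF q(1) t] by (simp add: LIMSEQ_const_iff)
      then show ?thesis
        using F'01 by (simp add: Henstock_Kurzweil_Integration.integral_nonneg F'_int[OF t])
    next
      case 2
      then have "f q s \<le> F' x s" for s
        unfolding F'_eq right_limit_cdf_def
        using q f_mono by (auto intro!: cINF_greatest[OF rationals_above[of "\<lambda>q. f q s", OF f]])
      then show ?thesis
        using f_int[OF q(1) t] F'_int[OF t, of x] has_integral_le[OF _ integrable_integral] by blast
    next
      case 3
      then have "F' x = (\<lambda>_. 1)" by (auto simp: F'_eq right_limit_cdf_def)
      then show ?thesis using H_lip[OF q(1), of 0 t] H0[OF q(1)] t by simp
    qed
  qed
  have "(\<lambda>k. integral {0..t} (\<lambda>s. LINT c|\<kappa> (r k) s. \<beta> c)) \<longlonglongrightarrow> integral {0..t} (\<lambda>s. LINT c|\<kappa>' s. \<beta> c)"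
    if t: "t \<in> {0..T}" and \<beta>: "continuous_on UNIV \<beta>" "\<forall>c. \<bar>\<beta> c\<bar> \<le> B" for t B and \<beta> :: "real \<Rightarrow> real"
    proof (cases "t = 0")
      case False
      then have t0: "0 < t" "t \<le> T" using t by auto
      \<comment> \<open>The time average over [0,t] of a kernel is a distribution on the line.\<close>
      define avg where "avg K = bind (uniform_time t) K" for K :: "real \<Rightarrow> real measure"
      have avg: "real_distribution (avg K)"
          "\<And>h C. h \<in> borel_measurable borel \<Longrightarrow> (\<And>c. \<bar>h c\<bar> \<le> C) \<Longrightarrow>
            (LINT c|avg K. h c) = integral {0..t} (\<lambda>s. LINT c|K s. h c) / t"
        if K: "K \<in> lebesgue_on {0..T} \<rightarrow>\<^sub>M prob_algebra borel" for K
      proof -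
        have Ku: "K \<in> uniform_time t \<rightarrow>\<^sub>M prob_algebra borel"
          by (rule measurable_uniform_time[OF K t0(2)])
        have U: "uniform_time t \<in> space (prob_algebra (uniform_time t))"
          using prob_space_uniform_time[OF t0(1)] by (simp add: space_prob_algebra)
        show "real_distribution (avg K)"
          unfolding avg_def
          by (intro sets_eq_real_distribution prob_space_bind'[OF U Ku] sets_bind'[OF U Ku])
        fix h :: "real \<Rightarrow> real" and C
        assume h: "h \<in> borel_measurable borel" "\<And>c. \<bar>h c\<bar> \<le> C"
        have "(\<lambda>s. LINT c|K s. h c) \<in> borel_measurable (lebesgue_on {0..T})"
          using measurable_compose[OF measurable_prob_algebraD[OF K] integral_measurable_subprob_algebra[OF h(1)]] .
        moreover have "\<bar>LINT c|K s. h c\<bar> \<le> C" if "s \<in> {0..T}" for s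
        proof -
          have "prob_space (K s)" "sets (K s) = sets borel"
            using measurable_space[OF K, of s] that by (auto simp: space_prob_algebra)
          then show ?thesis
            using prob_space_integral_bounded(2)[of "K s" h C] h by (simp cong: measurable_cong_sets)
        qed
        ultimately have "(LINT s|uniform_time t. LINT c|K s. h c) = integral {0..t} (\<lambda>s. LINT c|K s. h c) / t"
          by (intro integral_uniform_time[OF _ _ t0])
        then show "(LINT c|avg K. h c) = integral {0..t} (\<lambda>s. LINT c|K s. h c) / t"
          unfolding avg_def
          by (subst integral_bind_bounded[OF prob_space_uniform_time[OF t0(1)] Ku h])
      qed
      have avg_cdf: "cdf (avg K) x = integral {0..t} (\<lambda>s. measure (K s) {..x}) / t"
        if K: "K \<in> lebesgue_on {0..T} \<rightarrow>\<^sub>M prob_algebra borel" for K x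
      proof -
        interpret real_distribution "avg K" by (rule avg(1)[OF K])
        have "cdf (avg K) x = (LINT c|avg K. indicator {..x} c)" by (simp add: cdf_def2)
        also have "\<dots> = integral {0..t} (\<lambda>s. LINT c|K s. indicator {..x} c) / t"
          by (rule avg(2)[OF K, of _ 1]) (auto simp: indicator_def)
        also have "integral {0..t} (\<lambda>s. LINT c|K s. indicator {..x} c) = integral {0..t} (\<lambda>s. measure (K s) {..x})"
        proof (rule integral_cong)
          fix s assume "s \<in> {0..t}"
          then have "sets (K s) = sets borel" "space (K s) = UNIV"
            using measurable_space[OF K, of s] t sets_eq_imp_space_eq[of "K s" borel] by (auto simp: space_prob_algebra)
          then show "(LINT c|K s. indicator {..x} c) = measure (K s) {..x}" by simp
        qed
        finally show ?thesis .
      qed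
      have conv: "weak_conv_m (\<lambda>k. avg (\<kappa> (r k))) (avg \<kappa>')"
        unfolding weak_conv_m_def weak_conv_def
      proof (intro allI impI)
        fix x assume cont: "isCont (cdf (avg \<kappa>')) x"
        have C: "cdf (avg (\<kappa> (r k))) y = integral {0..t} (F (r k) y) / t" "cdf (avg \<kappa>') y = integral {0..t} (F' y) / t" for k y
          using avg_cdf[OF \<kappa>] avg_cdf[OF \<kappa>'] by (simp_all add: F_def[abs_def] F'_def[abs_def])
        have Hq: "(\<lambda>k. integral {0..t} (F (r k) q) / t) \<longlonglongrightarrow> H q t / t" if "q \<in> \<rat>" for q
          by (rule tendsto_divide[OF H[OF that t] tendsto_const]) (use t0 in simp)
        interpret A: real_distribution "avg (\<kappa> (r k))" for k by (rule avg(1)[OF \<kappa>])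
        interpret A': real_distribution "avg \<kappa>'" by (rule avg(1)[OF \<kappa>'])
        show "(\<lambda>k. cdf (avg (\<kappa> (r k))) x) \<longlonglongrightarrow> cdf (avg \<kappa>') x"
        proof (rule order_tendstoI)
          fix c assume c: "c < cdf (avg \<kappa>') x"
          then have "\<forall>\<^sub>F y in at x. c < cdf (avg \<kappa>') y"
            using cont by (intro order_tendstoD(1)) (auto simp: isCont_def)
          then obtain d where d: "d > 0" "\<And>y. y \<noteq> x \<Longrightarrow> dist y x < d \<Longrightarrow> c < cdf (avg \<kappa>') y"
            by (auto simp: eventually_at)
          obtain q where q: "q \<in> \<rat>" "x - d / 2 < q" "q < x"
            using Rats_dense_in_real[of "x - d / 2" x] d by auto
          have "c < cdf (avg \<kappa>') (x - d / 2)" using d by (intro d(2)) (auto simp: dist_real_def)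
          also have "\<dots> \<le> H q t / t"
            using upper[OF q(1,2) t] t0 by (simp add: C divide_right_mono)
          finally have "\<forall>\<^sub>F k in sequentially. c < cdf (avg (\<kappa> (r k))) q"
            unfolding C by (rule order_tendstoD(1)[OF Hq[OF q(1)]])
          then show "\<forall>\<^sub>F k in sequentially. c < cdf (avg (\<kappa> (r k))) x"
            by eventually_elim (use A.cdf_nondecreasing[of q x] q in \<open>auto intro: less_le_trans\<close>)
        next
          fix c assume c: "cdf (avg \<kappa>') x < c"
          then have "\<forall>\<^sub>F y in at x. cdf (avg \<kappa>') y < c"
            using cont by (intro order_tendstoD(2)) (auto simp: isCont_def)
          then obtain d where d: "d > 0" "\<And>y. y \<noteq> x \<Longrightarrow> dist y x < d \<Longrightarrow> cdf (avg \<kappa>') y < c"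
            by (auto simp: eventually_at)
          obtain q where q: "q \<in> \<rat>" "x < q" "q < x + d"
            using Rats_dense_in_real[of x "x + d"] d by auto
          have "H q t / t \<le> cdf (avg \<kappa>') q"
            using lower[OF q(1) order_refl t] t0 by (simp add: C divide_right_mono)
          also have "\<dots> < c" using q by (intro d(2)) (auto simp: dist_real_def)
          finally have "\<forall>\<^sub>F k in sequentially. cdf (avg (\<kappa> (r k))) q < c"
            unfolding C by (rule order_tendstoD(2)[OF Hq[OF q(1)]])
          then show "\<forall>\<^sub>F k in sequentially. cdf (avg (\<kappa> (r k))) x < c"
            by eventually_elim (use A.cdf_nondecreasing[of x q] q in \<open>auto intro: le_less_trans\<close>)
        qed
      qed
      have "(\<lambda>k. LINT c|avg (\<kappa> (r k)). \<beta> c) \<longlonglongrightarrow> (LINT c|avg \<kappa>'. \<beta> c)"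
        using \<beta> by (intro weak_conv_imp_integral_bdd_continuous_conv[OF avg(1)[OF \<kappa>] avg(1)[OF \<kappa>'] conv, of _ B])
          (auto simp: continuous_on_eq_continuous_at)
      moreover have "\<beta> \<in> borel_measurable borel" by (rule borel_measurable_continuous_onI[OF \<beta>(1)])
      ultimately have "(\<lambda>k. integral {0..t} (\<lambda>s. LINT c|\<kappa> (r k) s. \<beta> c) / t) \<longlonglongrightarrow> integral {0..t} (\<lambda>s. LINT c|\<kappa>' s. \<beta> c) / t"
        using avg(2)[OF \<kappa>, of \<beta> B] avg(2)[OF \<kappa>', of \<beta> B] \<beta>(2) by simp
      from tendsto_mult[OF this tendsto_const[of t]] show ?thesis using t0 by simp
    qed simp
  then show ?thesis by (intro that[OF r \<kappa>']) blast
qed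

section \<open>Relaxed controls as measurable kernels\<close>

lemma complete_measure_lebesgue_on:
  assumes "S \<in> sets lebesgue"
  shows "complete_measure (lebesgue_on S)"
proof
  fix A B assume BA: "B \<subseteq> A" and A: "A \<in> null_sets (lebesgue_on S)"
  then have A': "A \<subseteq> S" "A \<in> null_sets lebesgue"
    using null_sets_restrict_space[OF assms] by auto
  then have "B \<in> null_sets lebesgue"
    by (intro completion.complete2[OF BA])
  then show "B \<in> sets (lebesgue_on S)"
    using BA A'(1) assms by (auto simp: sets_restrict_space_iff)
qed

lemma (in complete_measure) borel_measurable_AE_eq:
  fixes f g :: "'a \<Rightarrow> 'b::topological_space"
  assumes f: "f \<in> borel_measurable M" and eq: "AE x in M. f x = g x"
  shows "g \<in> borel_measurable M"
proof (rule measurableI)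
  fix A :: "'b set" assume A: "A \<in> sets borel"
  show "g -` A \<inter> space M \<in> sets M"
  proof (rule in_sets_AE)
    show "AE x in M. (x \<in> f -` A \<inter> space M) = (x \<in> g -` A \<inter> space M)"
      using eq by eventually_elim auto
    show "f -` A \<inter> space M \<in> sets M" using f A by (rule measurable_sets)
  qed auto
qed simp

lemma sets_restrict_closed:
  assumes "S \<in> sets (borel :: 'a::topological_space measure)"
  shows "sets (restrict_space (borel :: 'a measure) S) = sigma_sets S ((\<inter>) S ` Collect closed)"
proof -
  have b: "sets (borel :: 'a measure) = sigma_sets UNIV (Collect closed)"
    by (subst borel_eq_closed) simp
  show ?thesis
    using sigma_sets_Int[of S UNIV "Collect closed"] assms
    by (simp add: sets_restrict_space b)
qed

text \<open>On a compact set regularity is automatic, so every kernel is a relaxed control.\<close>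

lemma prob_measure_on_compact_is_rpm:
  fixes \<Delta> :: "'a::euclidean_space set"
  assumes \<Delta>: "compact \<Delta>" and \<mu>: "\<mu> \<in> space (prob_algebra (restrict_space borel \<Delta>))"
  shows "\<mu> \<in> rpm \<Delta>"
proof -
  have s [measurable_cong]: "sets \<mu> = sets (restrict_space borel \<Delta>)" and p: "prob_space \<mu>"
    using \<mu> by (auto simp: space_prob_algebra)
  interpret prob_space \<mu> by fact
  have \<Delta>b [measurable]: "\<Delta> \<in> sets borel" using \<Delta> by (simp add: borel_compact)
  have sp: "space \<mu> = \<Delta>" using sets_eq_imp_space_eq[OF s] by (simp add: space_restrict_space)
  have id: "(\<lambda>v. v) \<in> \<mu> \<rightarrow>\<^sub>M borel" by (simp add: s measurable_restrict_space1 cong: measurable_cong_sets)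
  define N where "N = distr \<mu> borel (\<lambda>v. v)"
  have sN: "sets N = sets borel" by (simp add: N_def)
  have N: "emeasure N A = emeasure \<mu> (A \<inter> \<Delta>)" if "A \<in> sets borel" for A
    unfolding N_def using that id by (subst emeasure_distr) (auto simp: sp)
  have fin: "emeasure N (space N) \<noteq> \<infinity>" using N[of UNIV] by (simp add: N_def)
  have A_iff: "A \<in> sets \<mu> \<longleftrightarrow> A \<in> sets borel \<and> A \<subseteq> \<Delta>" for A
    by (auto simp: s sets_restrict_space_iff)
  have "emeasure \<mu> A = (SUP K\<in>{K. K \<subseteq> A \<and> compact K}. emeasure \<mu> K)" (is ?inner)
    and "emeasure \<mu> A = (INF U\<in>{U. A \<subseteq> U \<and> openin (top_of_set \<Delta>) U}. emeasure \<mu> U)" (is ?outer)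
    if A: "A \<in> sets \<mu>" for A
  proof -
    have Ab: "A \<in> sets borel" "A \<subseteq> \<Delta>" using A A_iff by auto
    have NA: "emeasure N A = emeasure \<mu> A" using N[OF Ab(1)] Ab(2) by (simp add: Int_absorb2)
    have "emeasure N A = (SUP K\<in>{K. K \<subseteq> A \<and> compact K}. emeasure N K)"
      by (rule inner_regular[OF sN fin Ab(1)])
    also have "\<dots> = (SUP K\<in>{K. K \<subseteq> A \<and> compact K}. emeasure \<mu> K)"
    proof (rule SUP_cong[OF refl])
      fix K assume "K \<in> {K. K \<subseteq> A \<and> compact K}"
      then have "K \<inter> \<Delta> = K" "compact K" using Ab(2) by auto
      then show "emeasure N K = emeasure \<mu> K" using N[of K] by (simp add: borel_compact)
    qed
    finally show ?inner by (simp add: NA)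
    have "emeasure N A = (INF U\<in>{U. A \<subseteq> U \<and> open U}. emeasure N U)"
      by (rule outer_regular[OF sN fin Ab(1)])
    also have "\<dots> = (INF U\<in>{U. A \<subseteq> U \<and> openin (top_of_set \<Delta>) U}. emeasure \<mu> U)"
    proof (rule INF_eq)
      fix U assume "U \<in> {U. A \<subseteq> U \<and> open U}"
      then show "\<exists>V\<in>{U. A \<subseteq> U \<and> openin (top_of_set \<Delta>) U}. emeasure \<mu> V \<le> emeasure N U"
        using Ab(2) N[of U] by (intro bexI[of _ "U \<inter> \<Delta>"]) (auto simp: openin_open)
    next
      fix V assume V: "V \<in> {U. A \<subseteq> U \<and> openin (top_of_set \<Delta>) U}"
      then obtain U where "open U" "V = \<Delta> \<inter> U" by (auto simp: openin_open)
      then show "\<exists>U\<in>{U. A \<subseteq> U \<and> open U}. emeasure N U \<le> emeasure \<mu> V"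
        using V N[of U] by (intro bexI[of _ U]) (auto simp: Int_commute)
    qed
    finally show ?outer by (simp add: NA)
  qed
  then show ?thesis using s p by (simp add: rpm_def)
qed

text \<open>Kernels that are defined and measurable for every time in [0,T]. They represent the relaxed
  controls up to changes on null sets of times.\<close>

abbreviation control_kernels :: "'a::euclidean_space set \<Rightarrow> real \<Rightarrow> (real \<Rightarrow> 'a measure) set" where
  "control_kernels \<Delta> T \<equiv> lebesgue_on {0..T} \<rightarrow>\<^sub>M prob_algebra (restrict_space borel \<Delta>)"

lemma control_kernel_is_relaxed_control:
  fixes \<Delta> :: "'a::euclidean_space set"
  assumes \<Delta>: "compact \<Delta>" and \<kappa>: "\<kappa> \<in> control_kernels \<Delta> T"
  shows "\<kappa> \<in> relaxed_controls \<Delta> T"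
proof -
  have "(\<lambda>t. LINT v|\<kappa> t. \<alpha> v) \<in> borel_measurable (lebesgue_on {0..T})" if "continuous_on \<Delta> \<alpha>" for \<alpha> :: "'a \<Rightarrow> real"
    by (rule measurable_compose[OF measurable_prob_algebraD[OF \<kappa>] integral_measurable_subprob_algebra])
      (rule borel_measurable_continuous_on_restrict[OF that])
  moreover have "\<kappa> t \<in> rpm \<Delta>" if "t \<in> {0..T}" for t
    using measurable_space[OF \<kappa>, of t] that by (intro prob_measure_on_compact_is_rpm \<Delta>) auto
  ultimately show ?thesis by (auto simp: relaxed_controls_def intro!: AE_I2)
qed

lemma measure_closed_as_limit:
  fixes K :: "'a::euclidean_space set"
  assumes K: "closed K" "K \<noteq> {}" and \<mu>: "\<mu> \<in> space (prob_algebra (restrict_space borel \<Delta>))"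
    and \<Delta>: "\<Delta> \<in> sets borel"
  shows "(\<lambda>n. LINT v|\<mu>. max 0 (1 - real n * infdist v K)) \<longlonglongrightarrow> measure \<mu> (\<Delta> \<inter> K)"
proof -
  have s: "sets \<mu> = sets (restrict_space borel \<Delta>)" and p: "prob_space \<mu>"
    using \<mu> by (auto simp: space_prob_algebra)
  interpret prob_space \<mu> by fact
  have sp: "space \<mu> = \<Delta>" using sets_eq_imp_space_eq[OF s] by (simp add: space_restrict_space)
  have KS: "\<Delta> \<inter> K \<in> sets \<mu>" using K \<Delta> by (auto simp: s sets_restrict_space_iff)
  have "(\<lambda>n. LINT v|\<mu>. max 0 (1 - real n * infdist v K)) \<longlonglongrightarrow> (LINT v|\<mu>. indicator (\<Delta> \<inter> K) v)"
  proof (rule integral_dominated_convergence[where w="\<lambda>_. 1"])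
    show "(\<lambda>v. max 0 (1 - real n * infdist v K)) \<in> borel_measurable \<mu>" for n
      unfolding measurable_cong_sets[OF s refl]
      by (intro borel_measurable_continuous_on_restrict continuous_intros)
    show "AE v in \<mu>. (\<lambda>n. max 0 (1 - real n * infdist v K)) \<longlonglongrightarrow> indicator (\<Delta> \<inter> K) v"
    proof (rule AE_I2)
      fix v assume v: "v \<in> space \<mu>"
      show "(\<lambda>n. max 0 (1 - real n * infdist v K)) \<longlonglongrightarrow> indicator (\<Delta> \<inter> K) v"
      proof (cases "v \<in> K")
        case True
        with v show ?thesis by (simp add: sp)
      next
        case False
        then have d: "infdist v K > 0"
          using in_closed_iff_infdist_zero[OF K, of v] infdist_nonneg[of v K] by linarith
        obtain m :: nat where m: "1 / infdist v K < m" using reals_Archimedean2 by blast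
        have "max 0 (1 - real n * infdist v K) = 0" if "n \<ge> m" for n
        proof -
          have "1 / infdist v K \<le> n" using m that by linarith
          then show ?thesis using d by (simp add: field_simps)
        qed
        then show ?thesis using False by (intro tendsto_eventually) (auto simp: eventually_sequentially)
      qed
    qed
    show "AE v in \<mu>. norm (max 0 (1 - real n * infdist v K)) \<le> 1" for n
      using infdist_nonneg[of _ K] by (intro AE_I2) (auto simp: zero_le_mult_iff)
  qed (use KS in auto)
  moreover have "\<Delta> \<inter> K \<inter> space \<mu> = \<Delta> \<inter> K" by (auto simp: sp)
  ultimately show ?thesis by simp
qed

text \<open>Conversely, a relaxed control becomes a kernel when it is replaced by a point mass on the null
  set of times where its value is not a probability measure. Measurability passes from integrals of
  continuous functions to measures of closed sets, which generate the Borel sets.\<close>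

lemma relaxed_control_kernel_version:
  fixes \<Delta> :: "'a::euclidean_space set"
  assumes \<Delta>: "compact \<Delta>" "\<Delta> \<noteq> {}" and u: "u \<in> relaxed_controls \<Delta> T"
  obtains \<kappa> where "\<kappa> \<in> control_kernels \<Delta> T" "AE t in lebesgue_on {0..T}. u t = \<kappa> t"
proof -
  interpret complete_measure "lebesgue_on {0..T}" by (rule complete_measure_lebesgue_on) simp
  have \<Delta>b: "\<Delta> \<in> sets borel" using \<Delta> by (simp add: borel_compact)
  obtain v0 where v0: "v0 \<in> \<Delta>" using \<Delta> by auto
  define \<kappa> where "\<kappa> t = (if u t \<in> rpm \<Delta> then u t else return (restrict_space borel \<Delta>) v0)" for t
  have AE: "AE t in lebesgue_on {0..T}. u t = \<kappa> t"
    using u by (auto simp: relaxed_controls_def \<kappa>_def)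
  have \<kappa>P: "\<kappa> t \<in> space (prob_algebra (restrict_space borel \<Delta>))" for t
    using v0 by (auto simp: \<kappa>_def rpm_def space_prob_algebra space_restrict_space intro!: prob_space_return)
  have meas: "(\<lambda>t. LINT v|\<kappa> t. \<alpha> v) \<in> borel_measurable (lebesgue_on {0..T})"
    if "continuous_on \<Delta> \<alpha>" for \<alpha> :: "'a \<Rightarrow> real"
  proof (rule borel_measurable_AE_eq)
    show "(\<lambda>t. LINT v|u t. \<alpha> v) \<in> borel_measurable (lebesgue_on {0..T})"
      using u that by (simp add: relaxed_controls_def)
    show "AE t in lebesgue_on {0..T}. (LINT v|u t. \<alpha> v) = (LINT v|\<kappa> t. \<alpha> v)"
      using AE by eventually_elim simp
  qed
  have "\<kappa> \<in> control_kernels \<Delta> T"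
  proof (rule measurable_prob_algebra_generated[OF sets_restrict_closed[OF \<Delta>b]])
    have "\<Delta> \<inter> K \<inter> (\<Delta> \<inter> L) \<in> (\<inter>) \<Delta> ` Collect closed" if "closed K" "closed L" for K L
      using that by (intro image_eqI[of _ _ "K \<inter> L"]) auto
    then show "Int_stable ((\<inter>) \<Delta> ` Collect closed)"
      by (auto simp: Int_stable_def)
    fix A assume "A \<in> (\<inter>) \<Delta> ` Collect closed"
    then obtain K where K: "closed K" "A = \<Delta> \<inter> K" by auto
    show "(\<lambda>t. emeasure (\<kappa> t) A) \<in> borel_measurable (lebesgue_on {0..T})"
    proof (cases "K = {}")
      case False
      have "(\<lambda>t. measure (\<kappa> t) A) \<in> borel_measurable (lebesgue_on {0..T})"
      proof (rule borel_measurable_LIMSEQ_metric)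
        show "(\<lambda>t. LINT v|\<kappa> t. max 0 (1 - real n * infdist v K)) \<in> borel_measurable (lebesgue_on {0..T})" for n
          by (intro meas continuous_intros)
        show "(\<lambda>n. LINT v|\<kappa> t. max 0 (1 - real n * infdist v K)) \<longlonglongrightarrow> measure (\<kappa> t) A" for t
          using measure_closed_as_limit[OF K(1) False \<kappa>P \<Delta>b] by (simp add: K)
      qed
      moreover have "emeasure (\<kappa> t) A = ennreal (measure (\<kappa> t) A)" for t
      proof -
        interpret prob_space "\<kappa> t" using \<kappa>P[of t] by (simp add: space_prob_algebra)
        show ?thesis by (rule emeasure_eq_measure)
      qed
      ultimately show ?thesis by simp
    qed (simp add: K)
  qed (use \<kappa>P in \<open>auto simp: space_prob_algebra\<close>)
  then show ?thesis using AE that by blast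
qed

lemma measurable_kernel_integral:
  fixes \<psi> :: "real \<Rightarrow> 'a::euclidean_space \<Rightarrow> 'b::euclidean_space"
  assumes \<kappa>: "\<kappa> \<in> control_kernels \<Delta> T" and \<psi>: "continuous_on ({0..T} \<times> \<Delta>) (\<lambda>(s, v). \<psi> s v)"
  shows "(\<lambda>s. LINT v|\<kappa> s. \<psi> s v) \<in> borel_measurable (lebesgue_on {0..T})"
proof -
  let ?L = "lebesgue_on {0..T}" and ?B = "restrict_space (borel :: 'a measure) \<Delta>"
  have \<kappa>s [measurable]: "\<kappa> \<in> ?L \<rightarrow>\<^sub>M subprob_algebra ?B" by (rule measurable_prob_algebraD[OF \<kappa>])
  have "(\<lambda>p. p) \<in> ?L \<Otimes>\<^sub>M ?B \<rightarrow>\<^sub>M restrict_space borel ({0..T} \<times> \<Delta>)"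
  proof (rule measurable_restrict_space2)
    show "(\<lambda>p. p) \<in> space (?L \<Otimes>\<^sub>M ?B) \<rightarrow> {0..T} \<times> \<Delta>"
      by (auto simp: space_pair_measure space_restrict_space)
    have "(\<lambda>p. (fst p, snd p)) \<in> ?L \<Otimes>\<^sub>M ?B \<rightarrow>\<^sub>M borel \<Otimes>\<^sub>M borel"
      by (intro measurable_Pair measurable_compose[OF measurable_fst] measurable_compose[OF measurable_snd]
        measurable_restrict_space1) (auto intro: measurable_completion)
    then show "(\<lambda>p. p) \<in> ?L \<Otimes>\<^sub>M ?B \<rightarrow>\<^sub>M borel" by (simp add: borel_prod)
  qed
  then have \<psi>m [measurable]: "(\<lambda>(s, v). \<psi> s v) \<in> borel_measurable (?L \<Otimes>\<^sub>M ?B)"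
    by (rule measurable_compose[OF _ borel_measurable_continuous_on_restrict[OF \<psi>]])
  have "(\<lambda>s. distr (\<kappa> s) (?L \<Otimes>\<^sub>M ?B) (\<lambda>v. (s, v))) \<in> ?L \<rightarrow>\<^sub>M subprob_algebra (?L \<Otimes>\<^sub>M ?B)"
    by (rule measurable_distr2[OF _ \<kappa>s]) simp
  then have "(\<lambda>s. integral\<^sup>L (distr (\<kappa> s) (?L \<Otimes>\<^sub>M ?B) (\<lambda>v. (s, v))) (\<lambda>(s, v). \<psi> s v)) \<in> borel_measurable ?L"
    by (rule measurable_compose[OF _ integral_measurable_subprob_algebra[OF \<psi>m]])
  moreover have "integral\<^sup>L (distr (\<kappa> s) (?L \<Otimes>\<^sub>M ?B) (\<lambda>v. (s, v))) (\<lambda>(s, v). \<psi> s v) = (LINT v|\<kappa> s. \<psi> s v)"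
    if "s \<in> space ?L" for s
  proof -
    have "sets (\<kappa> s) = sets ?B" using subprob_measurableD(2)[OF \<kappa>s that] .
    then have "(\<lambda>v. (s, v)) \<in> \<kappa> s \<rightarrow>\<^sub>M ?L \<Otimes>\<^sub>M ?B"
      using that by (simp cong: measurable_cong_sets)
    then show ?thesis by (subst integral_distr) (auto simp: \<psi>m)
  qed
  ultimately show ?thesis
    by (rule measurable_cong[THEN iffD1, rotated])
qed

lemma integral_Icc_cong_AE:
  fixes f g :: "real \<Rightarrow> 'b::euclidean_space"
  assumes AE: "AE s in lebesgue_on {0..T}. f s = g s" and t: "t \<le> T"
  shows "integral {0..t} f = integral {0..t} g"
proof (rule integral_spike)
  interpret complete_measure "lebesgue_on {0..T}" by (rule complete_measure_lebesgue_on) simp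
  have "{s \<in> space (lebesgue_on {0..T}). \<not> f s = g s} \<in> null_sets (lebesgue_on {0..T})"
    using AE by (simp only: AE_iff_null_sets)
  then show "negligible {s \<in> {0..T}. f s \<noteq> g s}"
    by (simp add: null_sets_restrict_space negligible_iff_null_sets)
qed (use t in auto)

text \<open>Weak convergence of kernels: the time integrals over [0,t] of the integrals of each continuous
  function converge, for every t.\<close>

abbreviation weak_kernel_limit ::
    "'a::euclidean_space set \<Rightarrow> real \<Rightarrow> (nat \<Rightarrow> real \<Rightarrow> 'a measure) \<Rightarrow> (real \<Rightarrow> 'a measure) \<Rightarrow> bool" where
  "weak_kernel_limit \<Delta> T \<kappa> \<kappa>' \<equiv>
     \<forall>t\<in>{0..T}. \<forall>\<alpha> :: 'a \<Rightarrow> real. continuous_on \<Delta> \<alpha> \<longrightarrow>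
       (\<lambda>k. integral {0..t} (\<lambda>s. LINT v|\<kappa> k s. \<alpha> v)) \<longlonglongrightarrow> integral {0..t} (\<lambda>s. LINT v|\<kappa>' s. \<alpha> v)"

theorem control_kernels_weakly_compact:
  fixes \<Delta> :: "(real^'m::finite) set" and \<kappa> :: "nat \<Rightarrow> real \<Rightarrow> (real^'m) measure"
  assumes T: "T \<ge> 0" and \<Delta>: "compact \<Delta>" "\<Delta> \<noteq> {}" and \<kappa>: "\<And>k. \<kappa> k \<in> control_kernels \<Delta> T"
  obtains r \<kappa>' where "strict_mono (r :: nat \<Rightarrow> nat)" "\<kappa>' \<in> control_kernels \<Delta> T"
    "weak_kernel_limit \<Delta> T (\<lambda>k. \<kappa> (r k)) \<kappa>'"
proof -
  let ?B = "restrict_space (borel :: (real^'m) measure) \<Delta>"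
  have \<Delta>c: "closed \<Delta>" and \<Delta>b: "\<Delta> \<in> sets borel" using \<Delta> by (auto simp: compact_imp_closed borel_compact)
  obtain v0 where v0: "v0 \<in> \<Delta>" using \<Delta> by auto
  obtain \<theta> :: "real \<Rightarrow> real^'m" and c where \<theta>: "continuous_on UNIV \<theta>" and c: "c \<in> borel_measurable borel"
    "\<And>v. c v \<in> {0..1}" "\<And>v. v \<in> \<Delta> \<Longrightarrow> \<theta> (c v) = v"
    using bounded_set_continuous_code[OF compact_imp_bounded[OF \<Delta>(1)]] by metis
  have \<theta>m [measurable]: "\<theta> \<in> borel_measurable borel" by (rule borel_measurable_continuous_onI[OF \<theta>])
  have cm: "c \<in> ?B \<rightarrow>\<^sub>M borel" by (rule measurable_restrict_space1[OF c(1)])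
  define \<rho> where "\<rho> k t = distr (\<kappa> k t) borel c" for k t
  have \<rho>: "\<rho> k \<in> lebesgue_on {0..T} \<rightarrow>\<^sub>M prob_algebra borel" for k
    unfolding \<rho>_def by (rule measurable_compose[OF \<kappa> measurable_distr_prob_space[OF cm]])
  have \<kappa>P: "prob_space (\<kappa> k t)" "sets (\<kappa> k t) = sets ?B" "space (\<kappa> k t) = \<Delta>" if "t \<in> {0..T}" for k t
    using measurable_space[OF \<kappa>, of t k] that sets_eq_imp_space_eq[of "\<kappa> k t" ?B]
    by (auto simp: space_prob_algebra space_restrict_space)
  have cm': "c \<in> \<kappa> k t \<rightarrow>\<^sub>M borel" if "t \<in> {0..T}" for k t
    using cm \<kappa>P(2)[OF that] by (simp cong: measurable_cong_sets)
  have supp: "AE x in \<rho> k t. x \<in> {0..1}" if "t \<in> {0..T}" for k t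
    unfolding \<rho>_def by (subst AE_distr_iff[OF cm'[OF that]]) (use c(2) in auto)
  obtain r \<rho>' where r: "strict_mono (r :: nat \<Rightarrow> nat)" and \<rho>': "\<rho>' \<in> lebesgue_on {0..T} \<rightarrow>\<^sub>M prob_algebra borel"
    and conv_all: "\<forall>t\<in>{0..T}. \<forall>(\<beta> :: real \<Rightarrow> real) B. continuous_on UNIV \<beta> \<longrightarrow> (\<forall>c. \<bar>\<beta> c\<bar> \<le> B) \<longrightarrow>
      (\<lambda>k. integral {0..t} (\<lambda>s. LINT c|\<rho> (r k) s. \<beta> c)) \<longlonglongrightarrow> integral {0..t} (\<lambda>s. LINT c|\<rho>' s. \<beta> c)"
    by (rule real_kernels_weakly_compact[of T \<rho>, OF T \<rho> supp]) (assumption, rule that)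
  have conv: "(\<lambda>k. integral {0..t} (\<lambda>s. LINT c|\<rho> (r k) s. \<beta> c)) \<longlonglongrightarrow> integral {0..t} (\<lambda>s. LINT c|\<rho>' s. \<beta> c)"
    if "t \<in> {0..T}" "continuous_on UNIV \<beta>" "\<And>c. \<bar>\<beta> c\<bar> \<le> B" for t B and \<beta> :: "real \<Rightarrow> real"
    using conv_all that by blast
  have \<rho>'P: "prob_space (\<rho>' t)" "sets (\<rho>' t) = sets borel" if "t \<in> {0..T}" for t
    using measurable_space[OF \<rho>', of t] that by (auto simp: space_prob_algebra)
  have \<rho>_int: "(LINT x|\<rho> k s. \<beta> x) = (LINT v|\<kappa> k s. \<beta> (c v))"
    if "s \<in> {0..T}" "continuous_on UNIV \<beta>" for k s and \<beta> :: "real \<Rightarrow> real"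
    unfolding \<rho>_def by (intro integral_distr cm' that borel_measurable_continuous_onI)
  \<comment> \<open>The limit kernel is carried by the codes of points of \<open>\<Delta>\<close>.\<close>
  define \<beta>0 where "\<beta>0 x = min 1 (infdist (\<theta> x) \<Delta>)" for x
  have \<beta>0: "continuous_on UNIV \<beta>0" "\<bar>\<beta>0 x\<bar> \<le> 1" "0 \<le> \<beta>0 x" for x
    unfolding \<beta>0_def using infdist_nonneg[of "\<theta> x" \<Delta>]
    by (auto intro!: continuous_intros \<theta>)
  have meas0: "(\<lambda>s. LINT x|\<rho>' s. \<beta>0 x) \<in> borel_measurable (lebesgue_on {0..T})"
    by (rule measurable_compose[OF measurable_prob_algebraD[OF \<rho>'] integral_measurable_subprob_algebra])
      (rule borel_measurable_continuous_onI[OF \<beta>0(1)])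
  have \<beta>0m: "\<beta>0 \<in> borel_measurable (\<rho>' s)" if "s \<in> {0..T}" for s
    using borel_measurable_continuous_onI[OF \<beta>0(1)] \<rho>'P(2)[OF that] by (simp cong: measurable_cong_sets)
  have bnd0: "\<bar>LINT x|\<rho>' s. \<beta>0 x\<bar> \<le> 1" if "s \<in> {0..T}" for s
    using prob_space_integral_bounded(2)[OF \<rho>'P(1) \<beta>0m, OF that that, of 1] \<beta>0(2) by simp
  have "integral {0..T} (\<lambda>s. LINT x|\<rho> (r k) s. \<beta>0 x) = integral {0..T} (\<lambda>s. 0)" for k
  proof (rule integral_cong)
    fix s assume s: "s \<in> {0..T}"
    have "(LINT x|\<rho> (r k) s. \<beta>0 x) = (LINT v|\<kappa> (r k) s. \<beta>0 (c v))" by (rule \<rho>_int[OF s \<beta>0(1)])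
    also have "\<dots> = (LINT v|\<kappa> (r k) s. 0)"
      using \<kappa>P(3)[OF s] by (intro Bochner_Integration.integral_cong) (auto simp: \<beta>0_def c(3))
    finally show "(LINT x|\<rho> (r k) s. \<beta>0 x) = 0" by simp
  qed
  then have zero: "integral {0..T} (\<lambda>s. LINT x|\<rho>' s. \<beta>0 x) = 0"
    using conv[of T \<beta>0 1] \<beta>0 T by (simp add: LIMSEQ_const_iff)
  have i0: "integrable (lebesgue_on {0..T}) (\<lambda>s. LINT x|\<rho>' s. \<beta>0 x)"
    using lebesgue_on_bounded_integrable(1)[OF meas0, of 1 0 T] bnd0
    by (simp add: absolutely_integrable_on_def set_integrable_def integrable_restrict_space)
  have "(LINT s|lebesgue_on {0..T}. LINT x|\<rho>' s. \<beta>0 x) = 0"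
    using lebesgue_integral_eq_integral[OF i0] zero by simp
  then have "AE s in lebesgue_on {0..T}. (LINT x|\<rho>' s. \<beta>0 x) = 0"
    by (subst (asm) integral_nonneg_eq_0_iff_AE[OF i0]) (use \<beta>0(3) in \<open>auto intro!: integral_nonneg_AE\<close>)
  note zero_AE = this
  have carried_at: "AE x in \<rho>' s. \<theta> x \<in> \<Delta>" if s: "s \<in> {0..T}" and 0: "(LINT x|\<rho>' s. \<beta>0 x) = 0" for s
  proof -
    have "integrable (\<rho>' s) \<beta>0"
      by (rule prob_space_integral_bounded(1)[OF \<rho>'P(1) \<beta>0m, OF s s, of 1]) (use \<beta>0(2) in auto)
    then have "AE x in \<rho>' s. \<beta>0 x = 0"
      using 0 \<beta>0(3) by (subst (asm) integral_nonneg_eq_0_iff_AE) auto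
    then show "AE x in \<rho>' s. \<theta> x \<in> \<Delta>"
      by eventually_elim
        (use in_closed_iff_infdist_zero[OF \<Delta>c \<Delta>(2)] in \<open>auto simp: \<beta>0_def min_def split: if_splits\<close>)
  qed
  have carried: "AE s in lebesgue_on {0..T}. AE x in \<rho>' s. \<theta> x \<in> \<Delta>"
    using zero_AE AE_space by eventually_elim (auto intro: carried_at)
  define \<theta>' where "\<theta>' x = (if \<theta> x \<in> \<Delta> then \<theta> x else v0)" for x
  have \<theta>': "\<theta>' \<in> borel \<rightarrow>\<^sub>M ?B"
  proof (rule measurable_restrict_space2)
    show "\<theta>' \<in> borel_measurable borel"
      unfolding \<theta>'_def using \<Delta>b by measurable
  qed (use v0 in \<open>auto simp: \<theta>'_def\<close>)
  define \<kappa>' where "\<kappa>' t = distr (\<rho>' t) ?B \<theta>'" for t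
  show ?thesis
  proof (rule that[OF r, of \<kappa>'], goal_cases)
    case 1
    show ?case unfolding \<kappa>'_def by (rule measurable_compose[OF \<rho>' measurable_distr_prob_space[OF \<theta>']])
  next
    case 2
    show ?case
    proof (intro ballI allI impI)
      fix t and \<alpha> :: "real^'m \<Rightarrow> real" assume t: "t \<in> {0..T}" and \<alpha>: "continuous_on \<Delta> \<alpha>"
      have "bounded (\<alpha> ` \<Delta>)" using compact_continuous_image[OF \<alpha> \<Delta>(1)] by (rule compact_imp_bounded)
      then obtain B where B: "\<And>v. v \<in> \<Delta> \<Longrightarrow> norm (\<alpha> v) \<le> B" by (auto simp: bounded_iff)
      have "0 \<le> B" using B[OF v0] norm_ge_zero order_trans by blast
      have "closedin (top_of_set UNIV) \<Delta>" using \<Delta>c by simp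
      from Tietze[OF \<alpha> this \<open>0 \<le> B\<close> B]
      have "\<exists>g. continuous_on UNIV g \<and> (\<forall>v\<in>\<Delta>. g v = \<alpha> v) \<and> (\<forall>v. norm (g v) \<le> B)"
        by (metis UNIV_I)
      then obtain g where g: "continuous_on UNIV g" "\<And>v. v \<in> \<Delta> \<Longrightarrow> g v = \<alpha> v" "\<And>v. norm (g v) \<le> B"
        by blast
      define \<beta> where "\<beta> x = g (\<theta> x)" for x
      have \<beta>: "continuous_on UNIV \<beta>" "\<bar>\<beta> x\<bar> \<le> B" for x
        using g(3)[of "\<theta> x"] unfolding \<beta>_def by (auto intro: continuous_on_compose2[OF g(1) \<theta>])
      have left: "integral {0..t} (\<lambda>s. LINT x|\<rho> (r k) s. \<beta> x) = integral {0..t} (\<lambda>s. LINT v|\<kappa> (r k) s. \<alpha> v)" for k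
      proof (rule integral_cong)
        fix s assume "s \<in> {0..t}"
        then have s: "s \<in> {0..T}" using t by auto
        show "(LINT x|\<rho> (r k) s. \<beta> x) = (LINT v|\<kappa> (r k) s. \<alpha> v)"
          unfolding \<rho>_int[OF s \<beta>(1)]
          using \<kappa>P(3)[OF s] by (intro Bochner_Integration.integral_cong) (auto simp: \<beta>_def c(3) g(2))
      qed
      have right: "integral {0..t} (\<lambda>s. LINT x|\<rho>' s. \<beta> x) = integral {0..t} (\<lambda>s. LINT v|\<kappa>' s. \<alpha> v)"
      proof (rule integral_Icc_cong_AE)
        show "t \<le> T" using t by simp
        show "AE s in lebesgue_on {0..T}. (LINT x|\<rho>' s. \<beta> x) = (LINT v|\<kappa>' s. \<alpha> v)"
          using carried AE_space
        proof eventually_elim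
          fix s assume carr: "AE x in \<rho>' s. \<theta> x \<in> \<Delta>" and "s \<in> space (lebesgue_on {0..T})"
          then have s: "s \<in> {0..T}" by simp
          have \<theta>s: "\<theta>' \<in> \<rho>' s \<rightarrow>\<^sub>M ?B" using \<theta>' \<rho>'P(2)[OF s] by (simp cong: measurable_cong_sets)
          have \<alpha>B: "\<alpha> \<in> borel_measurable ?B" by (rule borel_measurable_continuous_on_restrict[OF \<alpha>])
          have "(LINT v|\<kappa>' s. \<alpha> v) = (LINT x|\<rho>' s. \<alpha> (\<theta>' x))"
            unfolding \<kappa>'_def by (rule integral_distr[OF \<theta>s \<alpha>B])
          also have "\<dots> = (LINT x|\<rho>' s. \<beta> x)"
          proof (rule integral_cong_AE)
            show "(\<lambda>x. \<alpha> (\<theta>' x)) \<in> borel_measurable (\<rho>' s)" by (rule measurable_compose[OF \<theta>s \<alpha>B])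
            show "\<beta> \<in> borel_measurable (\<rho>' s)"
              using borel_measurable_continuous_onI[OF \<beta>(1)] \<rho>'P(2)[OF s] by (simp cong: measurable_cong_sets)
            show "AE x in \<rho>' s. \<alpha> (\<theta>' x) = \<beta> x"
              using carr by eventually_elim (simp add: \<theta>'_def \<beta>_def g(2))
          qed
          finally show "(LINT x|\<rho>' s. \<beta> x) = (LINT v|\<kappa>' s. \<alpha> v)" by simp
        qed
      qed
      show "(\<lambda>k. integral {0..t} (\<lambda>s. LINT v|\<kappa> (r k) s. \<alpha> v)) \<longlonglongrightarrow> integral {0..t} (\<lambda>s. LINT v|\<kappa>' s. \<alpha> v)"
        using conv[OF t \<beta>] unfolding left right .
    qed
  qed
qed


lemma continuous_on_slice:
  assumes "continuous_on (A \<times> B) (\<lambda>(s, v). h s v)" "s \<in> A"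
  shows "continuous_on B (h s)"
proof -
  have "continuous_on B (\<lambda>v. (\<lambda>(s, v). h s v) (s, v))"
    by (rule continuous_on_compose2[OF assms(1)]) (use assms(2) in \<open>auto intro!: continuous_intros\<close>)
  then show ?thesis by simp
qed

lemma sum_integral_consecutive:
  fixes f :: "real \<Rightarrow> 'b::euclidean_space"
  assumes "f integrable_on {0..a n}" "a 0 = 0" "\<And>i. a i \<le> a (Suc i)"
  shows "(\<Sum>i<n. integral {a i..a (Suc i)} f) = integral {0..a n} f"
  using assms(1)
proof (induction n)
  case (Suc n)
  have mono: "mono a" using assms(3) by (rule mono_iff_le_Suc[THEN iffD2, OF allI])
  have n: "0 \<le> a n" using monoD[OF mono, of 0 n] assms(2) by simp
  have "f integrable_on {0..a n}"
    by (rule integrable_on_subinterval[OF Suc.prems]) (use assms(3)[of n] in auto)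
  moreover have "integral {0..a n} f + integral {a n..a (Suc n)} f = integral {0..a (Suc n)} f"
    by (rule Henstock_Kurzweil_Integration.integral_combine[OF n assms(3) Suc.prems])
  ultimately show ?case using Suc.IH by simp
qed (simp add: assms)

text \<open>Weak convergence against functions of the control variable alone implies convergence
  against jointly continuous integrands, which are replaced by integrands that are piecewise
  constant in time.\<close>

lemma control_kernels_converge_joint:
  fixes \<Delta> :: "'a::euclidean_space set" and \<psi> :: "real \<Rightarrow> 'a \<Rightarrow> real"
  assumes \<Delta>: "compact \<Delta>" and \<kappa>: "\<And>k. \<kappa> k \<in> control_kernels \<Delta> T" and \<kappa>': "\<kappa>' \<in> control_kernels \<Delta> T"
    and conv: "weak_kernel_limit \<Delta> T \<kappa> \<kappa>'"
    and \<psi>: "continuous_on ({0..T} \<times> \<Delta>) (\<lambda>(s, v). \<psi> s v)" and t: "t \<in> {0..T}"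
  shows "(\<lambda>k. integral {0..t} (\<lambda>s. LINT v|\<kappa> k s. \<psi> s v)) \<longlonglongrightarrow> integral {0..t} (\<lambda>s. LINT v|\<kappa>' s. \<psi> s v)"
proof -
  have KP: "prob_space (K s)" "sets (K s) = sets (restrict_space borel \<Delta>)" "space (K s) = \<Delta>"
    if "K \<in> control_kernels \<Delta> T" "s \<in> {0..T}" for K s
    using measurable_space[OF that(1), of s] that(2) sets_eq_imp_space_eq[of "K s" "restrict_space borel \<Delta>"]
    by (auto simp: space_prob_algebra space_restrict_space)
  have Kint: "integrable (K s) \<alpha>" and Kbnd: "\<bar>LINT v|K s. \<alpha> v\<bar> \<le> C"
    if "K \<in> control_kernels \<Delta> T" "s \<in> {0..T}" "continuous_on \<Delta> \<alpha>" "\<And>v. v \<in> \<Delta> \<Longrightarrow> \<bar>\<alpha> v\<bar> \<le> C"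
    for K s C and \<alpha> :: "'a \<Rightarrow> real"
  proof -
    have "\<alpha> \<in> borel_measurable (K s)"
      using borel_measurable_continuous_on_restrict[OF that(3)] KP(2)[OF that(1,2)] by (simp cong: measurable_cong_sets)
    moreover have "norm (\<alpha> v) \<le> C" if "v \<in> space (K s)" for v
      using that KP(3)[OF \<open>K \<in> _\<close> \<open>s \<in> _\<close>] \<open>\<And>v. v \<in> \<Delta> \<Longrightarrow> \<bar>\<alpha> v\<bar> \<le> C\<close> by simp
    ultimately have "integrable (K s) \<alpha> \<and> norm (LINT v|K s. \<alpha> v) \<le> C"
      by (intro conjI prob_space_integral_bounded[OF KP(1)[OF that(1,2)]])
    then show "integrable (K s) \<alpha>" "\<bar>LINT v|K s. \<alpha> v\<bar> \<le> C" by simp_all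
  qed
  have \<psi>s: "continuous_on \<Delta> (\<psi> s)" if "s \<in> {0..T}" for s
    by (rule continuous_on_slice[OF \<psi> that])
  have comp: "compact ({0..T} \<times> \<Delta>)" using \<Delta> by (intro compact_Times compact_Icc)
  have "bounded ((\<lambda>(s, v). \<psi> s v) ` ({0..T} \<times> \<Delta>))"
    by (intro compact_imp_bounded compact_continuous_image \<psi> comp)
  then obtain C where C: "\<And>s v. s \<in> {0..T} \<Longrightarrow> v \<in> \<Delta> \<Longrightarrow> \<bar>\<psi> s v\<bar> \<le> C"
    by (force simp: bounded_iff)
  define I where "I K h = (\<lambda>s. LINT v|K s. \<psi> (h s) v)" for K :: "real \<Rightarrow> 'a measure" and h :: "real \<Rightarrow> real"
  have I_on: "I K h integrable_on {a..b}"
    if "K \<in> control_kernels \<Delta> T" "{a..b} \<subseteq> {0..T}" "continuous_on {0..T} h" "h ` {0..T} \<subseteq> {0..T}" for K a b h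
  proof (rule lebesgue_on_bounded_integrable(2)[OF _ _ that(2), of _ C])
    have "continuous_on ({0..T} \<times> \<Delta>) (\<lambda>p. (h (fst p), snd p))"
      by (intro continuous_intros continuous_on_compose2[OF that(3)]) auto
    then have "continuous_on ({0..T} \<times> \<Delta>) (\<lambda>p. case (h (fst p), snd p) of (s, v) \<Rightarrow> \<psi> s v)"
      by (rule continuous_on_compose2[OF \<psi>]) (use that(4) in auto)
    then have "continuous_on ({0..T} \<times> \<Delta>) (\<lambda>(s, v). \<psi> (h s) v)"
      by (simp add: case_prod_beta)
    then show "I K h \<in> borel_measurable (lebesgue_on {0..T})"
      unfolding I_def by (rule measurable_kernel_integral[OF that(1)])
    show "norm (I K h s) \<le> C" if s: "s \<in> {0..T}" for s
    proof -
      have hs: "h s \<in> {0..T}" using that \<open>h ` {0..T} \<subseteq> {0..T}\<close> by blast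
      show ?thesis
        unfolding I_def real_norm_def by (rule Kbnd[OF \<open>K \<in> _\<close> s \<psi>s[OF hs] C[OF hs]])
    qed
  qed
  have "(\<lambda>k. integral {0..t} (I (\<kappa> k) (\<lambda>s. s))) \<longlonglongrightarrow> integral {0..t} (I \<kappa>' (\<lambda>s. s))"
  proof (rule LIMSEQ_I)
    fix e :: real assume "e > 0"
    define \<epsilon> where "\<epsilon> = e / (4 * (T + 1))"
    have T0: "0 \<le> T" using t by auto
    then have \<epsilon>: "\<epsilon> > 0" using \<open>e > 0\<close> by (simp add: \<epsilon>_def)
    obtain \<delta> where \<delta>0: "\<delta> > 0" "\<forall>p\<in>{0..T} \<times> \<Delta>. \<forall>q\<in>{0..T} \<times> \<Delta>. dist q p < \<delta> \<longrightarrow>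
        dist ((\<lambda>(s, v). \<psi> s v) q) ((\<lambda>(s, v). \<psi> s v) p) < \<epsilon>"
      using compact_uniformly_continuous[OF \<psi> comp, unfolded uniformly_continuous_on_def, rule_format, OF \<epsilon>]
      by blast
    have \<delta>: "\<delta> > 0" "\<bar>\<psi> s v - \<psi> r v\<bar> < \<epsilon>" if "s \<in> {0..T}" "r \<in> {0..T}" "v \<in> \<Delta>" "\<bar>s - r\<bar> < \<delta>" for s r v
      using \<delta>0(1) bspec[OF bspec[OF \<delta>0(2), of "(r, v)"], of "(s, v)"] that
      by (auto simp: dist_Pair_Pair dist_real_def)
    obtain N :: nat where N: "t / \<delta> < N" using reals_Archimedean2 by blast
    then have N0: "N > 0" using t \<delta>0(1) by (cases N) (auto simp: divide_less_0_iff)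
    define a where "a i = t * real i / N" for i :: nat
    have a0: "a 0 = 0" and aN: "a N = t" using N0 by (auto simp: a_def)
    have aS: "a (Suc i) - a i = t / N" for i by (simp add: a_def diff_divide_distrib[symmetric] algebra_simps)
    have t_N: "t / N < \<delta>" "0 \<le> t / N" using N N0 \<delta>0(1) t by (auto simp: field_simps)
    have a_le: "a i \<le> a (Suc i)" for i using aS[of i] t_N by linarith
    have a_in: "a i \<in> {0..t}" if "i \<le> N" for i
      using that t N0 by (auto simp: a_def field_simps intro: mult_left_mono)
    have aT: "{a i..a (Suc i)} \<subseteq> {0..T}" if "i < N" for i using a_in[of i] a_in[of "Suc i"] that t by auto
    define S where "S K = (\<Sum>i<N. integral {a i..a (Suc i)} (I K (\<lambda>_. a i)))" for K
    have close: "\<bar>integral {0..t} (I K (\<lambda>s. s)) - S K\<bar> \<le> \<epsilon> * T" if K: "K \<in> control_kernels \<Delta> T" for K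
    proof -
      have piece: "\<bar>integral {a i..a (Suc i)} (I K (\<lambda>s. s)) - integral {a i..a (Suc i)} (I K (\<lambda>_. a i))\<bar> \<le> \<epsilon> * (t / N)"
        if i: "i < N" for i
      proof -
        have ai: "a i \<in> {0..T}" using a_in[of i] i t by auto
        have Ia: "I K (\<lambda>s. s) integrable_on {a i..a (Suc i)}" "I K (\<lambda>_. a i) integrable_on {a i..a (Suc i)}"
          using ai by (auto intro!: I_on K aT i)
        have bnd: "norm (I K (\<lambda>s. s) s - I K (\<lambda>_. a i) s) \<le> \<epsilon>" if s: "s \<in> {a i..a (Suc i)}" for s
        proof -
          have sT: "s \<in> {0..T}" using s aT[OF i] by auto
          have "I K (\<lambda>s. s) s - I K (\<lambda>_. a i) s = (LINT v|K s. \<psi> s v - \<psi> (a i) v)"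
            unfolding I_def using Kint[OF K sT \<psi>s[OF sT] C[OF sT]] Kint[OF K sT \<psi>s[OF ai] C[OF ai]] by simp
          moreover have "\<bar>\<psi> s v - \<psi> (a i) v\<bar> \<le> \<epsilon>" if "v \<in> \<Delta>" for v
          proof -
            have "\<bar>s - a i\<bar> < \<delta>" using s aS[of i] t_N by auto
            then show ?thesis using \<delta>(2)[OF sT ai that] by simp
          qed
          ultimately show ?thesis
            using Kbnd[OF K sT continuous_on_diff[OF \<psi>s[OF sT] \<psi>s[OF ai]], of \<epsilon>] by simp
        qed
        have "norm (integral {a i..a (Suc i)} (\<lambda>s. I K (\<lambda>s. s) s - I K (\<lambda>_. a i) s)) \<le> \<epsilon> * (a (Suc i) - a i)"
          by (intro norm_integral_le_const integrable_diff Ia a_le bnd)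
        then show ?thesis using Ia by (simp add: integral_diff aS)
      qed
      have "integral {0..t} (I K (\<lambda>s. s)) = (\<Sum>i<N. integral {a i..a (Suc i)} (I K (\<lambda>s. s)))"
        using sum_integral_consecutive[of "I K (\<lambda>s. s)" a N] a0 aN a_le I_on[OF K, of 0 t "\<lambda>s. s"] t by auto
      then have "\<bar>integral {0..t} (I K (\<lambda>s. s)) - S K\<bar> \<le> (\<Sum>i<N. \<bar>integral {a i..a (Suc i)} (I K (\<lambda>s. s)) - integral {a i..a (Suc i)} (I K (\<lambda>_. a i))\<bar>)"
        by (simp add: S_def flip: sum_subtractf)
      also have "\<dots> \<le> (\<Sum>i<N. \<epsilon> * (t / N))" by (intro sum_mono piece) auto
      also have "\<dots> = \<epsilon> * t" using N0 by simp
      also have "\<dots> \<le> \<epsilon> * T" using t \<epsilon> by simp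
      finally show ?thesis .
    qed
    have "(\<lambda>k. S (\<kappa> k)) \<longlonglongrightarrow> S \<kappa>'"
      unfolding S_def
    proof (rule tendsto_sum)
      fix i assume "i \<in> {..<N}"
      then have i: "i < N" by simp
      have ai: "a i \<in> {0..T}" "a (Suc i) \<in> {0..T}" using a_in[of i] a_in[of "Suc i"] i t by auto
      have split: "integral {a i..a (Suc i)} (I K (\<lambda>_. a i)) =
          integral {0..a (Suc i)} (\<lambda>s. LINT v|K s. \<psi> (a i) v) - integral {0..a i} (\<lambda>s. LINT v|K s. \<psi> (a i) v)"
        if K: "K \<in> control_kernels \<Delta> T" for K
      proof -
        have "I K (\<lambda>_. a i) integrable_on {0..a (Suc i)}"
          using ai by (intro I_on K) auto
        from Henstock_Kurzweil_Integration.integral_combine[OF _ a_le this] ai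
        show ?thesis by (simp add: I_def algebra_simps)
      qed
      show "(\<lambda>k. integral {a i..a (Suc i)} (I (\<kappa> k) (\<lambda>_. a i))) \<longlonglongrightarrow> integral {a i..a (Suc i)} (I \<kappa>' (\<lambda>_. a i))"
        unfolding split[OF \<kappa>] split[OF \<kappa>'] using conv ai \<psi>s[OF ai(1)] by (intro tendsto_diff) auto
    qed
    then obtain k0 where k0: "\<And>k. k \<ge> k0 \<Longrightarrow> norm (S (\<kappa> k) - S \<kappa>') < e / 2"
      using LIMSEQ_D[of "\<lambda>k. S (\<kappa> k)" "S \<kappa>'" "e / 2"] \<open>e > 0\<close> by auto
    have "\<epsilon> * T \<le> e / 4" using T0 \<open>e > 0\<close> by (simp add: \<epsilon>_def field_simps)
    then have "norm (integral {0..t} (I (\<kappa> k) (\<lambda>s. s)) - integral {0..t} (I \<kappa>' (\<lambda>s. s))) < e" if "k \<ge> k0" for k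
      using k0[OF that] close[OF \<kappa>[of k]] close[OF \<kappa>'] unfolding real_norm_def by linarith
    then show "\<exists>no. \<forall>n\<ge>no. norm (integral {0..t} (I (\<kappa> n) (\<lambda>s. s)) - integral {0..t} (I \<kappa>' (\<lambda>s. s))) < e" by blast
  qed
  then show ?thesis by (simp add: I_def)
qed

section \<open>Trajectories of relaxed controls\<close>

text \<open>Condition (I) provides a bound, a Lipschitz constant in the state, and joint continuity in time
  and control along every continuous curve.\<close>

lemma condition_I_constants:
  fixes \<Delta> :: "(real^'m::finite) set" and f :: "real^'n::finite \<Rightarrow> real^'m \<Rightarrow> real \<Rightarrow> real^'n"
  assumes "condition_I \<Delta> T f"
  obtains C L where "L > 0"
    "\<And>x v t. v \<in> \<Delta> \<Longrightarrow> t \<in> {0..T} \<Longrightarrow> norm (f x v t) \<le> C"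
    "\<And>x y v t. v \<in> \<Delta> \<Longrightarrow> t \<in> {0..T} \<Longrightarrow> norm (f x v t - f y v t) \<le> L * norm (x - y)"
    "\<And>z. continuous_on {0..T} z \<Longrightarrow> continuous_on ({0..T} \<times> \<Delta>) (\<lambda>(s, v). f (z s) v s)"
proof -
  obtain L where "\<forall>t\<in>{0..T}. L-lipschitz_on (UNIV \<times> \<Delta>) (\<lambda>(x, u). f x u t)"
    using assms unfolding condition_I_def by (elim conjE exE)
  then have L: "L-lipschitz_on (UNIV \<times> \<Delta>) (\<lambda>(x, u). f x u t)" if "t \<in> {0..T}" for t
    using that by blast
  obtain C where "\<forall>u\<in>\<Delta>. \<forall>t\<in>{0..T}. \<forall>x. norm (f x u t) \<le> C \<and>
        (\<forall>j. norm (partial j (\<lambda>z. f z u t) x) \<le> C) \<and>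
        (\<forall>j k. norm (partial k (partial j (\<lambda>z. f z u t)) x) \<le> C)"
    using assms unfolding condition_I_def by (elim conjE exE)
  then have C: "norm (f x v t) \<le> C" if "v \<in> \<Delta>" "t \<in> {0..T}" for x v t
    using that by blast
  have ft: "continuous_on {0..T} (\<lambda>t. f x v t)" if "v \<in> \<Delta>" for x v
    using assms that by (auto simp: condition_I_def)
  define M where "M = max L 1"
  have lip: "norm (f x v t - f y w t) \<le> M * dist (x, v) (y, w)"
    if "v \<in> \<Delta>" "w \<in> \<Delta>" "t \<in> {0..T}" for x y v w t
  proof -
    have "dist (f x v t) (f y w t) \<le> L * dist (x, v) (y, w)"
      using lipschitz_onD[OF L[OF that(3)], of "(x, v)" "(y, w)"] that by auto
    also have "\<dots> \<le> M * dist (x, v) (y, w)" by (intro mult_right_mono) (auto simp: M_def)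
    finally show ?thesis by (simp add: dist_norm)
  qed
  show ?thesis
  proof (rule that[of M C])
    show "M > 0" by (simp add: M_def)
    show "norm (f x v t) \<le> C" if "v \<in> \<Delta>" "t \<in> {0..T}" for x v t using C that .
    show "norm (f x v t - f y v t) \<le> M * norm (x - y)" if "v \<in> \<Delta>" "t \<in> {0..T}" for x y v t
      using lip[OF that(1,1,2), of x y] by (simp add: dist_Pair_Pair dist_norm)
    fix z :: "real \<Rightarrow> real^'n" assume z: "continuous_on {0..T} z"
    show "continuous_on ({0..T} \<times> \<Delta>) (\<lambda>(s, v). f (z s) v s)"
      unfolding continuous_on_def
    proof
      fix p0 assume "p0 \<in> {0..T} \<times> \<Delta>"
      then obtain s0 v0 where p0: "p0 = (s0, v0)" "s0 \<in> {0..T}" "v0 \<in> \<Delta>" by auto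
      let ?F = "at p0 within {0..T} \<times> \<Delta>"
      have fst_lim: "((\<lambda>p. fst p) \<longlongrightarrow> s0) ?F" and snd_lim: "((\<lambda>p. snd p) \<longlongrightarrow> v0) ?F"
        using tendsto_fst[OF tendsto_ident_at, of p0] tendsto_snd[OF tendsto_ident_at, of p0] by (auto simp: p0)
      have in_T: "\<forall>\<^sub>F p in ?F. fst p \<in> {0..T} \<and> snd p \<in> \<Delta>"
        unfolding eventually_at_filter by (rule always_eventually) auto
      have compose: "((\<lambda>p. h (fst p)) \<longlongrightarrow> h s0) ?F" if "continuous_on {0..T} h" for h :: "real \<Rightarrow> real^'n"
      proof -
        have "continuous_on ({0..T} \<times> \<Delta>) (\<lambda>p. h (fst p))"
          by (rule continuous_on_compose2[OF that]) (auto intro!: continuous_intros)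
        then show ?thesis using p0 by (auto simp: continuous_on_def)
      qed
      have "((\<lambda>p. f (z (fst p)) (snd p) (fst p) - f (z s0) v0 (fst p)) \<longlongrightarrow> 0) ?F"
      proof (rule Lim_null_comparison)
        show "\<forall>\<^sub>F p in ?F. norm (f (z (fst p)) (snd p) (fst p) - f (z s0) v0 (fst p)) \<le> M * dist (z (fst p), snd p) (z s0, v0)"
          using in_T by eventually_elim (use lip p0 in auto)
        have "((\<lambda>p. M * dist (z (fst p), snd p) (z s0, v0)) \<longlongrightarrow> M * dist (z s0, v0) (z s0, v0)) ?F"
          by (intro tendsto_intros compose[OF z] snd_lim)
        then show "((\<lambda>p. M * dist (z (fst p), snd p) (z s0, v0)) \<longlongrightarrow> 0) ?F" by simp
      qed
      from tendsto_add[OF this compose[OF ft[OF p0(3), of "z s0"]]]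
      show "((\<lambda>(s, v). f (z s) v s) \<longlongrightarrow> (case p0 of (s, v) \<Rightarrow> f (z s) v s)) ?F"
        by (simp add: p0 case_prod_unfold)
    qed
  qed
qed


lemma relaxed_rhs_bounded:
  fixes f :: "real^'n::finite \<Rightarrow> 'a::euclidean_space \<Rightarrow> real \<Rightarrow> real^'n"
  assumes \<mu>: "\<mu> \<in> space (prob_algebra (restrict_space borel \<Delta>))"
    and c: "continuous_on \<Delta> (\<lambda>v. f x v t)" and b: "\<And>v. v \<in> \<Delta> \<Longrightarrow> norm (f x v t) \<le> C"
  shows "integrable \<mu> (\<lambda>v. f x v t)" "norm (relaxed_rhs f x \<mu> t) \<le> C"
proof -
  have \<mu>': "prob_space \<mu>" "sets \<mu> = sets (restrict_space borel \<Delta>)"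
    using \<mu> by (auto simp: space_prob_algebra)
  have sp: "space \<mu> = \<Delta>" using sets_eq_imp_space_eq[OF \<mu>'(2)] by (simp add: space_restrict_space)
  have m: "(\<lambda>v. f x v t) \<in> borel_measurable \<mu>"
    using borel_measurable_continuous_on_restrict[OF c] \<mu>'(2) by (simp cong: measurable_cong_sets)
  show "integrable \<mu> (\<lambda>v. f x v t)"
    by (rule prob_space_integral_bounded(1)[OF \<mu>'(1) m]) (use b sp in blast)
  show "norm (relaxed_rhs f x \<mu> t) \<le> C"
    unfolding relaxed_rhs_def by (rule prob_space_integral_bounded(2)[OF \<mu>'(1) m]) (use b sp in blast)
qed

lemma control_field_time_measurable:
  fixes f :: "real^'n::finite \<Rightarrow> 'a::euclidean_space \<Rightarrow> real \<Rightarrow> real^'n"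
  assumes \<kappa>: "\<kappa> \<in> control_kernels \<Delta> T"
    and C: "\<And>x v t. v \<in> \<Delta> \<Longrightarrow> t \<in> {0..T} \<Longrightarrow> norm (f x v t) \<le> C"
    and L: "\<And>x y v t. v \<in> \<Delta> \<Longrightarrow> t \<in> {0..T} \<Longrightarrow> norm (f x v t - f y v t) \<le> L * norm (x - y)"
    and cont: "\<And>z. continuous_on {0..T} z \<Longrightarrow> continuous_on ({0..T} \<times> \<Delta>) (\<lambda>(s, v). f (z s) v s)"
  shows "time_measurable_field T C L (\<lambda>s y. relaxed_rhs f y (\<kappa> s) s)"
  unfolding time_measurable_field_def
proof (intro conjI allI impI ballI)
  fix z :: "real \<Rightarrow> real^'n" assume "continuous_on {0..T} z"
  then show "(\<lambda>s. relaxed_rhs f (z s) (\<kappa> s) s) \<in> borel_measurable (lebesgue_on {0..T})"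
    unfolding relaxed_rhs_def by (intro measurable_kernel_integral[OF \<kappa>] cont)
next
  fix s assume s: "s \<in> {0..T}"
  have \<mu>: "\<kappa> s \<in> space (prob_algebra (restrict_space borel \<Delta>))"
    using measurable_space[OF \<kappa>, of s] s by simp
  have c: "continuous_on \<Delta> (\<lambda>v. f y v s)" for y
    by (rule continuous_on_slice[OF cont[OF continuous_on_const] s])
  show "norm (relaxed_rhs f y (\<kappa> s) s) \<le> C" for y
    using relaxed_rhs_bounded(2)[where f=f, OF \<mu> c] C s by blast
  show "norm (relaxed_rhs f y (\<kappa> s) s - relaxed_rhs f y' (\<kappa> s) s) \<le> L * norm (y - y')" for y y'
  proof -
    have "relaxed_rhs f y (\<kappa> s) s - relaxed_rhs f y' (\<kappa> s) s = relaxed_rhs (\<lambda>_ v t. f y v t - f y' v t) y (\<kappa> s) s"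
      using relaxed_rhs_bounded(1)[where f=f, OF \<mu> c C[OF _ s]] by (simp add: relaxed_rhs_def)
    also have "norm \<dots> \<le> L * norm (y - y')"
      using L s by (intro relaxed_rhs_bounded(2)[OF \<mu>] continuous_on_diff c) auto
    finally show ?thesis .
  qed
qed

text \<open>The initial value problem for a relaxed control is solvable, hence \<open>trajectory\<close> selects a
  solution; that solution also solves the problem for every kernel that agrees with the control at
  almost every time.\<close>

lemma trajectory_integral_solution:
  fixes f :: "real^'n::finite \<Rightarrow> 'a::euclidean_space \<Rightarrow> real \<Rightarrow> real^'n"
  assumes T: "T \<ge> 0" and L: "L > 0" and AE: "AE t in lebesgue_on {0..T}. u t = \<kappa> t"
    and field: "time_measurable_field T C L (\<lambda>s y. relaxed_rhs f y (\<kappa> s) s)"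
  shows "integral_solution T (\<lambda>s y. relaxed_rhs f y (\<kappa> s) s) x (trajectory f T u x)"
proof -
  interpret complete_measure "lebesgue_on {0..T}" by (rule complete_measure_lebesgue_on) simp
  have AE_rhs: "AE s in lebesgue_on {0..T}. relaxed_rhs f (z s) (u s) s = relaxed_rhs f (z s) (\<kappa> s) s" for z
    using AE by eventually_elim simp
  obtain z where z: "integral_solution T (\<lambda>s y. relaxed_rhs f y (\<kappa> s) s) x z"
    using integral_solution_exists[OF T L field] by blast
  then have zc: "continuous_on {0..T} z" by (simp add: integral_solution_def)
  have "solves f T u x z"
    unfolding solves_def
  proof
    fix t assume t: "t \<in> {0..T}"
    have "(\<lambda>s. relaxed_rhs f (z s) (\<kappa> s) s) \<in> borel_measurable (lebesgue_on {0..T})"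
      using field zc by (simp add: time_measurable_field_def)
    then have "(\<lambda>s. relaxed_rhs f (z s) (u s) s) \<in> borel_measurable (lebesgue_on {0..T})"
      by (rule borel_measurable_AE_eq) (use AE_rhs[of z] in eventually_elim, simp)
    then have m: "(\<lambda>s. relaxed_rhs f (z s) (u s) s) \<in> borel_measurable (lebesgue_on {0..t})"
      by (rule measurable_restrict_mono) (use t in auto)
    have a: "(\<lambda>s. relaxed_rhs f (z s) (\<kappa> s) s) absolutely_integrable_on {0..t}"
      by (rule time_measurable_field_absolutely_integrable[OF field zc _ refl]) (use t in auto)
    then have i\<kappa>: "integrable (lebesgue_on {0..t}) (\<lambda>s. relaxed_rhs f (z s) (\<kappa> s) s)"
      by (simp add: absolutely_integrable_on_def set_integrable_def integrable_restrict_space)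
    have "AE s in lebesgue_on {0..t}. relaxed_rhs f (z s) (\<kappa> s) s = relaxed_rhs f (z s) (u s) s"
    proof -
      have "AE s in lebesgue. s \<in> {0..T} \<longrightarrow> relaxed_rhs f (z s) (u s) s = relaxed_rhs f (z s) (\<kappa> s) s"
        using AE_rhs[of z] by (subst (asm) AE_restrict_space_iff) auto
      then have "AE s in lebesgue. s \<in> {0..t} \<longrightarrow> relaxed_rhs f (z s) (\<kappa> s) s = relaxed_rhs f (z s) (u s) s"
        by eventually_elim (use t in auto)
      then show ?thesis by (subst AE_restrict_space_iff) auto
    qed
    then have iu: "integrable (lebesgue_on {0..t}) (\<lambda>s. relaxed_rhs f (z s) (u s) s)"
      using integrable_cong_AE_imp[OF i\<kappa> m] by simp
    have "(LINT s|lebesgue_on {0..t}. relaxed_rhs f (z s) (u s) s) = integral {0..t} (\<lambda>s. relaxed_rhs f (z s) (u s) s)"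
      by (rule lebesgue_integral_eq_integral[OF iu]) simp
    also have "\<dots> = integral {0..t} (\<lambda>s. relaxed_rhs f (z s) (\<kappa> s) s)"
      by (rule integral_Icc_cong_AE[OF AE_rhs]) (use t in simp)
    finally show "integrable (lebesgue_on {0..t}) (\<lambda>s. relaxed_rhs f (z s) (u s) s) \<and>
        z t = x + (LINT s|lebesgue_on {0..t}. relaxed_rhs f (z s) (u s) s)"
      using iu z t by (simp add: integral_solution_def)
  qed
  then have sol: "solves f T u x (trajectory f T u x)"
    unfolding trajectory_def by (rule someI[of "solves f T u x"])
  define y where "y = trajectory f T u x"
  have i: "integrable (lebesgue_on {0..t}) (\<lambda>s. relaxed_rhs f (y s) (u s) s)"
    and eq: "y t = x + (LINT s|lebesgue_on {0..t}. relaxed_rhs f (y s) (u s) s)" if "t \<in> {0..T}" for t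
    using sol that by (auto simp: solves_def y_def)
  have eq_HK: "y t = x + integral {0..t} (\<lambda>s. relaxed_rhs f (y s) (u s) s)" if "t \<in> {0..T}" for t
    using eq[OF that] lebesgue_integral_eq_integral[OF i[OF that]] by simp
  have "(\<lambda>s. relaxed_rhs f (y s) (u s) s) integrable_on {0..T}"
    using i[of T] T by (intro integrable_on_lebesgue_on) auto
  then have "continuous_on {0..T} (\<lambda>t. x + integral {0..t} (\<lambda>s. relaxed_rhs f (y s) (u s) s))"
    by (intro continuous_intros indefinite_integral_continuous_1)
  then have "continuous_on {0..T} y"
    by (rule continuous_on_eq) (simp add: eq_HK)
  moreover have "y t = x + integral {0..t} (\<lambda>s. relaxed_rhs f (y s) (\<kappa> s) s)" if "t \<in> {0..T}" for t
    using eq_HK[OF that] integral_Icc_cong_AE[OF AE_rhs, of t y] that by simp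
  ultimately show ?thesis by (simp add: integral_solution_def y_def)
qed

lemma trajectories_converge:
  fixes f :: "real^'n::finite \<Rightarrow> 'a::euclidean_space \<Rightarrow> real \<Rightarrow> real^'n"
  assumes \<Delta>: "compact \<Delta>" and L: "L > 0"
    and \<kappa>: "\<And>k. \<kappa> k \<in> control_kernels \<Delta> T" and \<kappa>': "\<kappa>' \<in> control_kernels \<Delta> T"
    and conv: "weak_kernel_limit \<Delta> T \<kappa> \<kappa>'"
    and C: "\<And>x v t. v \<in> \<Delta> \<Longrightarrow> t \<in> {0..T} \<Longrightarrow> norm (f x v t) \<le> C"
    and lip: "\<And>x y v t. v \<in> \<Delta> \<Longrightarrow> t \<in> {0..T} \<Longrightarrow> norm (f x v t - f y v t) \<le> L * norm (x - y)"
    and cont: "\<And>z. continuous_on {0..T} z \<Longrightarrow> continuous_on ({0..T} \<times> \<Delta>) (\<lambda>(s, v). f (z s) v s)"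
    and z: "\<And>k. integral_solution T (\<lambda>s y. relaxed_rhs f y (\<kappa> k s) s) x (z k)"
    and y: "integral_solution T (\<lambda>s y. relaxed_rhs f y (\<kappa>' s) s) x y"
    and t: "t \<in> {0..T}"
  shows "(\<lambda>k. z k t) \<longlonglongrightarrow> y t"
proof (rule integral_solution_convergence[OF L _ _ z y _ t])
  have field: "time_measurable_field T C L (\<lambda>s y. relaxed_rhs f y (K s) s)" if "K \<in> control_kernels \<Delta> T" for K
    by (rule control_field_time_measurable[OF that C lip cont])
  show "\<And>k. time_measurable_field T C L (\<lambda>s y. relaxed_rhs f y (\<kappa> k s) s)"
    "time_measurable_field T C L (\<lambda>s y. relaxed_rhs f y (\<kappa>' s) s)"
    by (intro field \<kappa> \<kappa>')+
  have yc: "continuous_on {0..T} y" using y by (simp add: integral_solution_def)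
  have c: "continuous_on ({0..T} \<times> \<Delta>) (\<lambda>(s, v). f (y s) v s)" by (rule cont[OF yc])
  fix t assume t: "t \<in> {0..T}"
  show "(\<lambda>k. integral {0..t} (\<lambda>s. relaxed_rhs f (y s) (\<kappa> k s) s)) \<longlonglongrightarrow> integral {0..t} (\<lambda>s. relaxed_rhs f (y s) (\<kappa>' s) s)"
  proof (rule vec_tendstoI)
    fix i
    have comp: "integral {0..t} (\<lambda>s. relaxed_rhs f (y s) (K s) s) $ i = integral {0..t} (\<lambda>s. LINT v|K s. f (y s) v s $ i)"
      if K: "K \<in> control_kernels \<Delta> T" for K
    proof -
      have "(\<lambda>s. relaxed_rhs f (y s) (K s) s) integrable_on {0..t}"
        by (rule time_measurable_field_integrable[OF field[OF K] yc]) (use t in auto)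
      then have "integral {0..t} (\<lambda>s. relaxed_rhs f (y s) (K s) s) $ i = integral {0..t} (\<lambda>s. relaxed_rhs f (y s) (K s) s $ i)"
        by simp
      also have "\<dots> = integral {0..t} (\<lambda>s. LINT v|K s. f (y s) v s $ i)"
      proof (rule integral_cong)
        fix s assume "s \<in> {0..t}"
        then have s: "s \<in> {0..T}" using t by auto
        have \<mu>: "K s \<in> space (prob_algebra (restrict_space borel \<Delta>))"
          using measurable_space[OF K, of s] s by simp
        have "continuous_on \<Delta> (\<lambda>v. f (y s) v s)"
          by (rule continuous_on_slice[OF c s])
        then have "integrable (K s) (\<lambda>v. f (y s) v s)"
          by (rule relaxed_rhs_bounded(1)[OF \<mu>]) (use C s in blast)
        from integral_bounded_linear[OF bounded_linear_vec_nth this, of i]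
        show "relaxed_rhs f (y s) (K s) s $ i = (LINT v|K s. f (y s) v s $ i)"
          by (simp add: relaxed_rhs_def)
      qed
      finally show ?thesis .
    qed
    have ci: "continuous_on ({0..T} \<times> \<Delta>) (\<lambda>(s, v). f (y s) v s $ i)"
      using continuous_on_component[OF c, of i] by (simp add: case_prod_beta)
    show "(\<lambda>k. integral {0..t} (\<lambda>s. relaxed_rhs f (y s) (\<kappa> k s) s) $ i) \<longlonglongrightarrow> integral {0..t} (\<lambda>s. relaxed_rhs f (y s) (\<kappa>' s) s) $ i"
      unfolding comp[OF \<kappa>] comp[OF \<kappa>']
      by (rule control_kernels_converge_joint[OF \<Delta> \<kappa> \<kappa>' conv ci t])
  qed
qed

text \<open>Families of maps \<open>Y (-) t\<close>, for t in [0,T], that are C-Lipschitz in time and bi-Lipschitz in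
  space with constant K.\<close>

definition lipschitz_flows :: "real \<Rightarrow> real \<Rightarrow> real \<Rightarrow> ('a::real_normed_vector \<Rightarrow> real \<Rightarrow> 'a) set" where
  "lipschitz_flows T C K =
     {Y. (\<forall>x. \<forall>s\<in>{0..T}. \<forall>t\<in>{0..T}. norm (Y x t - Y x s) \<le> C * \<bar>t - s\<bar>) \<and>
     (\<forall>x x'. \<forall>t\<in>{0..T}. norm (Y x t - Y x' t) \<le> K * norm (x - x') \<and>
       norm (x - x') \<le> K * norm (Y x t - Y x' t))}"

text \<open>The properties of the trajectories on which the treatment of the cost rests: bounds that are
  uniform in the control, and sequential compactness.\<close>

theorem relaxed_flow:
  fixes \<Delta> :: "(real^'m::finite) set" and f :: "real^'n::finite \<Rightarrow> real^'m \<Rightarrow> real \<Rightarrow> real^'n"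
  assumes T: "T \<ge> 0" and \<Delta>: "compact \<Delta>" "\<Delta> \<noteq> {}" and f: "condition_I \<Delta> T f"
  obtains C K where "K \<ge> 0"
    "\<forall>u\<in>relaxed_controls \<Delta> T. trajectory f T u \<in> lipschitz_flows T C K"
    "\<forall>U. (\<forall>k. U k \<in> relaxed_controls \<Delta> T) \<longrightarrow>
      (\<exists>r. strict_mono (r :: nat \<Rightarrow> nat) \<and> (\<exists>u\<in>relaxed_controls \<Delta> T. \<forall>x. \<forall>t\<in>{0..T}.
        (\<lambda>k. trajectory f T (U (r k)) x t) \<longlonglongrightarrow> trajectory f T u x t))"
proof -
  obtain C L where L: "L > 0"
    and C: "\<And>x v t. v \<in> \<Delta> \<Longrightarrow> t \<in> {0..T} \<Longrightarrow> norm (f x v t) \<le> C"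
    and lip: "\<And>x y v t. v \<in> \<Delta> \<Longrightarrow> t \<in> {0..T} \<Longrightarrow> norm (f x v t - f y v t) \<le> L * norm (x - y)"
    and cont: "\<And>z. continuous_on {0..T} z \<Longrightarrow> continuous_on ({0..T} \<times> \<Delta>) (\<lambda>(s, v). f (z s) v s)"
    by (rule condition_I_constants[OF f]) (rule that)
  have ker: "\<exists>\<kappa>. \<kappa> \<in> control_kernels \<Delta> T \<and> (AE t in lebesgue_on {0..T}. u t = \<kappa> t)"
    if "u \<in> relaxed_controls \<Delta> T" for u
    using relaxed_control_kernel_version[OF \<Delta> that] by blast
  have field: "time_measurable_field T C L (\<lambda>s y. relaxed_rhs f y (\<kappa> s) s)" if "\<kappa> \<in> control_kernels \<Delta> T" for \<kappa>
    by (rule control_field_time_measurable[OF that C lip cont])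
  have sol: "integral_solution T (\<lambda>s y. relaxed_rhs f y (\<kappa> s) s) x (trajectory f T u x)"
    if "\<kappa> \<in> control_kernels \<Delta> T" "AE t in lebesgue_on {0..T}. u t = \<kappa> t" for \<kappa> u x
    by (rule trajectory_integral_solution[OF T L that(2) field[OF that(1)]])
  define K where "K = 2 * exp (2 * L * T)"
  show ?thesis
  proof (rule that[of K C])
    show "K \<ge> 0" by (simp add: K_def)
    have time: "norm (trajectory f T u x t - trajectory f T u x s) \<le> C * \<bar>t - s\<bar>"
      if "u \<in> relaxed_controls \<Delta> T" "s \<in> {0..T}" "t \<in> {0..T}" for u x s t
      using ker[OF that(1)] sol field integral_solution_lipschitz_time that(2,3) by blast
    have space: "norm (trajectory f T u x t - trajectory f T u x' t) \<le> K * norm (x - x') \<and>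
        norm (x - x') \<le> K * norm (trajectory f T u x t - trajectory f T u x' t)"
      if u: "u \<in> relaxed_controls \<Delta> T" and t: "t \<in> {0..T}" for u x x' t
    proof -
      obtain \<kappa> where \<kappa>: "\<kappa> \<in> control_kernels \<Delta> T" "AE t in lebesgue_on {0..T}. u t = \<kappa> t"
        using ker[OF u] by blast
      let ?y = "trajectory f T u"
      have y0: "?y x 0 = x" for x using sol[OF \<kappa>, of x] T by (simp add: integral_solution_def)
      have e: "2 * n * exp (2 * L * t) \<le> K * n" if "n \<ge> 0" for n
      proof -
        have "exp (2 * L * t) \<le> exp (2 * L * T)" using t L by simp
        then have "2 * n * exp (2 * L * t) \<le> 2 * n * exp (2 * L * T)"
          using that by (intro mult_left_mono) auto
        then show ?thesis by (simp add: K_def mult_ac)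
      qed
      have "norm (?y x t - ?y x' t) \<le> 2 * norm (?y x 0 - ?y x' 0) * exp (2 * L * \<bar>t - 0\<bar>)"
        using T t by (intro integral_solution_two_point[OF L field[OF \<kappa>(1)] sol[OF \<kappa>] sol[OF \<kappa>]]) auto
      also have "\<dots> \<le> K * norm (x - x')" using e[of "norm (x - x')"] t by (simp add: y0)
      finally have 1: "norm (?y x t - ?y x' t) \<le> K * norm (x - x')" .
      have "norm (?y x 0 - ?y x' 0) \<le> 2 * norm (?y x t - ?y x' t) * exp (2 * L * \<bar>0 - t\<bar>)"
        using T t by (intro integral_solution_two_point[OF L field[OF \<kappa>(1)] sol[OF \<kappa>] sol[OF \<kappa>]]) auto
      also have "\<dots> \<le> K * norm (?y x t - ?y x' t)" using e[of "norm (?y x t - ?y x' t)"] t by simp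
      finally show "norm (?y x t - ?y x' t) \<le> K * norm (x - x') \<and> norm (x - x') \<le> K * norm (?y x t - ?y x' t)"
        using 1 by (simp add: y0)
    qed
    show "\<forall>u\<in>relaxed_controls \<Delta> T. trajectory f T u \<in> lipschitz_flows T C K"
      using time space by (simp add: lipschitz_flows_def)
    show "\<forall>U. (\<forall>k. U k \<in> relaxed_controls \<Delta> T) \<longrightarrow>
      (\<exists>r. strict_mono (r :: nat \<Rightarrow> nat) \<and> (\<exists>u\<in>relaxed_controls \<Delta> T. \<forall>x. \<forall>t\<in>{0..T}.
        (\<lambda>k. trajectory f T (U (r k)) x t) \<longlonglongrightarrow> trajectory f T u x t))"
    proof (intro allI impI)
      fix U :: "nat \<Rightarrow> real \<Rightarrow> (real^'m) measure" assume "\<forall>k. U k \<in> relaxed_controls \<Delta> T"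
      then have "\<forall>k. \<exists>\<kappa>. \<kappa> \<in> control_kernels \<Delta> T \<and> (AE t in lebesgue_on {0..T}. U k t = \<kappa> t)"
        using ker by blast
      then obtain \<kappa> where "\<forall>k. \<kappa> k \<in> control_kernels \<Delta> T \<and> (AE t in lebesgue_on {0..T}. U k t = \<kappa> k t)"
        unfolding choice_iff by (elim exE)
      then have \<kappa>: "\<kappa> k \<in> control_kernels \<Delta> T" "AE t in lebesgue_on {0..T}. U k t = \<kappa> k t" for k by auto
      obtain r \<kappa>' where r: "strict_mono (r :: nat \<Rightarrow> nat)" and \<kappa>': "\<kappa>' \<in> control_kernels \<Delta> T"
        and conv: "weak_kernel_limit \<Delta> T (\<lambda>k. \<kappa> (r k)) \<kappa>'"
        by (rule control_kernels_weakly_compact[of T \<Delta> \<kappa>, OF T \<Delta> \<kappa>(1)])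
      have "(\<lambda>k. trajectory f T (U (r k)) x t) \<longlonglongrightarrow> trajectory f T \<kappa>' x t" if "t \<in> {0..T}" for x t
        by (rule trajectories_converge[OF \<Delta>(1) L \<kappa>(1) \<kappa>' conv C lip cont sol[OF \<kappa>] sol[OF \<kappa>'] that]) auto
      then show "\<exists>r. strict_mono (r :: nat \<Rightarrow> nat) \<and> (\<exists>u\<in>relaxed_controls \<Delta> T. \<forall>x. \<forall>t\<in>{0..T}.
        (\<lambda>k. trajectory f T (U (r k)) x t) \<longlonglongrightarrow> trajectory f T u x t)"
        using r control_kernel_is_relaxed_control[OF \<Delta>(1) \<kappa>'] by blast
    qed
  qed
qed

section \<open>The cost functional\<close>

text \<open>The space-time function h is measured by the norm of \<open>L1([0,T], L2)\<close>; \<open>slice_norm h t\<close> is the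
  \<open>L2\<close> norm of \<open>h (-, t)\<close>, or 0 if that is not square integrable.\<close>

definition slice_norm :: "('a::euclidean_space \<times> real \<Rightarrow> real) \<Rightarrow> real \<Rightarrow> real" where
  "slice_norm h t = sqrt (enn2real (\<integral>\<^sup>+x. ennreal ((h (x, t))\<^sup>2) \<partial>lborel))"

text \<open>Lebesgue measure restricted to [0,T], as a measure on the Borel sets of the whole line.\<close>

definition time_measure :: "real \<Rightarrow> real measure" where
  "time_measure T = density lborel (indicator {0..T})"

lemma sets_time_measure [simp, measurable_cong]: "sets (time_measure T) = sets borel"
  by (simp add: time_measure_def)

lemma space_time_measure [simp]: "space (time_measure T) = UNIV"
  by (simp add: time_measure_def)

lemma finite_time_measure: "finite_measure (time_measure T)"
  by (rule finite_measureI)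
    (simp add: time_measure_def emeasure_density nn_integral_indicator emeasure_lborel_Icc_eq)

lemma AE_time_measure_iff: "(AE t in time_measure T. R t) \<longleftrightarrow> (AE t in lborel. t \<in> {0..T} \<longrightarrow> R t)"
  unfolding time_measure_def by (subst AE_density) (auto simp: indicator_def)

lemma AE_time_measure_lebesgue_on:
  "(AE t in time_measure T. R t) \<longleftrightarrow> (AE t in lebesgue_on {0..T}. R t)"
  unfolding AE_time_measure_iff
  by (subst AE_restrict_space_iff) (auto simp: AE_completion_iff)

lemma nn_integral_time_measure:
  fixes T :: real
  shows "(\<integral>\<^sup>+t. h t \<partial>lebesgue_on {0..T}) = (\<integral>\<^sup>+t. h t * indicator {0..T} t \<partial>lborel)"
  by (subst nn_integral_restrict_space) (auto simp: nn_integral_completion)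

lemma integral_time_measure:
  fixes h :: "real \<Rightarrow> real"
  assumes [measurable]: "h \<in> borel_measurable borel"
  shows "(LINT t|lebesgue_on {0..T}. h t) = (LINT t|time_measure T. h t)"
proof -
  have "(LINT t|lebesgue_on {0..T}. h t) = (LINT t|lebesgue. indicator {0..T} t *\<^sub>R h t)"
    by (rule integral_restrict_space) (simp add: sets_completionI_sets)
  also have "\<dots> = (LINT t|lborel. indicator {0..T} t *\<^sub>R h t)"
    by (rule integral_completion) simp
  also have "\<dots> = (LINT t|density lborel (\<lambda>t. ennreal (indicator {0..T} t)). h t)"
    by (rule integral_density[symmetric]) auto
  finally show ?thesis by (simp add: time_measure_def ennreal_indicator)
qed

lemma measurable_slice_norm [measurable]:
  assumes [measurable]: "h \<in> borel_measurable borel"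
  shows "slice_norm (h :: 'a::euclidean_space \<times> real \<Rightarrow> real) \<in> borel_measurable borel"
proof -
  have "(\<lambda>p. h (snd p, fst p)) \<in> borel_measurable (borel \<Otimes>\<^sub>M borel)"
    by (rule measurable_compose[OF _ assms]) (simp add: borel_prod[symmetric])
  then have "(\<lambda>(t, x). ennreal ((h (x, t))\<^sup>2)) \<in> borel_measurable (borel \<Otimes>\<^sub>M lborel)"
    by (simp add: case_prod_unfold cong: measurable_cong_sets)
  then show ?thesis unfolding slice_norm_def by measurable
qed

lemma measurable_slice [measurable]:
  fixes h :: "'a::euclidean_space \<times> real \<Rightarrow> 'b::topological_space"
  assumes h: "h \<in> borel_measurable borel"
  shows "(\<lambda>x. h (x, t)) \<in> borel_measurable borel"
  by (rule measurable_compose[OF _ h]) (simp add: borel_prod[symmetric])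

lemma AE_lborel_slices:
  assumes "AE p in (lborel :: ('a::euclidean_space \<times> 'b::euclidean_space) measure). R p"
  shows "AE t in lborel. AE x in lborel. R (x, t)"
proof -
  have "AE p in (lborel :: 'a measure) \<Otimes>\<^sub>M (lborel :: 'b measure). R p"
    using assms unfolding lborel_prod .
  then have "AE p in distr ((lborel :: 'b measure) \<Otimes>\<^sub>M (lborel :: 'a measure)) (lborel \<Otimes>\<^sub>M lborel) (\<lambda>(x, y). (y, x)). R p"
    by (simp only: lborel_pair.distr_pair_swap[symmetric])
  from AE_distrD[OF measurable_pair_swap' this]
  have "AE p in (lborel :: 'b measure) \<Otimes>\<^sub>M (lborel :: 'a measure). R (snd p, fst p)"
    by (simp add: case_prod_unfold)
  then show ?thesis
    using lborel_pair.AE_pair by fastforce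
qed

text \<open>Dominated convergence in \<open>L1([0,T], L2)\<close>.\<close>

lemma slice_norm_dominated_convergence:
  fixes G :: "'a::euclidean_space \<times> real \<Rightarrow> real"
  assumes G [measurable]: "G \<in> borel_measurable borel" and d [measurable]: "\<And>n. d n \<in> borel_measurable borel"
    and Gfin: "AE t in time_measure T. (\<integral>\<^sup>+x. ennreal ((G (x, t))\<^sup>2) \<partial>lborel) < \<infinity>"
    and Gint: "(\<integral>\<^sup>+t. ennreal (slice_norm G t) \<partial>time_measure T) < \<infinity>"
    and dom: "\<And>n p. \<bar>d n p\<bar> \<le> G p"
    and lim: "AE p in lborel. snd p \<in> {0..T} \<longrightarrow> (\<lambda>n. d n p) \<longlonglongrightarrow> (0::real)"
  shows "(\<lambda>n. \<integral>\<^sup>+t. ennreal (slice_norm (d n) t) \<partial>time_measure T) \<longlonglongrightarrow> 0"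
proof -
  have sq: "ennreal ((d n p)\<^sup>2) \<le> ennreal ((G p)\<^sup>2)" for n p
    using power_mono[OF dom[of n p], of 2] by (intro ennreal_leI) simp
  have le: "slice_norm (d n) t \<le> slice_norm G t" if "(\<integral>\<^sup>+x. ennreal ((G (x, t))\<^sup>2) \<partial>lborel) < \<infinity>" for n t
    unfolding slice_norm_def using that
    by (intro real_sqrt_le_mono enn2real_mono nn_integral_mono sq) simp
  have "AE t in lborel. AE x in (lborel :: 'a measure). t \<in> {0..T} \<longrightarrow> (\<lambda>n. d n (x, t)) \<longlonglongrightarrow> 0"
    using AE_lborel_slices[OF lim] by simp
  then have lim_t: "AE t in time_measure T. AE x in (lborel :: 'a measure). (\<lambda>n. d n (x, t)) \<longlonglongrightarrow> 0"
    unfolding AE_time_measure_iff by eventually_elim auto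
  have "(\<lambda>n. \<integral>\<^sup>+t. ennreal (slice_norm (d n) t) \<partial>time_measure T) \<longlonglongrightarrow> (\<integral>\<^sup>+t. 0 \<partial>time_measure T)"
  proof (rule nn_integral_dominated_convergence)
    show "(\<lambda>t. ennreal (slice_norm (d n) t)) \<in> borel_measurable (time_measure T)" for n by measurable
    show "(\<lambda>t. ennreal (slice_norm G t)) \<in> borel_measurable (time_measure T)" by measurable
    show "AE t in time_measure T. ennreal (slice_norm (d n) t) \<le> ennreal (slice_norm G t)" for n
      using Gfin by eventually_elim (intro ennreal_leI le)
    show "AE t in time_measure T. (\<lambda>n. ennreal (slice_norm (d n) t)) \<longlonglongrightarrow> 0"
      using Gfin lim_t
    proof eventually_elim
      fix t assume fin: "(\<integral>\<^sup>+x. ennreal ((G (x, t))\<^sup>2) \<partial>lborel) < \<infinity>"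
        and l: "AE x in (lborel :: 'a measure). (\<lambda>n. d n (x, t)) \<longlonglongrightarrow> 0"
      have "(\<lambda>n. \<integral>\<^sup>+x. ennreal ((d n (x, t))\<^sup>2) \<partial>lborel) \<longlonglongrightarrow> (\<integral>\<^sup>+x. 0 \<partial>(lborel :: 'a measure))"
      proof (rule nn_integral_dominated_convergence[where w="\<lambda>x. ennreal ((G (x, t))\<^sup>2)"])
        show "AE x in lborel. (\<lambda>n. ennreal ((d n (x, t))\<^sup>2)) \<longlonglongrightarrow> 0"
          using l
        proof eventually_elim
          fix x assume "(\<lambda>n. d n (x, t)) \<longlonglongrightarrow> 0"
          then have "(\<lambda>n. (d n (x, t))\<^sup>2) \<longlonglongrightarrow> 0\<^sup>2" by (intro tendsto_intros)
          then show "(\<lambda>n. ennreal ((d n (x, t))\<^sup>2)) \<longlonglongrightarrow> 0"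
            using tendsto_ennrealI by fastforce
        qed
      qed (use fin sq in auto)
      then have "(\<lambda>n. enn2real (\<integral>\<^sup>+x. ennreal ((d n (x, t))\<^sup>2) \<partial>lborel)) \<longlonglongrightarrow> enn2real 0"
        by (intro tendsto_enn2real) simp_all
      then have "(\<lambda>n. slice_norm (d n) t) \<longlonglongrightarrow> 0"
        unfolding slice_norm_def using tendsto_real_sqrt by fastforce
      then show "(\<lambda>n. ennreal (slice_norm (d n) t)) \<longlonglongrightarrow> 0"
        using tendsto_ennrealI by fastforce
    qed
  qed (use Gint in auto)
  then show ?thesis by simp
qed

text \<open>Density of bounded continuous functions in \<open>L1([0,T], L2)\<close>, in two steps: truncation, and
  pointwise approximation of a bounded function with bounded support.\<close>

lemma L1_L2_approximation:
  fixes \<phi> :: "'a::euclidean_space \<times> real \<Rightarrow> real"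
  assumes \<phi> [measurable]: "\<phi> \<in> borel_measurable borel"
    and fin: "AE t in time_measure T. (\<integral>\<^sup>+x. ennreal ((\<phi> (x, t))\<^sup>2) \<partial>lborel) < \<infinity>"
    and int: "(\<integral>\<^sup>+t. ennreal (slice_norm \<phi> t) \<partial>time_measure T) < \<infinity>"
    and e: "e > 0"
  obtains \<psi> h B where "\<psi> \<in> borel_measurable borel" "continuous_on UNIV h" "\<And>p. \<bar>h p\<bar> \<le> B"
    "AE t in time_measure T. (\<integral>\<^sup>+x. ennreal ((\<phi> (x, t) - \<psi> (x, t))\<^sup>2) \<partial>lborel) < \<infinity>"
    "AE t in time_measure T. (\<integral>\<^sup>+x. ennreal ((\<psi> (x, t) - h (x, t))\<^sup>2) \<partial>lborel) < \<infinity>"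
    "(\<integral>\<^sup>+t. ennreal (slice_norm (\<lambda>p. \<phi> p - \<psi> p) t) \<partial>time_measure T) < ennreal e"
    "(\<integral>\<^sup>+t. ennreal (slice_norm (\<lambda>p. \<psi> p - h p) t) \<partial>time_measure T) < ennreal e"
proof -
  have finite_le: "AE t in time_measure T. (\<integral>\<^sup>+x. ennreal ((d (x, t))\<^sup>2) \<partial>lborel) < \<infinity>"
    if "AE t in time_measure T. (\<integral>\<^sup>+x. ennreal ((G (x, t))\<^sup>2) \<partial>lborel) < \<infinity>" "\<And>p. \<bar>d p\<bar> \<le> G p"
    for d G :: "'a \<times> real \<Rightarrow> real"
    using that(1)
  proof eventually_elim
    fix t assume "(\<integral>\<^sup>+x. ennreal ((G (x, t))\<^sup>2) \<partial>lborel) < \<infinity>"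
    moreover have "(\<integral>\<^sup>+x. ennreal ((d (x, t))\<^sup>2) \<partial>lborel) \<le> (\<integral>\<^sup>+x. ennreal ((G (x, t))\<^sup>2) \<partial>lborel)"
      using power_mono[OF that(2), where n=2] by (intro nn_integral_mono ennreal_leI) simp
    ultimately show "(\<integral>\<^sup>+x. ennreal ((d (x, t))\<^sup>2) \<partial>lborel) < \<infinity>" by (rule le_less_trans[rotated])
  qed
  define trunc where "trunc n p = (if \<bar>\<phi> p\<bar> \<le> real n \<and> norm (fst p) \<le> real n then \<phi> p else 0)" for n :: nat and p
  have [measurable]: "(\<lambda>p. norm (fst p)) \<in> borel_measurable (borel :: ('a \<times> real) measure)"
    by (intro borel_measurable_continuous_onI continuous_intros)
  have trunc_m [measurable]: "trunc n \<in> borel_measurable borel" for n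
    unfolding trunc_def by measurable
  have abs_fin: "AE t in time_measure T. (\<integral>\<^sup>+x. ennreal (\<bar>\<phi> (x, t)\<bar>\<^sup>2) \<partial>lborel) < \<infinity>"
    using fin by simp
  have trunc_le: "\<bar>\<phi> p - trunc n p\<bar> \<le> \<bar>\<phi> p\<bar>" for n p by (auto simp: trunc_def)
  have "(\<lambda>n. \<integral>\<^sup>+t. ennreal (slice_norm (\<lambda>p. \<phi> p - trunc n p) t) \<partial>time_measure T) \<longlonglongrightarrow> 0"
  proof (rule slice_norm_dominated_convergence[where G="\<lambda>p. \<bar>\<phi> p\<bar>"])
    show "(\<integral>\<^sup>+t. ennreal (slice_norm (\<lambda>p. \<bar>\<phi> p\<bar>) t) \<partial>time_measure T) < \<infinity>"
      using int by (simp add: slice_norm_def)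
    show "AE p in lborel. snd p \<in> {0..T} \<longrightarrow> (\<lambda>n. \<phi> p - trunc n p) \<longlonglongrightarrow> 0"
    proof (intro AE_I2 impI)
      fix p
      obtain m :: nat where m: "max \<bar>\<phi> p\<bar> (norm (fst p)) \<le> m" using real_arch_simple by blast
      show "(\<lambda>n. \<phi> p - trunc n p) \<longlonglongrightarrow> 0"
        by (rule tendsto_eventually)
          (use m in \<open>auto simp: trunc_def eventually_sequentially intro!: exI[of _ m]\<close>)
    qed
  qed (use abs_fin trunc_le in auto)
  from order_tendstoD(2)[OF this, of "ennreal e"] e
  obtain N where N: "(\<integral>\<^sup>+t. ennreal (slice_norm (\<lambda>p. \<phi> p - trunc N p) t) \<partial>time_measure T) < ennreal e"
    by (auto simp: eventually_sequentially)
  define \<psi> where "\<psi> = trunc N"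
  have \<psi>m [measurable]: "\<psi> \<in> borel_measurable borel" by (simp add: \<psi>_def)
  have \<psi>N: "\<bar>\<psi> p\<bar> \<le> real N" "norm (fst p) > real N \<Longrightarrow> \<psi> p = 0" for p by (auto simp: \<psi>_def trunc_def)
  have "\<psi> measurable_on UNIV"
    by (rule lebesgue_measurable_imp_measurable_on_real) (auto intro: measurable_completion)
  then obtain Z g where Z: "negligible Z" and g: "\<And>n. continuous_on UNIV (g n)"
    and gl: "\<And>p. p \<notin> Z \<Longrightarrow> (\<lambda>n. g n p) \<longlonglongrightarrow> \<psi> p"
    unfolding measurable_on_def by auto
  define cut where "cut p = max 0 (min 1 (real N + 1 - norm (fst p)))" for p :: "'a \<times> real"
  define h where "h n p = cut p * max (- real N) (min (real N) (g n p))" for n p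
  have cut: "0 \<le> cut p" "cut p \<le> 1" "norm (fst p) \<le> real N \<Longrightarrow> cut p = 1" "norm (fst p) > real N + 1 \<Longrightarrow> cut p = 0" for p
    by (auto simp: cut_def)
  have hc: "continuous_on UNIV (h n)" for n
    unfolding h_def cut_def by (intro continuous_intros g)
  have hm [measurable]: "h n \<in> borel_measurable borel" for n by (rule borel_measurable_continuous_onI[OF hc])
  have hN: "\<bar>h n p\<bar> \<le> real N" for n p
  proof -
    have "\<bar>max (- real N) (min (real N) (g n p))\<bar> \<le> real N" by auto
    then have "cut p * \<bar>max (- real N) (min (real N) (g n p))\<bar> \<le> 1 * real N"
      using cut(1,2) by (intro mult_mono) auto
    then show ?thesis using cut(1)[of p] by (simp add: h_def abs_mult)
  qed
  define G where "G p = 2 * real N * indicator (cball 0 (real N + 1)) (fst p)" for p :: "'a \<times> real"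
  have Gm [measurable]: "G \<in> borel_measurable borel"
  proof -
    have "(fst :: 'a \<times> real \<Rightarrow> 'a) \<in> borel_measurable borel"
      by (intro borel_measurable_continuous_onI continuous_intros)
    moreover have "(\<lambda>x::'a. 2 * real N * indicator (cball 0 (real N + 1)) x :: real) \<in> borel_measurable borel"
      by (intro borel_measurable_times borel_measurable_const borel_measurable_indicator borel_closed closed_cball)
    ultimately show ?thesis unfolding G_def by (rule measurable_compose)
  qed
  have dom: "\<bar>\<psi> p - h n p\<bar> \<le> G p" for n p
  proof (cases "norm (fst p) \<le> real N + 1")
    case True
    then show ?thesis using \<psi>N(1)[of p] hN[of n p] by (simp add: G_def)
  next
    case False
    then show ?thesis using \<psi>N(2)[of p] cut(4)[of p] by (simp add: G_def h_def)
  qed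
  define I where "I = (\<integral>\<^sup>+x. ennreal ((2 * real N * indicator (cball (0::'a) (real N + 1)) x)\<^sup>2) \<partial>lborel)"
  have "I = (\<integral>\<^sup>+x. ennreal ((2 * real N)\<^sup>2) * indicator (cball (0::'a) (real N + 1)) x \<partial>lborel)"
    unfolding I_def by (intro nn_integral_cong) (auto simp: indicator_def)
  also have "\<dots> = ennreal ((2 * real N)\<^sup>2) * emeasure lborel (cball (0::'a) (real N + 1))"
    by (rule nn_integral_cmult_indicator) simp
  also have "\<dots> < \<infinity>"
    using emeasure_bounded_finite[of "cball (0::'a) (real N + 1)"] by (simp add: ennreal_mult_less_top)
  finally have I: "I < \<infinity>" .
  have GI: "(\<integral>\<^sup>+x. ennreal ((G (x, t))\<^sup>2) \<partial>lborel) = I" for t by (simp add: G_def I_def)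
  have Gfin: "AE t in time_measure T. (\<integral>\<^sup>+x. ennreal ((G (x, t))\<^sup>2) \<partial>lborel) < \<infinity>" using I by (simp add: GI)
  have "(\<lambda>n. \<integral>\<^sup>+t. ennreal (slice_norm (\<lambda>p. \<psi> p - h n p) t) \<partial>time_measure T) \<longlonglongrightarrow> 0"
  proof (rule slice_norm_dominated_convergence[where G=G])
    interpret finite_measure "time_measure T" by (rule finite_time_measure)
    have "emeasure (time_measure T) UNIV < top"
      using emeasure_finite[of UNIV] unfolding infinity_ennreal_def less_top .
    then show "(\<integral>\<^sup>+t. ennreal (slice_norm G t) \<partial>time_measure T) < \<infinity>"
      unfolding slice_norm_def GI by (simp add: ennreal_mult_less_top)
    have "Z \<in> null_sets lebesgue" using Z by (simp add: negligible_iff_null_sets)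
    then have "AE p in lebesgue. p \<notin> Z" by (rule AE_not_in)
    then have "AE p in lborel. p \<notin> Z" by (simp add: AE_completion_iff)
    then show "AE p in lborel. snd p \<in> {0..T} \<longrightarrow> (\<lambda>n. \<psi> p - h n p) \<longlonglongrightarrow> 0"
    proof eventually_elim
      fix p assume "p \<notin> Z"
      then have "(\<lambda>n. \<psi> p - h n p) \<longlonglongrightarrow> \<psi> p - cut p * max (- real N) (min (real N) (\<psi> p))"
        unfolding h_def by (intro tendsto_intros gl)
      moreover have "cut p * max (- real N) (min (real N) (\<psi> p)) = \<psi> p"
        using \<psi>N[of p] cut(3)[of p] by (cases "norm (fst p) \<le> real N") auto
      ultimately show "snd p \<in> {0..T} \<longrightarrow> (\<lambda>n. \<psi> p - h n p) \<longlonglongrightarrow> 0" by simp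
    qed
  qed (use Gfin dom in auto)
  from order_tendstoD(2)[OF this, of "ennreal e"] e
  obtain M where M: "(\<integral>\<^sup>+t. ennreal (slice_norm (\<lambda>p. \<psi> p - h M p) t) \<partial>time_measure T) < ennreal e"
    by (auto simp: eventually_sequentially)
  show ?thesis
  proof (rule that[OF \<psi>m hc[of M] hN[of M] _ _ _ M])
    show "AE t in time_measure T. (\<integral>\<^sup>+x. ennreal ((\<phi> (x, t) - \<psi> (x, t))\<^sup>2) \<partial>lborel) < \<infinity>"
      using finite_le[OF abs_fin, of "\<lambda>p. \<phi> p - \<psi> p"] trunc_le by (simp add: \<psi>_def)
    show "AE t in time_measure T. (\<integral>\<^sup>+x. ennreal ((\<psi> (x, t) - h M (x, t))\<^sup>2) \<partial>lborel) < \<infinity>"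
      using finite_le[OF Gfin, of "\<lambda>p. \<psi> p - h M p"] dom by simp
    show "(\<integral>\<^sup>+t. ennreal (slice_norm (\<lambda>p. \<phi> p - \<psi> p) t) \<partial>time_measure T) < ennreal e"
      using N by (simp add: \<psi>_def)
  qed
qed


text \<open>A random initial value a with square integrable density \<open>\<rho>\<close>, transported by flows in
  \<open>lipschitz_flows T C K\<close>.\<close>

locale random_initial_value = prob_space P
  for P :: "'w measure" and a :: "'w \<Rightarrow> 'a::euclidean_space" and \<rho> :: "'a \<Rightarrow> real" and T C K :: real +
  assumes T: "T \<ge> 0" and K: "K \<ge> 0"
    and density: "distributed P lborel a (\<lambda>x. ennreal (\<rho> x))"
    and density_L2: "in_L2 \<rho>"
begin

abbreviation flow_class :: "('a \<Rightarrow> real \<Rightarrow> 'a) set" where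
  "flow_class \<equiv> lipschitz_flows T C K"

text \<open>The space-time position at time t; times outside [0,T] do not matter and are clamped.\<close>

definition position :: "('a \<Rightarrow> real \<Rightarrow> 'a) \<Rightarrow> 'a \<times> real \<Rightarrow> 'a \<times> real" where
  "position Y p = (Y (fst p) (max 0 (min (snd p) T)), snd p)"

text \<open>The random space-time position, on the product of the sample space with the time axis.\<close>

definition transport :: "('a \<Rightarrow> real \<Rightarrow> 'a) \<Rightarrow> 'w \<times> real \<Rightarrow> 'a \<times> real" where
  "transport Y p = position Y (a (fst p), snd p)"

definition QT :: "('w \<times> real) measure" where
  "QT = P \<Otimes>\<^sub>M time_measure T"

sublocale time: finite_measure "time_measure T" by (rule finite_time_measure)

sublocale PT: pair_sigma_finite P "time_measure T" ..

lemma a_measurable [measurable]: "a \<in> P \<rightarrow>\<^sub>M borel"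
  using distributed_measurable[OF density] by simp

lemma density_measurable [measurable]: "(\<lambda>x. ennreal (\<rho> x)) \<in> borel_measurable borel"
  using distributed_borel_measurable[OF density] by simp

lemma continuous_position:
  assumes Y: "Y \<in> flow_class"
  shows "continuous_on UNIV (position Y)"
proof -
  define q where "q t = max 0 (min t T)" for t
  have q: "q t \<in> {0..T}" for t using T by (auto simp: q_def)
  have "continuous_on UNIV (\<lambda>p. Y (fst p) (q (snd p)))"
    unfolding continuous_on_def
  proof
    fix p0 :: "'a \<times> real"
    have "((\<lambda>p. Y (fst p) (q (snd p)) - Y (fst p0) (q (snd p0))) \<longlongrightarrow> 0) (at p0)"
    proof (rule Lim_null_comparison)
      show "\<forall>\<^sub>F p in at p0. norm (Y (fst p) (q (snd p)) - Y (fst p0) (q (snd p0)))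
          \<le> K * norm (fst p - fst p0) + C * \<bar>q (snd p) - q (snd p0)\<bar>"
      proof (rule always_eventually, rule allI)
        fix p
        have "norm (Y (fst p) (q (snd p)) - Y (fst p0) (q (snd p))) \<le> K * norm (fst p - fst p0)"
          "norm (Y (fst p0) (q (snd p)) - Y (fst p0) (q (snd p0))) \<le> C * \<bar>q (snd p) - q (snd p0)\<bar>"
          using Y q by (auto simp: lipschitz_flows_def)
        then show "norm (Y (fst p) (q (snd p)) - Y (fst p0) (q (snd p0)))
          \<le> K * norm (fst p - fst p0) + C * \<bar>q (snd p) - q (snd p0)\<bar>"
          by (rule norm_diff_triangle_le)
      qed
      have "((\<lambda>p. K * norm (fst p - fst p0) + C * \<bar>q (snd p) - q (snd p0)\<bar>) \<longlongrightarrow>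
          K * norm (fst p0 - fst p0) + C * \<bar>q (snd p0) - q (snd p0)\<bar>) (at p0)"
        unfolding q_def by (intro tendsto_intros)
      then show "((\<lambda>p. K * norm (fst p - fst p0) + C * \<bar>q (snd p) - q (snd p0)\<bar>) \<longlongrightarrow> 0) (at p0)"
        by simp
    qed
    then show "((\<lambda>p. Y (fst p) (q (snd p))) \<longlongrightarrow> Y (fst p0) (q (snd p0))) (at p0 within UNIV)"
      by (simp add: LIM_zero_iff)
  qed
  then show ?thesis
    unfolding position_def q_def[symmetric] by (intro continuous_intros)
qed

lemma measurable_transport:
  assumes Y: "Y \<in> flow_class"
  shows "transport Y \<in> QT \<rightarrow>\<^sub>M borel"
proof -
  have pm: "position Y \<in> borel_measurable borel"
    by (rule borel_measurable_continuous_onI[OF continuous_position[OF Y]])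
  have "(\<lambda>p. (a (fst p), snd p)) \<in> QT \<rightarrow>\<^sub>M borel \<Otimes>\<^sub>M borel"
    unfolding QT_def by measurable
  then have "(\<lambda>p. (a (fst p), snd p)) \<in> QT \<rightarrow>\<^sub>M borel" by (simp add: borel_prod)
  then show ?thesis unfolding transport_def by (rule measurable_compose[OF _ pm])
qed

text \<open>The constant of the \<open>L1\<close> estimate: the \<open>L2\<close> norm of the density times the square root of an
  upper bound for the factor by which a flow map compresses volumes.\<close>

definition transport_bound :: real where
  "transport_bound = sqrt (enn2real (\<integral>\<^sup>+x. ennreal ((\<rho> x)\<^sup>2) \<partial>lborel) * (2 * K * DIM('a))^DIM('a))"

lemma density_square_finite: "(\<integral>\<^sup>+x. ennreal ((\<rho> x)\<^sup>2) \<partial>lborel) < \<infinity>"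
proof -
  have "integrable lebesgue (\<lambda>x. (\<rho> x)\<^sup>2)" using density_L2 by (simp add: in_L2_def)
  then have "(\<integral>\<^sup>+x. ennreal ((\<rho> x)\<^sup>2) \<partial>lebesgue) < \<infinity>"
    by (subst (asm) integrable_iff_bounded) simp
  then show ?thesis by (simp add: nn_integral_completion)
qed

text \<open>Cauchy-Schwarz on a time slice, combined with the fact that \<open>Y (-) t\<close> compresses volumes
  at most by a fixed factor.\<close>

lemma transport_slice_bound:
  fixes h :: "'a \<times> real \<Rightarrow> real"
  assumes Y: "Y \<in> flow_class" and t: "t \<in> {0..T}" and h: "h \<in> borel_measurable borel"
    and fin: "(\<integral>\<^sup>+x. ennreal ((h (x, t))\<^sup>2) \<partial>lborel) < \<infinity>"
  shows "(\<integral>\<^sup>+x. ennreal (\<rho> x) * ennreal \<bar>h (position Y (x, t))\<bar> \<partial>lborel)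
      \<le> ennreal (transport_bound * slice_norm h t)"
proof -
  note [measurable] = h
  define g where "g x = Y x t" for x
  have pos: "position Y (x, t) = (g x, t)" for x using t by (simp add: position_def g_def)
  have glip: "norm (g x - g x') \<le> K * norm (x - x')" "norm (x - x') \<le> K * norm (g x - g x')" for x x'
    using Y t by (auto simp: lipschitz_flows_def g_def)
  have "K-lipschitz_on UNIV g" using glip(1) K by (intro lipschitz_onI) (auto simp: dist_norm)
  then have gm [measurable]: "g \<in> borel_measurable borel"
    by (intro borel_measurable_continuous_onI lipschitz_on_continuous_on)
  define k where "k = (2 * K * DIM('a))^DIM('a)"
  have k: "k \<ge> 0" using K by (simp add: k_def)
  obtain R where R: "(\<integral>\<^sup>+x. ennreal ((\<rho> x)\<^sup>2) \<partial>lborel) = ennreal R" "R \<ge> 0"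
    using density_square_finite by (cases "\<integral>\<^sup>+x. ennreal ((\<rho> x)\<^sup>2) \<partial>lborel") auto
  obtain S where S: "(\<integral>\<^sup>+x. ennreal ((h (x, t))\<^sup>2) \<partial>lborel) = ennreal S" "S \<ge> 0"
    using fin by (cases "\<integral>\<^sup>+x. ennreal ((h (x, t))\<^sup>2) \<partial>lborel") auto
  define X where "X = (\<integral>\<^sup>+x. ennreal (\<rho> x) * ennreal \<bar>h (g x, t)\<bar> \<partial>lborel)"
  have "X\<^sup>2 \<le> (\<integral>\<^sup>+x. (ennreal (\<rho> x))\<^sup>2 \<partial>lborel) * (\<integral>\<^sup>+x. (ennreal \<bar>h (g x, t)\<bar>)\<^sup>2 \<partial>lborel)"
    unfolding X_def by (rule Cauchy_Schwarz_nn_integral) measurable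
  also have "\<dots> \<le> ennreal R * (ennreal k * ennreal S)"
  proof (rule mult_mono)
    show "(\<integral>\<^sup>+x. (ennreal (\<rho> x))\<^sup>2 \<partial>lborel) \<le> ennreal R"
      unfolding R(1)[symmetric]
    proof (rule nn_integral_mono)
      show "(ennreal (\<rho> x))\<^sup>2 \<le> ennreal ((\<rho> x)\<^sup>2)" for x
        by (cases "\<rho> x \<ge> 0") (auto simp: ennreal_power ennreal_neg)
    qed
    have "(\<integral>\<^sup>+x. (ennreal \<bar>h (g x, t)\<bar>)\<^sup>2 \<partial>lborel) = (\<integral>\<^sup>+x. ennreal ((h (g x, t))\<^sup>2) \<partial>lborel)"
      by (simp add: ennreal_power)
    also have "\<dots> \<le> ennreal k * (\<integral>\<^sup>+x. ennreal ((h (x, t))\<^sup>2) \<partial>lborel)"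
      unfolding k_def by (rule nn_integral_expanding_map_le[OF gm glip(2) K]) measurable
    finally show "(\<integral>\<^sup>+x. (ennreal \<bar>h (g x, t)\<bar>)\<^sup>2 \<partial>lborel) \<le> ennreal k * ennreal S"
      by (simp add: S)
  qed auto
  also have "\<dots> = ennreal ((sqrt (R * k) * sqrt S)\<^sup>2)"
    using R S k by (simp add: power_mult_distrib mult_ac flip: ennreal_mult)
  finally have X2: "X\<^sup>2 \<le> ennreal ((sqrt (R * k) * sqrt S)\<^sup>2)" .
  then have "X < \<infinity>"
    by (metis ennreal_less_top infinity_ennreal_def le_less_trans power_less_top_ennreal zero_neq_numeral)
  then obtain x where x: "X = ennreal x" "x \<ge> 0" by (cases X) auto
  with X2 have "x\<^sup>2 \<le> (sqrt (R * k) * sqrt S)\<^sup>2" by (simp add: ennreal_power)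
  then have "x \<le> sqrt (R * k) * sqrt S"
    by (rule power2_le_imp_le) (use R S k in auto)
  then show ?thesis
    using x R S by (simp add: pos transport_bound_def slice_norm_def ennreal_leI k_def flip: X_def)
qed

lemma nn_integral_transport:
  assumes Y: "Y \<in> flow_class" and h: "h \<in> borel_measurable borel"
  shows "(\<integral>\<^sup>+p. h (transport Y p) \<partial>QT)
    = (\<integral>\<^sup>+t. (\<integral>\<^sup>+x. ennreal (\<rho> x) * h (position Y (x, t)) \<partial>lborel) \<partial>time_measure T)"
proof -
  have pm [measurable]: "position Y \<in> borel_measurable borel"
    by (rule borel_measurable_continuous_onI[OF continuous_position[OF Y]])
  have "(\<integral>\<^sup>+p. h (transport Y p) \<partial>QT) = (\<integral>\<^sup>+t. (\<integral>\<^sup>+\<omega>. h (transport Y (\<omega>, t)) \<partial>P) \<partial>time_measure T)"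
    unfolding QT_def
    by (rule PT.nn_integral_snd[symmetric])
      (rule measurable_compose[OF measurable_transport[OF Y, unfolded QT_def] h])
  also have "\<dots> = (\<integral>\<^sup>+t. (\<integral>\<^sup>+x. ennreal (\<rho> x) * h (position Y (x, t)) \<partial>lborel) \<partial>time_measure T)"
  proof (rule nn_integral_cong)
    fix t
    have "(\<lambda>x. h (position Y (x, t))) \<in> borel_measurable lborel"
      using measurable_slice[OF measurable_compose[OF pm h], of t] by simp
    then show "(\<integral>\<^sup>+\<omega>. h (transport Y (\<omega>, t)) \<partial>P) = (\<integral>\<^sup>+x. ennreal (\<rho> x) * h (position Y (x, t)) \<partial>lborel)"
      using distributed_nn_integral[OF density, of "\<lambda>x. h (position Y (x, t))"] by (simp add: transport_def)
  qed
  finally show ?thesis .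
qed

lemma transport_L1_bound:
  fixes h :: "'a \<times> real \<Rightarrow> real"
  assumes Y: "Y \<in> flow_class" and h [measurable]: "h \<in> borel_measurable borel"
    and fin: "AE t in time_measure T. (\<integral>\<^sup>+x. ennreal ((h (x, t))\<^sup>2) \<partial>lborel) < \<infinity>"
  shows "(\<integral>\<^sup>+p. ennreal \<bar>h (transport Y p)\<bar> \<partial>QT)
    \<le> ennreal transport_bound * (\<integral>\<^sup>+t. ennreal (slice_norm h t) \<partial>time_measure T)"
proof -
  have cb: "0 \<le> transport_bound" using K by (simp add: transport_bound_def)
  have sn: "0 \<le> slice_norm h t" for t by (simp add: slice_norm_def)
  have "(\<integral>\<^sup>+p. ennreal \<bar>h (transport Y p)\<bar> \<partial>QT)
      = (\<integral>\<^sup>+t. (\<integral>\<^sup>+x. ennreal (\<rho> x) * ennreal \<bar>h (position Y (x, t))\<bar> \<partial>lborel) \<partial>time_measure T)"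
    by (rule nn_integral_transport[OF Y]) measurable
  also have "\<dots> \<le> (\<integral>\<^sup>+t. ennreal (transport_bound * slice_norm h t) \<partial>time_measure T)"
  proof (rule nn_integral_mono_AE)
    have "AE t in time_measure T. t \<in> {0..T}" by (simp add: AE_time_measure_iff)
    with fin show "AE t in time_measure T. (\<integral>\<^sup>+x. ennreal (\<rho> x) * ennreal \<bar>h (position Y (x, t))\<bar> \<partial>lborel)
        \<le> ennreal (transport_bound * slice_norm h t)"
      by eventually_elim (intro transport_slice_bound Y h)
  qed
  also have "\<dots> = (\<integral>\<^sup>+t. ennreal transport_bound * ennreal (slice_norm h t) \<partial>time_measure T)"
    using cb sn by (simp add: ennreal_mult)
  also have "\<dots> = ennreal transport_bound * (\<integral>\<^sup>+t. ennreal (slice_norm h t) \<partial>time_measure T)"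
    by (rule nn_integral_cmult) measurable
  finally show ?thesis .
qed

lemma finite_measure_QT: "finite_measure QT"
proof -
  interpret finite_measure P by (rule finite_measure_axioms)
  show ?thesis unfolding QT_def
    by (rule finite_measure_pair_measure) (auto intro: finite_measure_axioms finite_time_measure)
qed

lemma transport_integrable:
  fixes h :: "'a \<times> real \<Rightarrow> real"
  assumes Y: "Y \<in> flow_class" and h: "h \<in> borel_measurable borel"
    and fin: "AE t in time_measure T. (\<integral>\<^sup>+x. ennreal ((h (x, t))\<^sup>2) \<partial>lborel) < \<infinity>"
    and int: "(\<integral>\<^sup>+t. ennreal (slice_norm h t) \<partial>time_measure T) < \<infinity>"
  shows "integrable QT (\<lambda>p. h (transport Y p))"
proof (rule integrableI_bounded)
  show "(\<lambda>p. h (transport Y p)) \<in> borel_measurable QT"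
    by (rule measurable_compose[OF measurable_transport[OF Y] h])
  have "(\<integral>\<^sup>+p. ennreal (norm (h (transport Y p))) \<partial>QT)
      \<le> ennreal transport_bound * (\<integral>\<^sup>+t. ennreal (slice_norm h t) \<partial>time_measure T)"
    using transport_L1_bound[OF Y h fin] by simp
  also have "\<dots> < \<infinity>" using int by (simp add: ennreal_mult_less_top)
  finally show "(\<integral>\<^sup>+p. ennreal (norm (h (transport Y p))) \<partial>QT) < \<infinity>" .
qed

lemma transport_integral_bound:
  fixes h :: "'a \<times> real \<Rightarrow> real"
  assumes Y: "Y \<in> flow_class" and h: "h \<in> borel_measurable borel"
    and fin: "AE t in time_measure T. (\<integral>\<^sup>+x. ennreal ((h (x, t))\<^sup>2) \<partial>lborel) < \<infinity>"
    and int: "(\<integral>\<^sup>+t. ennreal (slice_norm h t) \<partial>time_measure T) \<le> ennreal e" and e: "e \<ge> 0"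
  shows "\<bar>LINT p|QT. h (transport Y p)\<bar> \<le> transport_bound * e"
proof -
  have cb: "0 \<le> transport_bound" using K by (simp add: transport_bound_def)
  have i: "integrable QT (\<lambda>p. h (transport Y p))"
    using int by (intro transport_integrable Y h fin) (auto intro: le_less_trans)
  have "ennreal \<bar>LINT p|QT. h (transport Y p)\<bar> \<le> (\<integral>\<^sup>+p. ennreal \<bar>h (transport Y p)\<bar> \<partial>QT)"
    using integral_norm_bound_ennreal[OF i] by simp
  also have "\<dots> \<le> ennreal transport_bound * (\<integral>\<^sup>+t. ennreal (slice_norm h t) \<partial>time_measure T)"
    by (rule transport_L1_bound[OF Y h fin])
  also have "\<dots> \<le> ennreal transport_bound * ennreal e"
    by (intro mult_left_mono int) auto
  also have "\<dots> = ennreal (transport_bound * e)" using cb e by (simp add: ennreal_mult)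
  finally show ?thesis using cb e by (simp add: ennreal_le_iff)
qed

text \<open>Integrals of functions in \<open>L1([0,T], L2)\<close> along flows are continuous under pointwise
  convergence of the flows.\<close>

lemma transport_integral_convergence:
  fixes h :: "'a \<times> real \<Rightarrow> real"
  assumes Yk: "\<And>k. Yk k \<in> flow_class" and Y: "Y \<in> flow_class"
    and lim: "\<And>x t. t \<in> {0..T} \<Longrightarrow> (\<lambda>k. Yk k x t) \<longlonglongrightarrow> Y x t"
    and h [measurable]: "h \<in> borel_measurable borel"
    and fin: "AE t in time_measure T. (\<integral>\<^sup>+x. ennreal ((h (x, t))\<^sup>2) \<partial>lborel) < \<infinity>"
    and int: "(\<integral>\<^sup>+t. ennreal (slice_norm h t) \<partial>time_measure T) < \<infinity>"
  shows "(\<lambda>k. LINT p|QT. h (transport (Yk k) p)) \<longlonglongrightarrow> (LINT p|QT. h (transport Y p))"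
proof (rule LIMSEQ_I)
  fix r :: real assume r: "r > 0"
  have cb: "0 \<le> transport_bound" using K by (simp add: transport_bound_def)
  \<comment> \<open>Along every flow the integral of h is within \<open>r / 4\<close> of the integral of the continuous
      function g; the two approximation steps contribute at most \<open>r / 8\<close> each.\<close>
  define e where "e = r / (8 * (transport_bound + 1))"
  have e: "e > 0" using r cb by (simp add: e_def)
  have ce: "transport_bound * e \<le> r / 8" using cb r by (simp add: e_def field_simps)
  obtain \<psi> g B where \<psi> [measurable]: "\<psi> \<in> borel_measurable borel" and gc: "continuous_on UNIV g"
    and gB: "\<And>p. \<bar>g p\<bar> \<le> B"
    and fin1: "AE t in time_measure T. (\<integral>\<^sup>+x. ennreal ((h (x, t) - \<psi> (x, t))\<^sup>2) \<partial>lborel) < \<infinity>"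
    and fin2: "AE t in time_measure T. (\<integral>\<^sup>+x. ennreal ((\<psi> (x, t) - g (x, t))\<^sup>2) \<partial>lborel) < \<infinity>"
    and int1: "(\<integral>\<^sup>+t. ennreal (slice_norm (\<lambda>p. h p - \<psi> p) t) \<partial>time_measure T) < ennreal e"
    and int2: "(\<integral>\<^sup>+t. ennreal (slice_norm (\<lambda>p. \<psi> p - g p) t) \<partial>time_measure T) < ennreal e"
    by (rule L1_L2_approximation[OF h fin int e]) (rule that)
  have gm [measurable]: "g \<in> borel_measurable borel" by (rule borel_measurable_continuous_onI[OF gc])
  interpret QT: finite_measure QT by (rule finite_measure_QT)
  have close: "\<bar>(LINT p|QT. h (transport Z p)) - (LINT p|QT. g (transport Z p))\<bar> \<le> r / 4"
    if Z: "Z \<in> flow_class" for Z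
  proof -
    have tm: "transport Z \<in> QT \<rightarrow>\<^sub>M borel" by (rule measurable_transport[OF Z])
    have ih: "integrable QT (\<lambda>p. h (transport Z p))" by (rule transport_integrable[OF Z h fin int])
    have ig: "integrable QT (\<lambda>p. g (transport Z p))"
      by (rule QT.integrable_const_bound[of _ B]) (use gB measurable_compose[OF tm gm] in auto)
    have i1: "integrable QT (\<lambda>p. h (transport Z p) - \<psi> (transport Z p))"
      by (rule transport_integrable[OF Z, of "\<lambda>p. h p - \<psi> p"]) (use fin1 int1 in \<open>auto intro: less_trans\<close>)
    have i2: "integrable QT (\<lambda>p. \<psi> (transport Z p) - g (transport Z p))"
      by (rule transport_integrable[OF Z, of "\<lambda>p. \<psi> p - g p"]) (use fin2 int2 in \<open>auto intro: less_trans\<close>)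
    have b1: "\<bar>LINT p|QT. h (transport Z p) - \<psi> (transport Z p)\<bar> \<le> transport_bound * e"
      by (rule transport_integral_bound[OF Z, of "\<lambda>p. h p - \<psi> p"]) (use fin1 int1 e in auto)
    have b2: "\<bar>LINT p|QT. \<psi> (transport Z p) - g (transport Z p)\<bar> \<le> transport_bound * e"
      by (rule transport_integral_bound[OF Z, of "\<lambda>p. \<psi> p - g p"]) (use fin2 int2 e in auto)
    have "(LINT p|QT. h (transport Z p)) - (LINT p|QT. g (transport Z p))
        = (LINT p|QT. (h (transport Z p) - \<psi> (transport Z p)) + (\<psi> (transport Z p) - g (transport Z p)))"
      using ih ig by (simp flip: integral_diff)
    also have "\<dots> = (LINT p|QT. h (transport Z p) - \<psi> (transport Z p)) + (LINT p|QT. \<psi> (transport Z p) - g (transport Z p))"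
      by (rule Bochner_Integration.integral_add[OF i1 i2])
    finally show ?thesis using b1 b2 ce by linarith
  qed
  have "(\<lambda>k. LINT p|QT. g (transport (Yk k) p)) \<longlonglongrightarrow> (LINT p|QT. g (transport Y p))"
  proof (rule integral_dominated_convergence[where w="\<lambda>_. B"])
    show "(\<lambda>p. g (transport Y p)) \<in> borel_measurable QT"
      "\<And>k. (\<lambda>p. g (transport (Yk k) p)) \<in> borel_measurable QT"
      by (intro measurable_compose[OF measurable_transport gm] Y Yk)+
    show "AE p in QT. (\<lambda>k. g (transport (Yk k) p)) \<longlonglongrightarrow> g (transport Y p)"
    proof (rule AE_I2)
      fix p
      have "(\<lambda>k. transport (Yk k) p) \<longlonglongrightarrow> transport Y p"
        unfolding transport_def position_def using T by (intro tendsto_intros lim) auto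
      then show "(\<lambda>k. g (transport (Yk k) p)) \<longlonglongrightarrow> g (transport Y p)"
        by (rule isCont_tendsto_compose[rotated])
          (use gc in \<open>simp add: continuous_on_eq_continuous_at del: split_paired_All\<close>)
    qed
  qed (use gB in auto)
  from LIMSEQ_D[OF this, of "r / 4"] r
  obtain k0 where k0: "\<And>k. k \<ge> k0 \<Longrightarrow> norm ((LINT p|QT. g (transport (Yk k) p)) - (LINT p|QT. g (transport Y p))) < r / 4"
    by auto
  have "norm ((LINT p|QT. h (transport (Yk k) p)) - (LINT p|QT. h (transport Y p))) < r" if "k \<ge> k0" for k
    using k0[OF that] close[OF Yk[of k]] close[OF Y] r unfolding real_norm_def by linarith
  then show "\<exists>no. \<forall>n\<ge>no. norm ((LINT p|QT. h (transport (Yk n) p)) - (LINT p|QT. h (transport Y p))) < r"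
    by blast
qed

text \<open>Since the flow maps do not send sets of positive measure into null sets, a Lebesgue measurable
  integrand may be replaced by a Borel version.\<close>

lemma iterated_integral_eq_transport_integral:
  fixes \<phi> :: "'a \<Rightarrow> real \<Rightarrow> real" and h :: "'a \<times> real \<Rightarrow> real"
  assumes Y: "Y \<in> flow_class" and h [measurable]: "h \<in> borel_measurable borel"
    and eq: "AE p in lborel. snd p \<in> {0..T} \<longrightarrow> \<phi> (fst p) (snd p) = h p"
    and fin: "AE t in time_measure T. (\<integral>\<^sup>+x. ennreal ((h (x, t))\<^sup>2) \<partial>lborel) < \<infinity>"
    and int: "(\<integral>\<^sup>+t. ennreal (slice_norm h t) \<partial>time_measure T) < \<infinity>"
  shows "(LINT \<omega>|completion P. LINT t|lebesgue_on {0..T}. \<phi> (Y (a \<omega>) t) t) = (LINT p|QT. h (transport Y p))"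
proof -
  interpret L: complete_measure "lebesgue_on {0..T}" by (rule complete_measure_lebesgue_on) simp
  obtain N where N: "{p \<in> space lborel. \<not> (snd p \<in> {0..T} \<longrightarrow> \<phi> (fst p) (snd p) = h p)} \<subseteq> N"
    "emeasure lborel N = 0" "N \<in> sets lborel"
    using AE_E[OF eq] by blast
  have Nb [measurable]: "N \<in> sets borel" using N(3) by simp
  have im: "indicat_real N \<in> borel_measurable borel" by (rule borel_measurable_indicator[OF Nb])
  have "AE p in lborel. p \<notin> N" using N(2,3) by (intro AE_not_in) (auto simp: null_sets_def)
  then have "AE t in lborel. AE x in (lborel :: 'a measure). (x, t) \<notin> N"
    by (rule AE_lborel_slices)
  then have slice0: "AE t in lborel. (\<integral>\<^sup>+x. ennreal ((indicat_real N (x, t))\<^sup>2) \<partial>(lborel :: 'a measure)) = 0"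
  proof eventually_elim
    fix t assume "AE x in (lborel :: 'a measure). (x, t) \<notin> N"
    note N_slice = this
    have "(\<integral>\<^sup>+x. ennreal ((indicat_real N (x, t))\<^sup>2) \<partial>(lborel :: 'a measure)) = (\<integral>\<^sup>+x. 0 \<partial>(lborel :: 'a measure))"
      by (rule nn_integral_cong_AE) (use N_slice in eventually_elim, simp)
    then show "(\<integral>\<^sup>+x. ennreal ((indicat_real N (x, t))\<^sup>2) \<partial>(lborel :: 'a measure)) = 0" by simp
  qed
  then have slice0': "AE t in time_measure T. (\<integral>\<^sup>+x. ennreal ((indicat_real N (x, t))\<^sup>2) \<partial>(lborel :: 'a measure)) = 0"
    unfolding AE_time_measure_iff by eventually_elim simp
  have fin0: "AE t in time_measure T. (\<integral>\<^sup>+x. ennreal ((indicat_real N (x, t))\<^sup>2) \<partial>(lborel :: 'a measure)) < \<infinity>"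
    using slice0' by eventually_elim simp
  have "(\<integral>\<^sup>+t. ennreal (slice_norm (indicat_real N) t) \<partial>time_measure T) = (\<integral>\<^sup>+t. 0 \<partial>time_measure T)"
    by (rule nn_integral_cong_AE) (use slice0' in eventually_elim, simp add: slice_norm_def)
  then have "(\<integral>\<^sup>+p. ennreal \<bar>indicat_real N (transport Y p)\<bar> \<partial>QT) = 0"
    using transport_L1_bound[OF Y im fin0] by simp
  moreover have "(\<lambda>p. ennreal \<bar>indicat_real N (transport Y p)\<bar>) \<in> borel_measurable QT"
    using measurable_compose[OF measurable_transport[OF Y] im] by measurable
  ultimately have "AE p in QT. ennreal \<bar>indicat_real N (transport Y p)\<bar> = 0"
    by (simp add: nn_integral_0_iff_AE)
  then have "AE p in P \<Otimes>\<^sub>M time_measure T. transport Y p \<notin> N"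
    unfolding QT_def by eventually_elim (simp add: indicator_def split: if_splits)
  then have avoid: "AE \<omega> in P. AE t in time_measure T. transport Y (\<omega>, t) \<notin> N"
    by (rule PT.AE_pair)
  have pm: "position Y \<in> borel_measurable borel"
    by (rule borel_measurable_continuous_onI[OF continuous_position[OF Y]])
  have slice_m: "(\<lambda>t. h (transport Y (\<omega>, t))) \<in> borel_measurable borel" for \<omega>
    unfolding transport_def fst_conv snd_conv
    by (rule measurable_compose[OF measurable_compose[OF _ pm] h]) (simp add: borel_prod[symmetric])
  define inner where "inner \<omega> = (LINT t|time_measure T. h (transport Y (\<omega>, t)))" for \<omega>
  have tm: "(\<lambda>p. h (transport Y p)) \<in> borel_measurable (P \<Otimes>\<^sub>M time_measure T)"
    using measurable_compose[OF measurable_transport[OF Y] h] by (simp add: QT_def)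
  have inner_m: "inner \<in> borel_measurable P"
    unfolding inner_def using tm by (intro time.borel_measurable_lebesgue_integral) simp
  have "AE \<omega> in P. inner \<omega> = (LINT t|lebesgue_on {0..T}. \<phi> (Y (a \<omega>) t) t)"
    using avoid
  proof eventually_elim
    fix \<omega> assume "AE t in time_measure T. transport Y (\<omega>, t) \<notin> N"
    then have "AE t in lebesgue_on {0..T}. transport Y (\<omega>, t) \<notin> N"
      by (simp only: AE_time_measure_lebesgue_on)
    then have eq_t: "AE t in lebesgue_on {0..T}. h (transport Y (\<omega>, t)) = \<phi> (Y (a \<omega>) t) t"
      using AE_space
    proof eventually_elim
      fix t assume t: "transport Y (\<omega>, t) \<notin> N" "t \<in> space (lebesgue_on {0..T})"
      then have pos: "transport Y (\<omega>, t) = (Y (a \<omega>) t, t)" and tT: "t \<in> {0..T}"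
        by (auto simp: transport_def position_def min_absorb1 max_absorb2)
      have "(Y (a \<omega>) t, t) \<notin> {p \<in> space lborel. \<not> (snd p \<in> {0..T} \<longrightarrow> \<phi> (fst p) (snd p) = h p)}"
        using subsetD[OF N(1)] t(1) unfolding pos by blast
      then show "h (transport Y (\<omega>, t)) = \<phi> (Y (a \<omega>) t) t"
        using tT by (simp add: pos)
    qed
    have m1: "(\<lambda>t. h (transport Y (\<omega>, t))) \<in> borel_measurable (lebesgue_on {0..T})"
      using slice_m by (intro measurable_restrict_space1 measurable_completion) simp
    have m2: "(\<lambda>t. \<phi> (Y (a \<omega>) t) t) \<in> borel_measurable (lebesgue_on {0..T})"
      by (rule L.borel_measurable_AE_eq[OF m1 eq_t])
    have "inner \<omega> = (LINT t|lebesgue_on {0..T}. h (transport Y (\<omega>, t)))"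
      unfolding inner_def by (rule integral_time_measure[OF slice_m, symmetric])
    also have "\<dots> = (LINT t|lebesgue_on {0..T}. \<phi> (Y (a \<omega>) t) t)"
      by (rule integral_cong_AE[OF m1 m2 eq_t])
    finally show "inner \<omega> = (LINT t|lebesgue_on {0..T}. \<phi> (Y (a \<omega>) t) t)" .
  qed
  then have inner_eq: "AE \<omega> in completion P. inner \<omega> = (LINT t|lebesgue_on {0..T}. \<phi> (Y (a \<omega>) t) t)"
    by (rule AE_completion)
  have inner_mc: "inner \<in> borel_measurable (completion P)" by (rule measurable_completion[OF inner_m])
  have "(LINT \<omega>|completion P. LINT t|lebesgue_on {0..T}. \<phi> (Y (a \<omega>) t) t) = (LINT \<omega>|completion P. inner \<omega>)"
    by (rule integral_cong_AE[OF inner_mc _ inner_eq, symmetric])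
      (rule complete_measure.borel_measurable_AE_eq[OF completion.complete_measure_axioms inner_mc inner_eq])
  also have "\<dots> = (LINT \<omega>|P. inner \<omega>)" by (rule integral_completion[OF inner_m])
  also have "\<dots> = (LINT p|QT. h (transport Y p))"
    unfolding inner_def QT_def
    by (rule PT.integral_fst') (use transport_integrable[OF Y h fin int] in \<open>simp add: QT_def\<close>)
  finally show ?thesis .
qed

end

lemma L1_L2_borel_version:
  fixes \<phi> :: "'a::euclidean_space \<Rightarrow> real \<Rightarrow> real"
  assumes \<phi>: "in_L1_L2 T \<phi>"
  obtains h :: "'a \<times> real \<Rightarrow> real" where "h \<in> borel_measurable borel"
    "AE p in lborel. snd p \<in> {0..T} \<longrightarrow> \<phi> (fst p) (snd p) = h p"
    "AE t in time_measure T. (\<integral>\<^sup>+x. ennreal ((h (x, t))\<^sup>2) \<partial>lborel) < \<infinity>"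
    "(\<integral>\<^sup>+t. ennreal (slice_norm h t) \<partial>time_measure T) < \<infinity>"
proof -
  have meas: "(\<lambda>(x, t). \<phi> x t) \<in> borel_measurable (lebesgue_on (UNIV \<times> {0..T}))"
    and L2: "AE t in lebesgue_on {0..T}. in_L2 (\<lambda>x. \<phi> x t)"
    and L1: "integrable (lebesgue_on {0..T}) (\<lambda>t. L2_norm (\<lambda>x. \<phi> x t))"
    using \<phi> by (auto simp: in_L1_L2_def)
  have S: "UNIV \<times> {0..T} \<in> sets (lebesgue :: ('a \<times> real) measure)"
    by (intro sets_completionI_sets) (simp add: closed_Times)
  have "(\<lambda>p. if p \<in> UNIV \<times> {0..T} then (\<lambda>(x, t). \<phi> x t) p else 0) \<in> borel_measurable lebesgue"
    using borel_measurable_if[OF S, of "\<lambda>(x, t). \<phi> x t"] meas by simp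
  from completion_ex_borel_measurable_real[OF this]
  obtain h where h: "h \<in> borel_measurable (lborel :: ('a \<times> real) measure)"
    and eq: "AE p in lborel. (if p \<in> UNIV \<times> {0..T} then (\<lambda>(x, t). \<phi> x t) p else 0) = h p" by blast
  have hb [measurable]: "h \<in> borel_measurable borel" using h by simp
  have eq': "AE p in lborel. snd p \<in> {0..T} \<longrightarrow> \<phi> (fst p) (snd p) = h p"
    using eq by eventually_elim (auto simp: case_prod_unfold split: if_splits)
  have slices: "AE t in lebesgue_on {0..T}. AE x in lborel. \<phi> x t = h (x, t)"
    unfolding AE_time_measure_lebesgue_on[symmetric] AE_time_measure_iff
    using AE_lborel_slices[OF eq'] by eventually_elim auto
  have both: "AE t in lebesgue_on {0..T}. (\<integral>\<^sup>+x. ennreal ((h (x, t))\<^sup>2) \<partial>lborel) < \<infinity> \<and>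
      slice_norm h t = L2_norm (\<lambda>x. \<phi> x t)"
    using L2 slices
  proof eventually_elim
    fix t assume L2: "in_L2 (\<lambda>x. \<phi> x t)" and sl: "AE x in lborel. \<phi> x t = h (x, t)"
    have m: "(\<lambda>x. \<phi> x t) \<in> borel_measurable lebesgue" and i: "integrable lebesgue (\<lambda>x. (\<phi> x t)\<^sup>2)"
      using L2 by (auto simp: in_L2_def)
    have e: "(\<integral>\<^sup>+x. ennreal ((h (x, t))\<^sup>2) \<partial>lborel) = (\<integral>\<^sup>+x. ennreal ((\<phi> x t)\<^sup>2) \<partial>lebesgue)"
      unfolding nn_integral_completion by (rule nn_integral_cong_AE) (use sl in eventually_elim, simp)
    have "(\<integral>\<^sup>+x. ennreal ((\<phi> x t)\<^sup>2) \<partial>lebesgue) < \<infinity>"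
      using i by (subst (asm) integrable_iff_bounded) simp
    moreover have "(LINT x|lebesgue. (\<phi> x t)\<^sup>2) = enn2real (\<integral>\<^sup>+x. ennreal ((\<phi> x t)\<^sup>2) \<partial>lebesgue)"
      using m by (intro integral_eq_nn_integral) auto
    ultimately show "(\<integral>\<^sup>+x. ennreal ((h (x, t))\<^sup>2) \<partial>lborel) < \<infinity> \<and> slice_norm h t = L2_norm (\<lambda>x. \<phi> x t)"
      by (simp add: e slice_norm_def L2_norm_def)
  qed
  have fin: "AE t in time_measure T. (\<integral>\<^sup>+x. ennreal ((h (x, t))\<^sup>2) \<partial>lborel) < \<infinity>"
    unfolding AE_time_measure_lebesgue_on using both by eventually_elim simp
  have "(\<integral>\<^sup>+t. ennreal (slice_norm h t) \<partial>time_measure T) = (\<integral>\<^sup>+t. indicator {0..T} t * ennreal (slice_norm h t) \<partial>lborel)"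
    unfolding time_measure_def by (rule nn_integral_density) auto
  also have "\<dots> = (\<integral>\<^sup>+t. ennreal (slice_norm h t) \<partial>lebesgue_on {0..T})"
    by (simp add: nn_integral_time_measure mult.commute)
  also have "\<dots> = (\<integral>\<^sup>+t. ennreal (L2_norm (\<lambda>x. \<phi> x t)) \<partial>lebesgue_on {0..T})"
    by (rule nn_integral_cong_AE) (use both in eventually_elim, simp)
  also have "\<dots> \<le> (\<integral>\<^sup>+t. ennreal (norm (L2_norm (\<lambda>x. \<phi> x t))) \<partial>lebesgue_on {0..T})"
    by (intro nn_integral_mono ennreal_leI) simp
  also have "\<dots> < \<infinity>" using L1 by (subst (asm) integrable_iff_bounded) simp
  finally show ?thesis using that hb eq' fin by blast
qed

lemma attains_infimum_if_sequentially_compact: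
  fixes J :: "'u \<Rightarrow> real"
  assumes S: "S \<noteq> {}" and bdd: "\<And>u. u \<in> S \<Longrightarrow> \<bar>J u\<bar> \<le> B"
    and comp: "\<And>U. (\<forall>k. U k \<in> S) \<Longrightarrow>
      \<exists>r. strict_mono (r :: nat \<Rightarrow> nat) \<and> (\<exists>u\<in>S. (\<lambda>k. J (U (r k))) \<longlonglongrightarrow> J u)"
  shows "\<exists>u\<in>S. \<forall>v\<in>S. J u \<le> J v"
proof -
  define m where "m = (INF u\<in>S. J u)"
  have bb: "bdd_below (J ` S)" using bdd by (intro bdd_belowI[of _ "-B"]) force
  have m_le: "m \<le> J u" if "u \<in> S" for u unfolding m_def by (rule cINF_lower[OF bb that])
  have "\<exists>u\<in>S. J u < m + 1 / real (Suc k)" for k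
    using cINF_less_iff[OF S bb, of "m + 1 / real (Suc k)"] by (simp add: m_def)
  then have "\<exists>U. \<forall>k. U k \<in> S \<and> J (U k) < m + 1 / real (Suc k)"
    by (intro choice) blast
  then obtain U where U: "\<forall>k. U k \<in> S" "\<And>k. J (U k) < m + 1 / real (Suc k)" by blast
  obtain r u where r: "strict_mono (r :: nat \<Rightarrow> nat)" and u: "u \<in> S" "(\<lambda>k. J (U (r k))) \<longlonglongrightarrow> J u"
    using comp[OF U(1)] by blast
  have "(\<lambda>k. J (U k)) \<longlonglongrightarrow> m"
  proof (rule tendsto_sandwich[OF _ _ tendsto_const])
    show "\<forall>\<^sub>F k in sequentially. m \<le> J (U k)" using U(1) m_le by simp
    show "\<forall>\<^sub>F k in sequentially. J (U k) \<le> m + 1 / real (Suc k)"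
      using U(2) by (intro always_eventually allI less_imp_le)
    show "(\<lambda>k. m + 1 / real (Suc k)) \<longlonglongrightarrow> m"
      using tendsto_add[OF tendsto_const LIMSEQ_inverse_real_of_nat, of m] by (simp add: inverse_eq_divide)
  qed
  from LIMSEQ_subseq_LIMSEQ[OF this r] have "(\<lambda>k. J (U (r k))) \<longlonglongrightarrow> m" by (simp add: comp_def)
  then have "J u = m" using u(2) by (rule LIMSEQ_unique[rotated])
  then show ?thesis using u(1) m_le by auto
qed

theorem theorem2p2:
  fixes T :: real
    and \<Delta> :: "(real^'m::finite) set"
    and f :: "real^'n::finite \<Rightarrow> real^'m \<Rightarrow> real \<Rightarrow> real^'n"
    and \<phi> :: "real^'n \<Rightarrow> real \<Rightarrow> real"
    and P :: "'w measure"
    and a :: "'w \<Rightarrow> real^'n"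
    and \<rho>\<^sub>0 :: "real^'n \<Rightarrow> real"
  assumes "T > 0"
    and "\<Delta> \<noteq> {}"
    and "compact \<Delta>"
    and "prob_space P"
    and "\<And>x. \<rho>\<^sub>0 x \<ge> 0"
    and "distributed P lborel a (\<lambda>x. ennreal (\<rho>\<^sub>0 x))"
    and "in_L2 \<rho>\<^sub>0"
    and "condition_I \<Delta> T f"
    and "in_L1_L2 T \<phi>"
  shows "\<exists>u_hat\<in>relaxed_controls \<Delta> T. \<forall>u\<in>relaxed_controls \<Delta> T.
           cost P a f \<phi> T u_hat \<le> cost P a f \<phi> T u"
proof -
  have T: "T \<ge> 0" using assms(1) by simp
  obtain C K where K: "K \<ge> 0"
    and flow_all: "\<forall>u\<in>relaxed_controls \<Delta> T. trajectory f T u \<in> lipschitz_flows T C K"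
    and comp: "\<forall>U. (\<forall>k. U k \<in> relaxed_controls \<Delta> T) \<longrightarrow>
      (\<exists>r. strict_mono (r :: nat \<Rightarrow> nat) \<and> (\<exists>u\<in>relaxed_controls \<Delta> T. \<forall>x. \<forall>t\<in>{0..T}.
        (\<lambda>k. trajectory f T (U (r k)) x t) \<longlonglongrightarrow> trajectory f T u x t))"
    by (rule relaxed_flow[OF T assms(3,2,8)])
  interpret prob_space P by fact
  interpret random_initial_value P a \<rho>\<^sub>0 T C K
    by unfold_locales (use T K assms in auto)
  have flow: "trajectory f T u \<in> flow_class" if "u \<in> relaxed_controls \<Delta> T" for u
    using flow_all that by blast
  obtain h :: "(real^'n) \<times> real \<Rightarrow> real" where h: "h \<in> borel_measurable borel"
    and eq: "AE p in lborel. snd p \<in> {0..T} \<longrightarrow> \<phi> (fst p) (snd p) = h p"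
    and fin: "AE t in time_measure T. (\<integral>\<^sup>+x. ennreal ((h (x, t))\<^sup>2) \<partial>lborel) < \<infinity>"
    and int: "(\<integral>\<^sup>+t. ennreal (slice_norm h t) \<partial>time_measure T) < \<infinity>"
    by (rule L1_L2_borel_version[OF assms(9)])
  have cost: "cost P a f \<phi> T u = (LINT p|QT. h (transport (trajectory f T u) p))"
    if "u \<in> relaxed_controls \<Delta> T" for u
    unfolding cost_def by (rule iterated_integral_eq_transport_integral[OF flow[OF that] h eq fin int])
  obtain v0 where v0: "v0 \<in> \<Delta>" using assms(2) by blast
  show ?thesis
  proof (rule attains_infimum_if_sequentially_compact)
    have "(\<lambda>_. return (restrict_space borel \<Delta>) v0) \<in> control_kernels \<Delta> T"
      using v0 by (intro measurable_const)
        (auto simp: space_prob_algebra space_restrict_space intro!: prob_space_return)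
    then show "relaxed_controls \<Delta> T \<noteq> {}"
      using control_kernel_is_relaxed_control[OF assms(3)] by blast
    define S where "S = enn2real (\<integral>\<^sup>+t. ennreal (slice_norm h t) \<partial>time_measure T)"
    have S: "(\<integral>\<^sup>+t. ennreal (slice_norm h t) \<partial>time_measure T) = ennreal S" "S \<ge> 0"
      using int by (simp_all add: S_def)
    show "\<bar>cost P a f \<phi> T u\<bar> \<le> transport_bound * S" if "u \<in> relaxed_controls \<Delta> T" for u
      unfolding cost[OF that] by (rule transport_integral_bound[OF flow[OF that] h fin]) (simp_all add: S)
    fix U :: "nat \<Rightarrow> real \<Rightarrow> (real^'m) measure" assume U: "\<forall>k. U k \<in> relaxed_controls \<Delta> T"
    then obtain r u where r: "strict_mono (r :: nat \<Rightarrow> nat)" and u: "u \<in> relaxed_controls \<Delta> T"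
      and lim: "\<forall>x. \<forall>t\<in>{0..T}. (\<lambda>k. trajectory f T (U (r k)) x t) \<longlonglongrightarrow> trajectory f T u x t"
      using comp by blast
    have "(\<lambda>k. LINT p|QT. h (transport (trajectory f T (U (r k))) p)) \<longlonglongrightarrow> (LINT p|QT. h (transport (trajectory f T u) p))"
      by (rule transport_integral_convergence[OF flow flow[OF u] _ h fin int]) (use U lim in auto)
    then have "(\<lambda>k. cost P a f \<phi> T (U (r k))) \<longlonglongrightarrow> cost P a f \<phi> T u"
      using cost U u by simp
    then show "\<exists>r. strict_mono (r :: nat \<Rightarrow> nat) \<and> (\<exists>u\<in>relaxed_controls \<Delta> T. (\<lambda>k. cost P a f \<phi> T (U (r k))) \<longlonglongrightarrow> cost P a f \<phi> T u)"
      using r u by blast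
  qed
qed

end
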